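(* Let $R$ be a commutative unital ring and let $M$ be a finitely generated $R$-module, topologized with the induced Zariski topology. Let $S_M=\{\mathfrak{m}\in \mathrm{mSpec}(R):\dim_{R/\mathfrak{m}}(M/\mathfrak{m}M)\geq2\}$, assume $R/\mathfrak{m}$ is infinite for every $\mathfrak{m}\in S_M$, and let $T=R\setminus\bigcup_{\mathfrak{m}\in S_M}\mathfrak{m}$. If $M$ is a $\kappa$-Baire space with its induced Zariski topology (for any infinite cardinal $\kappa$), then the $T^{-1}R$-module $T^{-1}M$, with its induced Zariski topology, is also a $\kappa$-Baire space.
   Context: $\mathrm{mSpec}(A)$ is the set of maximal ideals of a ring $A$. $T^{-1}R$ and $T^{-1}M$ denote localization at the multiplicative set $T$. Induced Zariski topology on a finite-dimensional vector space $V$ over a field $\mathbf{K}$: identify $V$ with $\mathbf{K}^n$ by a basis; closed sets are the common zero sets of families of polynomials in $\mathbf{K}[X_1,\dots,X_n]$ (independent of the basis). Induced Zariski topology on a finitely generated module $N$ over a commutative unital ring $A$ (used for $(A,N)=(R,M)$ and $(A,N)=(T^{-1}R,T^{-1}M)$): let $S_N=\{\mathfrak{n}\in\mathrm{mSpec}(A):\dim_{A/\mathfrak{n}}(N/\mathfrak{n}N)\ge 2\}$. Topologize each $N/\mathfrak{n}N$ with the induced Zariski topology as an $A/\mathfrak{n}$-vector space if $\mathfrak{n}\in S_N$, and with the topology whose only closed sets are $\emptyset,\{0\},N/\mathfrak{n}N$ if $\mathfrak{n}\notin S_N$; give $\prod_{\mathfrak{n}\in\mathrm{mSpec}(A)}N/\mathfrak{n}N$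 the product topology; and give $N$ the coarsest topology making the natural map $N\to\prod_{\mathfrak{n}\in\mathrm{mSpec}(A)}N/\mathfrak{n}N$ continuous. For a cardinal $\kappa$, a space $X$ is a $\kappa$-Baire space if for every collection $\{\mathcal{O}_i\}_{i\in I}$ of dense open subsets of $X$ with $|I|<\kappa$, the intersection $\bigcap_{i\in I}\mathcal{O}_i$ is dense in $X$. *)

theory Defs
  imports
    "HOL-Analysis.Function_Topology"
    "HOL-Algebra.Indexed_Polynomials"
    "Jordan_Normal_Form.Missing_VectorSpace"
begin

section \<open>Residue modules at maximal ideals\<close>

definition mSpec :: "('a, 'r) ring_scheme \<Rightarrow> 'a set set" where
  "mSpec R = {I. maximalideal I R}"

definition finitely_generated_module ::
    "('a, 'r) ring_scheme \<Rightarrow> ('a, 'b, 'm) module_scheme \<Rightarrow> bool" where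
  "finitely_generated_module R M \<longleftrightarrow>
     (\<exists>A. finite A \<and> A \<subseteq> carrier M \<and> module.span R M A = carrier M)"

definition ideal_smult ::
    "('a, 'r) ring_scheme \<Rightarrow> ('a, 'b, 'm) module_scheme \<Rightarrow> 'a set \<Rightarrow> 'b set" where
  "ideal_smult R M I = module.span R M {a \<odot>\<^bsub>M\<^esub> x | a x. a \<in> I \<and> x \<in> carrier M}"

text \<open>
  The quotient \<open>M/IM\<close> as a module over \<^term>\<open>R Quot I\<close>. The fields \<^const>\<open>mult\<close> and
  \<^const>\<open>one\<close>, which a module record inherits from the ring record, carry no meaning.
\<close>

definition residue_module ::
    "('a, 'r) ring_scheme \<Rightarrow> ('a, 'b, 'm) module_scheme \<Rightarrow> 'a set \<Rightarrow> ('a set, 'b set) module" where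
  "residue_module R M I =
     \<lparr>carrier = a_rcosets\<^bsub>M\<^esub> (ideal_smult R M I),
      monoid.mult = (\<lambda>_ _. ideal_smult R M I),
      one = ideal_smult R M I,
      zero = ideal_smult R M I,
      add = set_add M,
      smult = (\<lambda>C Y. \<Union>a\<in>C. \<Union>x\<in>Y. ideal_smult R M I +>\<^bsub>M\<^esub> (a \<odot>\<^bsub>M\<^esub> x))\<rparr>"

definition mSpec_ge2 ::
    "('a, 'r) ring_scheme \<Rightarrow> ('a, 'b, 'm) module_scheme \<Rightarrow> 'a set set" where
  "mSpec_ge2 R M = {I \<in> mSpec R. 2 \<le> vectorspace.dim (R Quot I) (residue_module R M I)}"


section \<open>Zariski topologies\<close>

text \<open>
  Meaningful only if \<open>\<C>\<close> satisfies the axioms for closed sets, as in the following lemma.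
\<close>

definition topology_of_closed :: "'a set \<Rightarrow> 'a set set \<Rightarrow> 'a topology" where
  "topology_of_closed Y \<C> = topology (\<lambda>U. U \<subseteq> Y \<and> Y - U \<in> \<C>)"

lemma
  assumes sub: "\<And>C. C \<in> \<C> \<Longrightarrow> C \<subseteq> Y"
    and empty: "{} \<in> \<C>"
    and Un: "\<And>C D. C \<in> \<C> \<Longrightarrow> D \<in> \<C> \<Longrightarrow> C \<union> D \<in> \<C>"
    and Int: "\<And>\<D>. \<D> \<subseteq> \<C> \<Longrightarrow> Y \<inter> \<Inter>\<D> \<in> \<C>"
  shows openin_topology_of_closed:
      "openin (topology_of_closed Y \<C>) U \<longleftrightarrow> U \<subseteq> Y \<and> Y - U \<in> \<C>"
    and topspace_topology_of_closed: "topspace (topology_of_closed Y \<C>) = Y"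
    and closedin_topology_of_closed: "closedin (topology_of_closed Y \<C>) C \<longleftrightarrow> C \<in> \<C>"
proof -
  have "istopology (\<lambda>U. U \<subseteq> Y \<and> Y - U \<in> \<C>)"
    unfolding istopology_def
  proof (intro conjI allI impI)
    fix S T assume "S \<subseteq> Y \<and> Y - S \<in> \<C>" "T \<subseteq> Y \<and> Y - T \<in> \<C>"
    then show "S \<inter> T \<subseteq> Y" "Y - S \<inter> T \<in> \<C>"
      using Un by (auto simp: Diff_Int)
  next
    fix \<K> assume K: "\<forall>K\<in>\<K>. K \<subseteq> Y \<and> Y - K \<in> \<C>"
    then show "\<Union>\<K> \<subseteq> Y" by blast
    have "Y - \<Union>\<K> = Y \<inter> \<Inter>((\<lambda>K. Y - K) ` \<K>)" by auto
    also have "\<dots> \<in> \<C>" by (rule Int) (use K in auto)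
    finally show "Y - \<Union>\<K> \<in> \<C>" .
  qed
  then show op: "openin (topology_of_closed Y \<C>) U \<longleftrightarrow> U \<subseteq> Y \<and> Y - U \<in> \<C>" for U
    by (simp add: topology_of_closed_def topology_inverse')
  show top: "topspace (topology_of_closed Y \<C>) = Y"
    using op empty by (fastforce simp: topspace_def)
  show "closedin (topology_of_closed Y \<C>) C \<longleftrightarrow> C \<in> \<C>"
    using sub unfolding closedin_def top op by (auto simp: double_diff)
qed

text \<open>
  Polynomials over \<open>K\<close> in variables indexed by \<open>I\<close> are the elements of
  \<^term>\<open>ring.indexed_pset K I (carrier K)\<close>: they map a monomial, represented as a multiset of
  indices, to its coefficient.
\<close>

definition poly_value :: "('k, 'r) ring_scheme \<Rightarrow> ('i multiset \<Rightarrow> 'k) \<Rightarrow> ('i \<Rightarrow> 'k) \<Rightarrow> 'k" where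
  "poly_value K P c =
     (\<Oplus>\<^bsub>K\<^esub>m\<in>{m. P m \<noteq> \<zero>\<^bsub>K\<^esub>}. P m \<otimes>\<^bsub>K\<^esub> (\<Otimes>\<^bsub>K\<^esub>i\<in>set_mset m. c i [^]\<^bsub>K\<^esub> count m i))"

text \<open>
  A basis \<open>B\<close> of \<open>V\<close> identifies a coordinate vector \<open>c \<in> B \<rightarrow>\<^sub>E carrier K\<close> with the
  vector \<^term>\<open>module.lincomb V c B\<close>; the variables of the polynomials are indexed by \<open>B\<close>.
\<close>

definition zero_locus ::
    "('k, 'r) ring_scheme \<Rightarrow> ('k, 'v, 'm) module_scheme \<Rightarrow> 'v set \<Rightarrow> ('v multiset \<Rightarrow> 'k) set \<Rightarrow> 'v set"
    where
  "zero_locus K V B F =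
     {module.lincomb V c B | c. c \<in> B \<rightarrow>\<^sub>E carrier K \<and> (\<forall>P\<in>F. poly_value K P c = \<zero>\<^bsub>K\<^esub>)}"

definition zariski_topology_wrt ::
    "('k, 'r) ring_scheme \<Rightarrow> ('k, 'v, 'm) module_scheme \<Rightarrow> 'v set \<Rightarrow> 'v topology" where
  "zariski_topology_wrt K V B =
     topology_of_closed (carrier V)
       {zero_locus K V B F | F. F \<subseteq> ring.indexed_pset K B (carrier K)}"

text \<open>
  A linear change of coordinates turns polynomials into polynomials, so the topology does not depend
  on the basis that is chosen.
\<close>

definition zariski_topology ::
    "('k, 'r) ring_scheme \<Rightarrow> ('k, 'v, 'm) module_scheme \<Rightarrow> 'v topology" where
  "zariski_topology K V =
     zariski_topology_wrt K V (SOME B. finite B \<and> vectorspace.basis K V B)"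

definition residue_topology ::
    "('a, 'r) ring_scheme \<Rightarrow> ('a, 'b, 'm) module_scheme \<Rightarrow> 'a set \<Rightarrow> 'b set topology" where
  "residue_topology R M I =
     (let V = residue_module R M I in
      if I \<in> mSpec_ge2 R M then zariski_topology (R Quot I) V
      else topology_of_closed (carrier V) {{}, {\<zero>\<^bsub>V\<^esub>}, carrier V})"

definition induced_zariski_topology ::
    "('a, 'r) ring_scheme \<Rightarrow> ('a, 'b, 'm) module_scheme \<Rightarrow> 'b topology" where
  "induced_zariski_topology R M =
     pullback_topology (carrier M)
       (\<lambda>x. \<lambda>I\<in>mSpec R. ideal_smult R M I +>\<^bsub>M\<^esub> x)
       (product_topology (residue_topology R M) (mSpec R))"


section \<open>Localization\<close>

definition loc_ring_rel :: "('a, 'r) ring_scheme \<Rightarrow> 'a set \<Rightarrow> (('a \<times> 'a) \<times> ('a \<times> 'a)) set" where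
  "loc_ring_rel R T =
     {((a, s), (b, t)). a \<in> carrier R \<and> b \<in> carrier R \<and> s \<in> T \<and> t \<in> T \<and>
        (\<exists>u\<in>T. u \<otimes>\<^bsub>R\<^esub> (t \<otimes>\<^bsub>R\<^esub> a) = u \<otimes>\<^bsub>R\<^esub> (s \<otimes>\<^bsub>R\<^esub> b))}"

definition ring_frac :: "('a, 'r) ring_scheme \<Rightarrow> 'a set \<Rightarrow> 'a \<Rightarrow> 'a \<Rightarrow> ('a \<times> 'a) set" where
  "ring_frac R T a s = loc_ring_rel R T `` {(a, s)}"

definition localization_ring :: "('a, 'r) ring_scheme \<Rightarrow> 'a set \<Rightarrow> ('a \<times> 'a) set ring" where
  "localization_ring R T =
     \<lparr>carrier = (carrier R \<times> T) // loc_ring_rel R T,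
      monoid.mult = (\<lambda>Y Z. \<Union>(a, s)\<in>Y. \<Union>(b, t)\<in>Z. ring_frac R T (a \<otimes>\<^bsub>R\<^esub> b) (s \<otimes>\<^bsub>R\<^esub> t)),
      one = ring_frac R T \<one>\<^bsub>R\<^esub> \<one>\<^bsub>R\<^esub>,
      zero = ring_frac R T \<zero>\<^bsub>R\<^esub> \<one>\<^bsub>R\<^esub>,
      add = (\<lambda>Y Z. \<Union>(a, s)\<in>Y. \<Union>(b, t)\<in>Z.
               ring_frac R T (t \<otimes>\<^bsub>R\<^esub> a \<oplus>\<^bsub>R\<^esub> s \<otimes>\<^bsub>R\<^esub> b) (s \<otimes>\<^bsub>R\<^esub> t))\<rparr>"

definition loc_module_rel ::
    "('a, 'r) ring_scheme \<Rightarrow> ('a, 'b, 'm) module_scheme \<Rightarrow> 'a set \<Rightarrow> (('b \<times> 'a) \<times> ('b \<times> 'a)) set" where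
  "loc_module_rel R M T =
     {((x, s), (y, t)). x \<in> carrier M \<and> y \<in> carrier M \<and> s \<in> T \<and> t \<in> T \<and>
        (\<exists>u\<in>T. u \<odot>\<^bsub>M\<^esub> (t \<odot>\<^bsub>M\<^esub> x) = u \<odot>\<^bsub>M\<^esub> (s \<odot>\<^bsub>M\<^esub> y))}"

definition module_frac ::
    "('a, 'r) ring_scheme \<Rightarrow> ('a, 'b, 'm) module_scheme \<Rightarrow> 'a set \<Rightarrow> 'b \<Rightarrow> 'a \<Rightarrow> ('b \<times> 'a) set" where
  "module_frac R M T x s = loc_module_rel R M T `` {(x, s)}"

text \<open>As above, the fields \<^const>\<open>mult\<close> and \<^const>\<open>one\<close> carry no meaning.\<close>

definition localization_module ::
    "('a, 'r) ring_scheme \<Rightarrow> ('a, 'b, 'm) module_scheme \<Rightarrow> 'a set \<Rightarrow>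
     (('a \<times> 'a) set, ('b \<times> 'a) set) module" where
  "localization_module R M T =
     \<lparr>carrier = (carrier M \<times> T) // loc_module_rel R M T,
      monoid.mult = (\<lambda>_ _. module_frac R M T \<zero>\<^bsub>M\<^esub> \<one>\<^bsub>R\<^esub>),
      one = module_frac R M T \<zero>\<^bsub>M\<^esub> \<one>\<^bsub>R\<^esub>,
      zero = module_frac R M T \<zero>\<^bsub>M\<^esub> \<one>\<^bsub>R\<^esub>,
      add = (\<lambda>Y Z. \<Union>(x, s)\<in>Y. \<Union>(y, t)\<in>Z.
               module_frac R M T (t \<odot>\<^bsub>M\<^esub> x \<oplus>\<^bsub>M\<^esub> s \<odot>\<^bsub>M\<^esub> y) (s \<otimes>\<^bsub>R\<^esub> t)),
      smult = (\<lambda>C Y. \<Union>(a, s)\<in>C. \<Union>(x, t)\<in>Y.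
               module_frac R M T (a \<odot>\<^bsub>M\<^esub> x) (s \<otimes>\<^bsub>R\<^esub> t))\<rparr>"


section \<open>Baire spaces\<close>

text \<open>
  Membership in \<^const>\<open>ordLess\<close> expresses \<open>|\<O>| < \<kappa>\<close>. The field of the cardinal \<open>\<kappa>\<close> may
  have any type, so \<open>\<kappa>\<close> is not bounded by the cardinality of the space. Sets of open sets replace
  indexed families: the range of a family is no larger than its index set. The intersection with
  \<^term>\<open>topspace Y\<close> only matters for empty \<open>\<O>\<close>.
\<close>

definition kappa_Baire_space :: "'k rel \<Rightarrow> 'a topology \<Rightarrow> bool" where
  "kappa_Baire_space \<kappa> Y \<longleftrightarrow>
     (\<forall>\<O>. (card_of \<O>, \<kappa>) \<in> ordLess \<and>
          (\<forall>U\<in>\<O>. openin Y U \<and> Y closure_of U = topspace Y) \<longrightarrow>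
          Y closure_of (topspace Y \<inter> \<Inter>\<O>) = topspace Y)"

end

theory Submission
  imports Defs
begin

text \<open>
  Let \<open>S = mSpec_ge2 R M\<close>, let \<open>J\<close> be the intersection of \<open>S\<close>, and let \<open>\<phi> : M \<rightarrow> T^-1 M\<close> be the map
  \<open>x \<mapsto> x/1\<close>. Up to points that no open set distinguishes, \<open>T^-1 M\<close> is \<open>M\<close> with a coarser topology,
  which forgets maximal ideals outside \<open>S\<close>. The Baire property passes to this coarser topology because its
  dense open sets remain dense in the topology of \<open>M\<close>.

  \<^item> \<open>S\<close> is closed in the maximal spectrum: each maximal ideal containing \<open>J\<close> belongs to \<open>S\<close>. This
    follows from a local form of Nakayama's lemma (\<open>ex_in_Inter_mSpec_ge2\<close>). Consequently the elements
    of \<open>T\<close> are units modulo \<open>J\<close> (\<open>inverse_mod_mSpec_ge2\<close>), and each maximal ideal \<open>n\<close> of \<open>T^-1 R\<close>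
    contracts to some \<open>m\<close> in \<open>S\<close> (\<open>contraction_mSpec_ge2\<close>).

  \<^item> For such \<open>n\<close> and \<open>m\<close>, the map \<open>\<phi>\<close> induces a bijection between \<open>M/mM\<close> and the residue space of
    \<open>T^-1 M\<close> at \<open>n\<close>. It is linear along the isomorphism of the residue fields
    (\<open>semilinear_bijection_residue_map\<close>), and therefore a homeomorphism of Zariski topologies
    (\<open>zariski_homeomorphic_map\<close>). As the inverses of the elements of \<open>T\<close> exist modulo \<open>J\<close>, not just
    modulo each \<open>m\<close> separately, \<open>M\<close> and \<open>T^-1 M\<close> have the same image in the product of these
    residue spaces.

  \<^item> A nonempty basic open set of \<open>M\<close> restricts the residue classes at finitely many maximal ideals. By the
    Chinese remainder theorem (\<open>residue_approximation\<close>) the restrictions at ideals that are not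
    contractions can be met without disturbing the residue classes at finitely many contractions.
    So the preimage under \<open>\<phi>\<close> of a dense open set is dense (\<open>dense_vimage\<close>), and the Baire property
    is transferred along \<open>\<phi>\<close> (\<open>kappa_Baire_transfer\<close>).
\<close>

section \<open>Evaluation of polynomials\<close>

definition monomial_value :: "('k, 'r) ring_scheme \<Rightarrow> ('i \<Rightarrow> 'k) \<Rightarrow> 'i multiset \<Rightarrow> 'k" where
  "monomial_value K c m = (\<Otimes>\<^bsub>K\<^esub>i\<in>set_mset m. c i [^]\<^bsub>K\<^esub> count m i)"

text \<open>
  Every polynomial in \<open>indexed_pset B (carrier K)\<close> satisfies this; it makes the sum that defines
  \<^const>\<open>poly_value\<close> finite and all its monomials evaluable at points of \<open>B \<rightarrow> carrier K\<close>.
\<close>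

definition finite_coeff :: "('k, 'r) ring_scheme \<Rightarrow> 'i set \<Rightarrow> ('i multiset \<Rightarrow> 'k) \<Rightarrow> bool" where
  "finite_coeff K B P \<longleftrightarrow> (\<forall>m. P m \<in> carrier K) \<and> finite {m. P m \<noteq> \<zero>\<^bsub>K\<^esub>} \<and>
     (\<forall>m. P m \<noteq> \<zero>\<^bsub>K\<^esub> \<longrightarrow> set_mset m \<subseteq> B)"

context cring
begin

lemma monomial_value_closed:
  assumes "c \<in> B \<rightarrow> carrier R" "set_mset m \<subseteq> B"
  shows "monomial_value R c m \<in> carrier R"
  unfolding monomial_value_def using assms by (intro finprod_closed) auto

lemma monomial_value_add_mset:
  assumes c: "c \<in> B \<rightarrow> carrier R" and m: "set_mset m \<subseteq> B" and i: "i \<in> B"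
  shows "monomial_value R c (add_mset i m) = monomial_value R c m \<otimes> c i"
proof (cases "i \<in># m")
  case False
  then have [simp]: "count m i = 0" by (simp add: count_eq_zero_iff)
  have "monomial_value R c (add_mset i m) =
      (\<Otimes>j\<in>insert i (set_mset m). c j [^] count (add_mset i m) j)"
    by (simp add: monomial_value_def)
  also have "\<dots> = c i [^] count (add_mset i m) i \<otimes>
      (\<Otimes>j\<in>set_mset m. c j [^] count (add_mset i m) j)"
    using False assms by (intro finprod_insert) auto
  also have "(\<Otimes>j\<in>set_mset m. c j [^] count (add_mset i m) j) = monomial_value R c m"
    unfolding monomial_value_def using False assms by (intro finprod_cong') auto
  finally show ?thesis
    using c i monomial_value_closed[OF c m] by (simp add: m_comm Pi_iff)
next
  case True
  define A where "A = set_mset m - {i}"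
  have A: "set_mset m = insert i A" "i \<notin> A" "finite A" "A \<subseteq> B"
    using True m by (auto simp: A_def)
  have ci: "c i \<in> carrier R" using c i by auto
  have cl: "(\<lambda>j. c j [^] count m j) \<in> A \<rightarrow> carrier R" using c A by auto
  have s: "set_mset (add_mset i m) = insert i A" using A by auto
  have "monomial_value R c (add_mset i m) =
      c i [^] Suc (count m i) \<otimes> (\<Otimes>j\<in>A. c j [^] count (add_mset i m) j)"
    unfolding monomial_value_def s using A c ci by (subst finprod_insert) auto
  also have "(\<Otimes>j\<in>A. c j [^] count (add_mset i m) j) = (\<Otimes>j\<in>A. c j [^] count m j)"
    using A c by (intro finprod_cong') auto
  also have "c i [^] Suc (count m i) \<otimes> (\<Otimes>j\<in>A. c j [^] count m j) =
      (c i [^] count m i \<otimes> (\<Otimes>j\<in>A. c j [^] count m j)) \<otimes> c i"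
    using ci finprod_closed[OF cl] by (simp add: m_ac)
  also have "c i [^] count m i \<otimes> (\<Otimes>j\<in>A. c j [^] count m j) = monomial_value R c m"
    unfolding monomial_value_def A(1) using A cl ci by (subst finprod_insert) auto
  finally show ?thesis .
qed

text \<open>
  Summing over a set \<open>S\<close> larger than the support lets two polynomials be evaluated over a common
  index set, as the addition of values requires.
\<close>

lemma poly_value_eq_finsum:
  assumes "finite_coeff R B P" "c \<in> B \<rightarrow> carrier R" "finite S" "{m. P m \<noteq> \<zero>} \<subseteq> S"
    "\<And>m. m \<in> S \<Longrightarrow> set_mset m \<subseteq> B"
  shows "poly_value R P c = (\<Oplus>m\<in>S. P m \<otimes> monomial_value R c m)"
  unfolding poly_value_def monomial_value_def[symmetric]
proof (rule add.finprod_mono_neutral_cong_left)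
  show "\<And>m. m \<in> S - {m. P m \<noteq> \<zero>} \<Longrightarrow> P m \<otimes> monomial_value R c m = \<zero>"
    using assms monomial_value_closed[OF assms(2)] by auto
  show "(\<lambda>m. P m \<otimes> monomial_value R c m) \<in> S \<rightarrow> carrier R"
    using assms monomial_value_closed[OF assms(2)] by (auto simp: finite_coeff_def)
qed (use assms in auto)

lemma finite_coeff_const: "k \<in> carrier R \<Longrightarrow> finite_coeff R B (indexed_const k)"
  using finite_subset[of "{m. indexed_const k m \<noteq> \<zero>}" "{{#}}"]
  unfolding finite_coeff_def by (auto simp: indexed_const_def split: if_splits)

lemma support_padd:
  assumes "\<And>m. P m \<in> carrier R" "\<And>m. Q m \<in> carrier R"
  shows "{m. indexed_padd P Q m \<noteq> \<zero>} \<subseteq> {m. P m \<noteq> \<zero>} \<union> {m. Q m \<noteq> \<zero>}"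
  using assms by (auto simp: indexed_padd_def)

lemma finite_coeff_padd:
  assumes "finite_coeff R B P" "finite_coeff R B Q"
  shows "finite_coeff R B (indexed_padd P Q)"
proof -
  have "{m. indexed_padd P Q m \<noteq> \<zero>} \<subseteq> {m. P m \<noteq> \<zero>} \<union> {m. Q m \<noteq> \<zero>}"
    using assms by (intro support_padd) (auto simp: finite_coeff_def)
  then have "finite {m. indexed_padd P Q m \<noteq> \<zero>}"
    using assms by (auto simp: finite_coeff_def intro: finite_subset)
  moreover have "set_mset m \<subseteq> B" if "indexed_padd P Q m \<noteq> \<zero>" for m
  proof -
    have "P m \<noteq> \<zero> \<or> Q m \<noteq> \<zero>" using that by (auto simp: indexed_padd_def)
    then show ?thesis using assms unfolding finite_coeff_def by blast
  qed
  ultimately show ?thesis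
    using assms unfolding finite_coeff_def by (simp add: indexed_padd_def)
qed

lemma support_pmult:
  "{m. indexed_pmult P i m \<noteq> \<zero>} = add_mset i ` {m. P m \<noteq> \<zero>}"
proof -
  have "m \<in> add_mset i ` {m. P m \<noteq> \<zero>}" if "indexed_pmult P i m \<noteq> \<zero>" for m
    using that by (intro image_eqI[of _ _ "m - {#i#}"]) (auto simp: indexed_pmult_def split: if_splits)
  then show ?thesis by (auto simp: indexed_pmult_def)
qed

lemma finite_coeff_pmult:
  assumes "finite_coeff R B P" "i \<in> B"
  shows "finite_coeff R B (indexed_pmult P i)"
proof -
  have "\<forall>m\<in>{m. indexed_pmult P i m \<noteq> \<zero>}. set_mset m \<subseteq> B"
    unfolding support_pmult using assms by (auto simp: finite_coeff_def)
  moreover have "finite {m. indexed_pmult P i m \<noteq> \<zero>}"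
    unfolding support_pmult using assms by (auto simp: finite_coeff_def)
  moreover have "\<forall>m. indexed_pmult P i m \<in> carrier R"
    using assms by (auto simp: finite_coeff_def indexed_pmult_def)
  ultimately show ?thesis unfolding finite_coeff_def by auto
qed

lemma finite_coeff_indexed_pset:
  "P \<in> indexed_pset B (carrier R) \<Longrightarrow> finite_coeff R B P"
  by (induction rule: indexed_pset.induct)
    (auto intro: finite_coeff_const finite_coeff_padd finite_coeff_pmult)

lemma poly_value_closed:
  assumes "finite_coeff R B P" "c \<in> B \<rightarrow> carrier R"
  shows "poly_value R P c \<in> carrier R"
  unfolding poly_value_def monomial_value_def[symmetric]
  using assms monomial_value_closed[OF assms(2)]
  by (intro finsum_closed) (auto simp: finite_coeff_def)

lemma poly_value_const:
  assumes "k \<in> carrier R" "c \<in> B \<rightarrow> carrier R"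
  shows "poly_value R (indexed_const k) c = k"
proof -
  have "poly_value R (indexed_const k) c = (\<Oplus>m\<in>{{#}}. indexed_const k m \<otimes> monomial_value R c m)"
    using assms by (intro poly_value_eq_finsum[OF finite_coeff_const])
      (auto simp: indexed_const_def split: if_splits)
  also have "\<dots> = k"
    using assms by (simp add: finsum_insert indexed_const_def monomial_value_def)
  finally show ?thesis .
qed

lemma poly_value_padd:
  assumes P: "finite_coeff R B P" and Q: "finite_coeff R B Q" and c: "c \<in> B \<rightarrow> carrier R"
  shows "poly_value R (indexed_padd P Q) c = poly_value R P c \<oplus> poly_value R Q c"
proof -
  define S where "S = {m. P m \<noteq> \<zero>} \<union> {m. Q m \<noteq> \<zero>}"
  have S: "finite S" "\<And>m. m \<in> S \<Longrightarrow> set_mset m \<subseteq> B"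
    using P Q by (auto simp: S_def finite_coeff_def)
  note mv = monomial_value_closed[OF c S(2)]
  have PQ: "P m \<in> carrier R" "Q m \<in> carrier R" for m using P Q by (auto simp: finite_coeff_def)
  have "poly_value R (indexed_padd P Q) c = (\<Oplus>m\<in>S. indexed_padd P Q m \<otimes> monomial_value R c m)"
    using S support_padd[of P Q] PQ
    by (intro poly_value_eq_finsum[OF finite_coeff_padd[OF P Q] c]) (auto simp: S_def)
  also have "\<dots> = (\<Oplus>m\<in>S. P m \<otimes> monomial_value R c m \<oplus> Q m \<otimes> monomial_value R c m)"
    using PQ mv by (intro finsum_cong') (auto simp: indexed_padd_def l_distr)
  also have "\<dots> = (\<Oplus>m\<in>S. P m \<otimes> monomial_value R c m) \<oplus> (\<Oplus>m\<in>S. Q m \<otimes> monomial_value R c m)"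
    using PQ mv by (intro finsum_addf) auto
  also have "(\<Oplus>m\<in>S. P m \<otimes> monomial_value R c m) = poly_value R P c"
    using S by (intro poly_value_eq_finsum[OF P c, symmetric]) (auto simp: S_def)
  also have "(\<Oplus>m\<in>S. Q m \<otimes> monomial_value R c m) = poly_value R Q c"
    using S by (intro poly_value_eq_finsum[OF Q c, symmetric]) (auto simp: S_def)
  finally show ?thesis .
qed

lemma poly_value_pmult:
  assumes P: "finite_coeff R B P" and i: "i \<in> B" and c: "c \<in> B \<rightarrow> carrier R"
  shows "poly_value R (indexed_pmult P i) c = poly_value R P c \<otimes> c i"
proof -
  define S where "S = {m. P m \<noteq> \<zero>}"
  have S: "finite S" "\<And>m. m \<in> S \<Longrightarrow> set_mset m \<subseteq> B"
    using P by (auto simp: S_def finite_coeff_def)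
  note mv = monomial_value_closed[OF c S(2)]
  have PQ: "P m \<in> carrier R" for m using P by (auto simp: finite_coeff_def)
  have ci: "c i \<in> carrier R" using c i by auto
  have mv': "m \<in> S \<Longrightarrow> monomial_value R c (add_mset i m) \<in> carrier R" for m
    using S(2) i by (intro monomial_value_closed[OF c]) auto
  have "poly_value R (indexed_pmult P i) c =
      (\<Oplus>m\<in>add_mset i ` S. indexed_pmult P i m \<otimes> monomial_value R c m)"
    unfolding poly_value_def monomial_value_def[symmetric] support_pmult S_def ..
  also have "\<dots> = (\<Oplus>m\<in>S. indexed_pmult P i (add_mset i m) \<otimes> monomial_value R c (add_mset i m))"
    using mv' PQ by (intro finsum_reindex) (auto simp: indexed_pmult_def inj_on_def)
  also have "\<dots> = (\<Oplus>m\<in>S. (P m \<otimes> monomial_value R c m) \<otimes> c i)"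
    using PQ mv ci S(2) i c
    by (intro finsum_cong') (auto simp: indexed_pmult_def monomial_value_add_mset[OF c] m_assoc)
  also have "\<dots> = (\<Oplus>m\<in>S. P m \<otimes> monomial_value R c m) \<otimes> c i"
    using PQ mv ci S by (intro finsum_ldistr[symmetric]) auto
  also have "(\<Oplus>m\<in>S. P m \<otimes> monomial_value R c m) = poly_value R P c"
    unfolding poly_value_def monomial_value_def[symmetric] S_def ..
  finally show ?thesis .
qed

definition represents :: "'i set \<Rightarrow> ('i multiset \<Rightarrow> 'a) \<Rightarrow> (('i \<Rightarrow> 'a) \<Rightarrow> 'a) \<Rightarrow> bool" where
  "represents B P h \<longleftrightarrow> P \<in> indexed_pset B (carrier R) \<and>
     (\<forall>c\<in>B \<rightarrow> carrier R. poly_value R P c = h c)"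

lemma represents_const: "k \<in> carrier R \<Longrightarrow> represents B (indexed_const k) (\<lambda>_. k)"
  by (auto simp: represents_def intro: indexed_pset.indexed_const poly_value_const)

lemma represents_add:
  "represents B P h \<Longrightarrow> represents B Q g \<Longrightarrow> represents B (indexed_padd P Q) (\<lambda>c. h c \<oplus> g c)"
  by (auto simp: represents_def poly_value_padd[of B] finite_coeff_indexed_pset
      intro: indexed_pset.indexed_padd)

lemma represents_pmult:
  "represents B P h \<Longrightarrow> i \<in> B \<Longrightarrow> represents B (indexed_pmult P i) (\<lambda>c. h c \<otimes> c i)"
  by (auto simp: represents_def poly_value_pmult[of B] finite_coeff_indexed_pset
      intro: indexed_pset.indexed_pmult)

lemma represents_cong:
  "represents B P h \<Longrightarrow> (\<And>c. c \<in> B \<rightarrow> carrier R \<Longrightarrow> h c = g c) \<Longrightarrow> represents B P g"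
  by (auto simp: represents_def)

lemma represents_closed: "represents B P h \<Longrightarrow> c \<in> B \<rightarrow> carrier R \<Longrightarrow> h c \<in> carrier R"
  using poly_value_closed finite_coeff_indexed_pset unfolding represents_def by metis

text \<open>
  \<^const>\<open>ring.indexed_pset\<close> is generated by constants, sums and multiplication by one variable
  only. Closure under general products therefore takes two inductions: this one, over the second
  factor when the first is a constant, and then one over the first factor.
\<close>

lemma ex_represents_smult:
  assumes Q: "Q \<in> indexed_pset B (carrier R)" and k: "k \<in> carrier R"
  shows "\<exists>S. represents B S (\<lambda>c. k \<otimes> poly_value R Q c)"
  using Q
proof (induction rule: indexed_pset.induct)
  case (indexed_const l)
  then show ?case
    using represents_cong[OF represents_const[of "k \<otimes> l"]] k
    by (metis m_closed poly_value_const)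
next
  case (indexed_padd P Q)
  then obtain S S' where S: "represents B S (\<lambda>c. k \<otimes> poly_value R P c)"
    "represents B S' (\<lambda>c. k \<otimes> poly_value R Q c)" by blast
  have fc: "finite_coeff R B P" "finite_coeff R B Q"
    using indexed_padd finite_coeff_indexed_pset by blast+
  show ?case
    by (rule exI, rule represents_cong[OF represents_add[OF S]])
      (simp add: fc poly_value_padd[of B] poly_value_closed[of B] k r_distr)
next
  case (indexed_pmult P i)
  then obtain S where S: "represents B S (\<lambda>c. k \<otimes> poly_value R P c)" by blast
  have fc: "finite_coeff R B P"
    using indexed_pmult finite_coeff_indexed_pset by blast+
  show ?case
    by (rule exI, rule represents_cong[OF represents_pmult[OF S indexed_pmult(2)]])
      (use indexed_pmult(2) in \<open>auto simp: fc poly_value_pmult[of B] poly_value_closed[of B] k m_assoc Pi_iff\<close>)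
qed

lemma ex_represents_mult:
  assumes P: "represents B P h" and Q: "represents B Q g"
  shows "\<exists>S. represents B S (\<lambda>c. h c \<otimes> g c)"
proof -
  have Q': "Q \<in> indexed_pset B (carrier R)" and P': "P \<in> indexed_pset B (carrier R)"
    using P Q by (auto simp: represents_def)
  note fQ = finite_coeff_indexed_pset[OF Q']
  from P' have "\<exists>S. represents B S (\<lambda>c. poly_value R P c \<otimes> poly_value R Q c)"
  proof (induction rule: indexed_pset.induct)
    case (indexed_const k)
    from ex_represents_smult[OF Q' this] obtain S
      where "represents B S (\<lambda>c. k \<otimes> poly_value R Q c)" ..
    then have "represents B S (\<lambda>c. poly_value R (indexed_const k) c \<otimes> poly_value R Q c)"
      by (rule represents_cong) (simp add: poly_value_const[of _ _ B] indexed_const)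
    then show ?case by blast
  next
    case (indexed_padd P P')
    then obtain S S' where S: "represents B S (\<lambda>c. poly_value R P c \<otimes> poly_value R Q c)"
      "represents B S' (\<lambda>c. poly_value R P' c \<otimes> poly_value R Q c)" by blast
    have fc: "finite_coeff R B P" "finite_coeff R B P'"
      using indexed_padd finite_coeff_indexed_pset by blast+
    show ?case
      by (rule exI, rule represents_cong[OF represents_add[OF S]])
        (simp add: fc fQ poly_value_padd[of B] poly_value_closed[of B] l_distr)
  next
    case (indexed_pmult P i)
    then obtain S where S: "represents B S (\<lambda>c. poly_value R P c \<otimes> poly_value R Q c)" by blast
    have fc: "finite_coeff R B P"
      using indexed_pmult finite_coeff_indexed_pset by blast+
    show ?case
      by (rule exI, rule represents_cong[OF represents_pmult[OF S indexed_pmult(2)]])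
        (use indexed_pmult(2) in
          \<open>auto simp: fc fQ poly_value_pmult[of B] poly_value_closed[of B] m_ac Pi_iff\<close>)
  qed
  then obtain S where "represents B S (\<lambda>c. poly_value R P c \<otimes> poly_value R Q c)" ..
  then have "represents B S (\<lambda>c. h c \<otimes> g c)"
    by (rule represents_cong) (use P Q in \<open>simp add: represents_def\<close>)
  then show ?thesis by blast
qed

lemma ex_represents_coordinate:
  assumes "b \<in> B" shows "\<exists>P. represents B P (\<lambda>c. c b)"
  by (rule exI, rule represents_cong[OF represents_pmult[OF represents_const[OF one_closed] assms]])
    (use assms in \<open>auto simp: Pi_iff\<close>)

lemma ex_represents_finsum:
  assumes "finite A" and "\<And>a. a \<in> A \<Longrightarrow> \<exists>P. represents B P (h a)"
  shows "\<exists>P. represents B P (\<lambda>c. \<Oplus>a\<in>A. h a c)"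
  using assms
proof (induction rule: finite_induct)
  case empty
  show ?case using represents_const[of \<zero>] by auto
next
  case (insert a A)
  then obtain P Q where PQ: "represents B P (h a)" "represents B Q (\<lambda>c. \<Oplus>a\<in>A. h a c)" by blast
  have "h x c \<in> carrier R" if "x \<in> insert a A" "c \<in> B \<rightarrow> carrier R" for x c
    using insert.prems that represents_closed by blast
  then have "(\<Oplus>a\<in>insert a A. h a c) = h a c \<oplus> (\<Oplus>a\<in>A. h a c)" if "c \<in> B \<rightarrow> carrier R" for c
    using insert.hyps that by (intro finsum_insert) auto
  then have "represents B (indexed_padd P Q) (\<lambda>c. \<Oplus>a\<in>insert a A. h a c)"
    by (intro represents_cong[OF represents_add[OF PQ]]) simp
  then show ?case by blast
qed

end

section \<open>The Zariski topology without a basis\<close>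

text \<open>
  The Zariski topology of a finite-dimensional vector space is described here by functions on the
  space itself: a polynomial in the coordinates with respect to some basis is the same as an
  expression built from constants and linear forms by sums and products. In this form the topology
  is visibly preserved by semilinear bijections, whatever bases are chosen on the two sides.
\<close>

definition linear_form ::
    "('k, 'r) ring_scheme \<Rightarrow> ('k, 'v, 'm) module_scheme \<Rightarrow> ('v \<Rightarrow> 'k) \<Rightarrow> bool" where
  "linear_form K V l \<longleftrightarrow> l \<in> carrier V \<rightarrow> carrier K \<and>
     (\<forall>x\<in>carrier V. \<forall>y\<in>carrier V. l (x \<oplus>\<^bsub>V\<^esub> y) = l x \<oplus>\<^bsub>K\<^esub> l y) \<and>
     (\<forall>k\<in>carrier K. \<forall>x\<in>carrier V. l (k \<odot>\<^bsub>V\<^esub> x) = k \<otimes>\<^bsub>K\<^esub> l x)"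

inductive polynomial_function ::
    "('k, 'r) ring_scheme \<Rightarrow> ('k, 'v, 'm) module_scheme \<Rightarrow> ('v \<Rightarrow> 'k) \<Rightarrow> bool"
    for K :: "('k, 'r) ring_scheme" and V :: "('k, 'v, 'm) module_scheme" where
  const: "k \<in> carrier K \<Longrightarrow> polynomial_function K V (\<lambda>_. k)"
| linear: "linear_form K V l \<Longrightarrow> polynomial_function K V l"
| add: "polynomial_function K V f \<Longrightarrow> polynomial_function K V g \<Longrightarrow>
    polynomial_function K V (\<lambda>x. f x \<oplus>\<^bsub>K\<^esub> g x)"
| mult: "polynomial_function K V f \<Longrightarrow> polynomial_function K V g \<Longrightarrow>
    polynomial_function K V (\<lambda>x. f x \<otimes>\<^bsub>K\<^esub> g x)"

definition common_zeros ::
    "('k, 'r) ring_scheme \<Rightarrow> ('k, 'v, 'm) module_scheme \<Rightarrow> ('v \<Rightarrow> 'k) set \<Rightarrow> 'v set" where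
  "common_zeros K V F = {x \<in> carrier V. \<forall>f\<in>F. f x = \<zero>\<^bsub>K\<^esub>}"

definition algebraic_sets ::
    "('k, 'r) ring_scheme \<Rightarrow> ('k, 'v, 'm) module_scheme \<Rightarrow> 'v set set" where
  "algebraic_sets K V = {common_zeros K V F | F. F \<subseteq> Collect (polynomial_function K V)}"

lemma (in module) linear_form_lincomb:
  assumes "linear_form R M l" "finite B" "B \<subseteq> carrier M" "c \<in> B \<rightarrow> carrier R"
  shows "l (lincomb c B) = (\<Oplus>\<^bsub>R\<^esub>b\<in>B. c b \<otimes>\<^bsub>R\<^esub> l b)"
  using assms(2-)
proof (induction B rule: finite_induct)
  case empty
  have l: "l \<in> carrier M \<rightarrow> carrier R" "l (\<zero>\<^bsub>R\<^esub> \<odot>\<^bsub>M\<^esub> \<zero>\<^bsub>M\<^esub>) = \<zero>\<^bsub>R\<^esub> \<otimes>\<^bsub>R\<^esub> l \<zero>\<^bsub>M\<^esub>"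
    using assms(1) M.zero_closed R.zero_closed unfolding linear_form_def by blast+
  then have "l \<zero>\<^bsub>M\<^esub> = \<zero>\<^bsub>R\<^esub>" by (auto simp: Pi_iff)
  then show ?case by (simp add: lincomb_def)
next
  case (insert b B)
  have l: "l \<in> carrier M \<rightarrow> carrier R" using assms(1) unfolding linear_form_def by blast
  have cb: "c b \<in> carrier R" "c \<in> B \<rightarrow> carrier R" "b \<in> carrier M" "B \<subseteq> carrier M"
    using insert by auto
  have "lincomb c (insert b B) = c b \<odot>\<^bsub>M\<^esub> b \<oplus>\<^bsub>M\<^esub> lincomb c B"
    using lincomb_insert[of B c b] insert by auto
  moreover have "lincomb c B \<in> carrier M" using cb by blast
  ultimately have "l (lincomb c (insert b B)) = c b \<otimes>\<^bsub>R\<^esub> l b \<oplus>\<^bsub>R\<^esub> l (lincomb c B)"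
    using assms(1) cb unfolding linear_form_def by simp
  also have "l (lincomb c B) = (\<Oplus>\<^bsub>R\<^esub>b\<in>B. c b \<otimes>\<^bsub>R\<^esub> l b)" using insert.IH cb by blast
  finally show ?case
    using insert.hyps cb l by (subst R.finsum_insert) auto
qed

lemma (in module) polynomial_function_closed:
  "polynomial_function R M f \<Longrightarrow> x \<in> carrier M \<Longrightarrow> f x \<in> carrier R"
  by (induction rule: polynomial_function.induct) (auto simp: linear_form_def)

context vectorspace
begin

text \<open>
  This turns the variables of a polynomial into linear forms on \<open>V\<close>.
\<close>

lemma ex_linear_form_coordinate:
  assumes B: "finite B" "basis B" and b: "b \<in> B"
  shows "\<exists>l. linear_form K V l \<and> (\<forall>c\<in>B \<rightarrow>\<^sub>E carrier K. l (lincomb c B) = c b)"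
proof -
  have BV: "B \<subseteq> carrier V" using B by (simp add: basis_def)
  have ex1: "\<exists>!a. a \<in> B \<rightarrow>\<^sub>E carrier K \<and> lincomb a B = v" if "v \<in> carrier V" for v
    using basis_criterion[OF B(1) BV] B(2) that by blast
  define coord where "coord v = (THE a. a \<in> B \<rightarrow>\<^sub>E carrier K \<and> lincomb a B = v)" for v
  have coord: "coord v \<in> B \<rightarrow>\<^sub>E carrier K" "lincomb (coord v) B = v" if "v \<in> carrier V" for v
    using theI'[OF ex1[OF that]] by (auto simp: coord_def)
  have coordI: "coord (lincomb a B) b = a b" if "a \<in> B \<rightarrow> carrier K" for a
  proof -
    have "lincomb (restrict a B) B = lincomb a B"
      using BV that by (intro lincomb_cong) auto
    moreover have "lincomb a B \<in> carrier V" using that BV by blast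
    ultimately have "coord (lincomb a B) = restrict a B"
      unfolding coord_def using that by (intro the1_equality ex1) auto
    then show ?thesis using b by simp
  qed
  have cP: "coord v \<in> B \<rightarrow> carrier K" if "v \<in> carrier V" for v using coord[OF that] by auto
  have "linear_form K V (\<lambda>v. coord v b)"
    unfolding linear_form_def
  proof (intro conjI ballI)
    show "(\<lambda>v. coord v b) \<in> carrier V \<rightarrow> carrier K" using cP b by auto
    fix x y assume xy: "x \<in> carrier V" "y \<in> carrier V"
    have "x \<oplus>\<^bsub>V\<^esub> y = lincomb (\<lambda>v. coord x v \<oplus>\<^bsub>K\<^esub> coord y v) B"
      using lincomb_sum[OF B(1) BV cP[OF xy(1)] cP[OF xy(2)]] coord xy by simp
    then show "coord (x \<oplus>\<^bsub>V\<^esub> y) b = coord x b \<oplus>\<^bsub>K\<^esub> coord y b"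
      using coordI[of "\<lambda>v. coord x v \<oplus>\<^bsub>K\<^esub> coord y v"] cP[OF xy(1)] cP[OF xy(2)] by (auto simp: Pi_iff)
  next
    fix k x assume kx: "k \<in> carrier K" "x \<in> carrier V"
    have "k \<odot>\<^bsub>V\<^esub> x = lincomb (\<lambda>v. k \<otimes>\<^bsub>K\<^esub> coord x v) B"
      using lincomb_smult[OF BV cP[OF kx(2)] kx(1)] coord kx by simp
    then show "coord (k \<odot>\<^bsub>V\<^esub> x) b = k \<otimes>\<^bsub>K\<^esub> coord x b"
      using coordI[of "\<lambda>v. k \<otimes>\<^bsub>K\<^esub> coord x v"] cP[OF kx(2)] kx by (auto simp: Pi_iff)
  qed
  moreover have "\<forall>c\<in>B \<rightarrow>\<^sub>E carrier K. coord (lincomb c B) b = c b" using coordI by auto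
  ultimately show ?thesis by blast
qed

lemma polynomial_function_of_indexed:
  assumes B: "finite B" "basis B" and P: "P \<in> indexed_pset B (carrier K)"
  shows "\<exists>f. polynomial_function K V f \<and>
    (\<forall>c\<in>B \<rightarrow>\<^sub>E carrier K. f (lincomb c B) = poly_value K P c)"
  using P
proof (induction rule: indexed_pset.induct)
  case (indexed_const k)
  then have "\<forall>c\<in>B \<rightarrow>\<^sub>E carrier K. k = poly_value K (indexed_const k) c"
    by (auto simp: R.poly_value_const[of _ _ B] PiE_def)
  then show ?case using polynomial_function.const[OF indexed_const] by blast
next
  case (indexed_padd P Q)
  then obtain f g where f: "polynomial_function K V f"
      "\<forall>c\<in>B \<rightarrow>\<^sub>E carrier K. f (lincomb c B) = poly_value K P c"
    and g: "polynomial_function K V g"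
      "\<forall>c\<in>B \<rightarrow>\<^sub>E carrier K. g (lincomb c B) = poly_value K Q c" by blast
  have "poly_value K (indexed_padd P Q) c = poly_value K P c \<oplus>\<^bsub>K\<^esub> poly_value K Q c"
    if "c \<in> B \<rightarrow>\<^sub>E carrier K" for c
    using that indexed_padd by (intro R.poly_value_padd[of B] R.finite_coeff_indexed_pset) auto
  with polynomial_function.add[OF f(1) g(1)] f(2) g(2) show ?case
    by (intro exI[of _ "\<lambda>x. f x \<oplus>\<^bsub>K\<^esub> g x"]) simp
next
  case (indexed_pmult P i)
  then obtain f where f: "polynomial_function K V f"
      "\<forall>c\<in>B \<rightarrow>\<^sub>E carrier K. f (lincomb c B) = poly_value K P c" by blast
  obtain l where l: "linear_form K V l" "\<forall>c\<in>B \<rightarrow>\<^sub>E carrier K. l (lincomb c B) = c i"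
    using ex_linear_form_coordinate[OF B indexed_pmult(2)] by blast
  have "poly_value K (indexed_pmult P i) c = poly_value K P c \<otimes>\<^bsub>K\<^esub> c i"
    if "c \<in> B \<rightarrow>\<^sub>E carrier K" for c
    using that indexed_pmult by (intro R.poly_value_pmult[of B] R.finite_coeff_indexed_pset) auto
  with polynomial_function.mult[OF f(1) polynomial_function.linear[OF l(1)]] f(2) l(2) show ?case
    by (intro exI[of _ "\<lambda>x. f x \<otimes>\<^bsub>K\<^esub> l x"]) simp
qed

text \<open>
  A linear form is the linear polynomial whose coefficients are its values on \<open>B\<close>, by
  \<open>linear_form_lincomb\<close>; the other cases are the closure properties of \<^const>\<open>cring.represents\<close>.
\<close>

lemma indexed_of_polynomial_function:
  assumes B: "finite B" "B \<subseteq> carrier V" and f: "polynomial_function K V f"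
  shows "\<exists>P. R.represents B P (\<lambda>c. f (lincomb c B))"
  using f
proof (induction rule: polynomial_function.induct)
  case (const k)
  then show ?case using R.represents_const by blast
next
  case (linear l)
  have "\<exists>P. R.represents B P (\<lambda>c. \<Oplus>\<^bsub>K\<^esub>b\<in>B. c b \<otimes>\<^bsub>K\<^esub> l b)"
  proof (intro R.ex_represents_finsum B)
    fix b assume b: "b \<in> B"
    then have "l b \<in> carrier K" using linear B by (auto simp: linear_form_def)
    from R.ex_represents_coordinate[OF b] R.represents_const[OF this]
    show "\<exists>P. R.represents B P (\<lambda>c. c b \<otimes>\<^bsub>K\<^esub> l b)" using R.ex_represents_mult by blast
  qed
  then obtain P where "R.represents B P (\<lambda>c. \<Oplus>\<^bsub>K\<^esub>b\<in>B. c b \<otimes>\<^bsub>K\<^esub> l b)" ..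
  then have "R.represents B P (\<lambda>c. l (lincomb c B))"
    by (rule R.represents_cong) (simp add: linear_form_lincomb[OF linear B])
  then show ?case by blast
next
  case (add f g)
  then show ?case using R.represents_add by blast
next
  case (mult f g)
  then show ?case using R.ex_represents_mult by blast
qed

lemma zero_loci_eq_algebraic_sets:
  assumes B: "finite B" "basis B"
  shows "{zero_locus K V B F | F. F \<subseteq> indexed_pset B (carrier K)} = algebraic_sets K V"
proof -
  have BV: "B \<subseteq> carrier V" using B by (simp add: basis_def)
  have ex1: "\<exists>!a. a \<in> B \<rightarrow>\<^sub>E carrier K \<and> lincomb a B = v" if "v \<in> carrier V" for v
    using basis_criterion[OF B(1) BV] B(2) that by blast
  have cl: "lincomb c B \<in> carrier V" if "c \<in> B \<rightarrow>\<^sub>E carrier K" for c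
    using that BV by (intro lincomb_closed) auto
  have eq: "zero_locus K V B F = common_zeros K V G"
    if FG: "\<And>P. P \<in> F \<Longrightarrow> \<exists>f\<in>G. \<forall>c\<in>B \<rightarrow>\<^sub>E carrier K. f (lincomb c B) = poly_value K P c"
      and GF: "\<And>f. f \<in> G \<Longrightarrow> \<exists>P\<in>F. \<forall>c\<in>B \<rightarrow>\<^sub>E carrier K. f (lincomb c B) = poly_value K P c"
    for F G
  proof -
    have "(\<forall>P\<in>F. poly_value K P c = \<zero>\<^bsub>K\<^esub>) \<longleftrightarrow> (\<forall>f\<in>G. f (lincomb c B) = \<zero>\<^bsub>K\<^esub>)"
      if c: "c \<in> B \<rightarrow>\<^sub>E carrier K" for c
      using FG GF c by metis
    then have "zero_locus K V B F =
        {lincomb c B | c. c \<in> B \<rightarrow>\<^sub>E carrier K \<and> (\<forall>f\<in>G. f (lincomb c B) = \<zero>\<^bsub>K\<^esub>)}"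
      unfolding zero_locus_def by blast
    also have "\<dots> = common_zeros K V G"
      unfolding common_zeros_def using cl ex1 by blast
    finally show ?thesis .
  qed
  show ?thesis
  proof (intro equalityI subsetI)
    fix Z assume "Z \<in> {zero_locus K V B F | F. F \<subseteq> indexed_pset B (carrier K)}"
    then obtain F where F: "F \<subseteq> indexed_pset B (carrier K)" "Z = zero_locus K V B F" by blast
    define G where "G = {f. polynomial_function K V f \<and>
      (\<exists>P\<in>F. \<forall>c\<in>B \<rightarrow>\<^sub>E carrier K. f (lincomb c B) = poly_value K P c)}"
    have "Z = common_zeros K V G"
      unfolding F(2)
    proof (rule eq)
      fix P assume P: "P \<in> F"
      then obtain f where "polynomial_function K V f"
        "\<forall>c\<in>B \<rightarrow>\<^sub>E carrier K. f (lincomb c B) = poly_value K P c"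
        using polynomial_function_of_indexed[OF B, of P] F(1) by blast
      then show "\<exists>f\<in>G. \<forall>c\<in>B \<rightarrow>\<^sub>E carrier K. f (lincomb c B) = poly_value K P c"
        using P unfolding G_def by blast
    qed (auto simp: G_def)
    then show "Z \<in> algebraic_sets K V" unfolding algebraic_sets_def by (auto simp: G_def)
  next
    fix Z assume "Z \<in> algebraic_sets K V"
    then obtain G where G: "\<And>g. g \<in> G \<Longrightarrow> polynomial_function K V g" "Z = common_zeros K V G"
      unfolding algebraic_sets_def by blast
    define F where "F = {P\<in>indexed_pset B (carrier K).
      (\<exists>f\<in>G. \<forall>c\<in>B \<rightarrow>\<^sub>E carrier K. f (lincomb c B) = poly_value K P c)}"
    have "\<exists>P\<in>F. \<forall>c\<in>B \<rightarrow>\<^sub>E carrier K. f (lincomb c B) = poly_value K P c"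
      if fG: "f \<in> G" for f
    proof -
      obtain P where "P \<in> indexed_pset B (carrier K)"
        "\<forall>c\<in>B \<rightarrow> carrier K. poly_value K P c = f (lincomb c B)"
        using indexed_of_polynomial_function[OF B(1) BV G(1)[OF fG]]
        unfolding R.represents_def by blast
      then show ?thesis using fG unfolding F_def by (intro bexI[of _ P]) (auto simp: PiE_def)
    qed
    then have "Z = zero_locus K V B F"
      unfolding G(2) by (intro eq[symmetric]) (auto simp: F_def)
    then show "Z \<in> {zero_locus K V B F | F. F \<subseteq> indexed_pset B (carrier K)}"
      by (auto simp: F_def)
  qed
qed

lemma algebraic_sets_subset: "C \<in> algebraic_sets K V \<Longrightarrow> C \<subseteq> carrier V"
  by (auto simp: algebraic_sets_def common_zeros_def)

lemma algebraic_sets_empty: "{} \<in> algebraic_sets K V"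
  unfolding algebraic_sets_def
  by (auto simp: common_zeros_def intro!: exI[of _ "{\<lambda>_. \<one>\<^bsub>K\<^esub>}"] polynomial_function.const)

text \<open>
  A union is cut out by the products of the equations of its two parts, since a field has no zero
  divisors.
\<close>

lemma algebraic_sets_Un:
  assumes "C \<in> algebraic_sets K V" "D \<in> algebraic_sets K V"
  shows "C \<union> D \<in> algebraic_sets K V"
proof -
  obtain F where F: "C = common_zeros K V F" "\<And>f. f \<in> F \<Longrightarrow> polynomial_function K V f"
    using assms(1) unfolding algebraic_sets_def by blast
  obtain G where G: "D = common_zeros K V G" "\<And>f. f \<in> G \<Longrightarrow> polynomial_function K V f"
    using assms(2) unfolding algebraic_sets_def by blast
  define H where "H = {\<lambda>x. f x \<otimes>\<^bsub>K\<^esub> g x | f g. f \<in> F \<and> g \<in> G}"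
  have "C \<union> D = common_zeros K V H"
  proof (intro equalityI subsetI)
    fix x assume "x \<in> C \<union> D"
    then show "x \<in> common_zeros K V H"
      using polynomial_function_closed F G by (fastforce simp: common_zeros_def H_def)
  next
    fix x assume x: "x \<in> common_zeros K V H"
    then have xV: "x \<in> carrier V" by (simp add: common_zeros_def)
    show "x \<in> C \<union> D"
    proof (rule ccontr)
      assume "x \<notin> C \<union> D"
      then obtain f g where fg: "f \<in> F" "f x \<noteq> \<zero>\<^bsub>K\<^esub>" "g \<in> G" "g x \<noteq> \<zero>\<^bsub>K\<^esub>"
        using xV by (auto simp: F(1) G(1) common_zeros_def)
      then have "f x \<in> carrier K" "g x \<in> carrier K"
        using polynomial_function_closed F G xV by blast+
      moreover have "f x \<otimes>\<^bsub>K\<^esub> g x = \<zero>\<^bsub>K\<^esub>"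
        using x fg by (auto simp: common_zeros_def H_def)
      ultimately show False using fg integral by blast
    qed
  qed
  moreover have "H \<subseteq> Collect (polynomial_function K V)"
    using F G by (auto simp: H_def intro: polynomial_function.mult)
  ultimately show ?thesis unfolding algebraic_sets_def by blast
qed

lemma algebraic_sets_Inter:
  assumes "\<D> \<subseteq> algebraic_sets K V"
  shows "carrier V \<inter> \<Inter>\<D> \<in> algebraic_sets K V"
proof -
  have "\<forall>D\<in>\<D>. \<exists>F. D = common_zeros K V F \<and> F \<subseteq> Collect (polynomial_function K V)"
    using assms unfolding algebraic_sets_def by blast
  then obtain F where F: "\<And>D. D \<in> \<D> \<Longrightarrow> D = common_zeros K V (F D)"
      "\<And>D. D \<in> \<D> \<Longrightarrow> F D \<subseteq> Collect (polynomial_function K V)"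
    by metis
  have "x \<in> D \<longleftrightarrow> (\<forall>f\<in>F D. f x = \<zero>\<^bsub>K\<^esub>)" if "x \<in> carrier V" "D \<in> \<D>" for x D
    using F(1)[OF that(2)] that(1) unfolding common_zeros_def by blast
  then have "carrier V \<inter> \<Inter>\<D> = common_zeros K V (\<Union>D\<in>\<D>. F D)"
    unfolding common_zeros_def by auto
  moreover have "(\<Union>D\<in>\<D>. F D) \<subseteq> Collect (polynomial_function K V)" using F(2) by blast
  ultimately show ?thesis unfolding algebraic_sets_def by blast
qed

text \<open>
  The basis that \<^const>\<open>zariski_topology\<close> picks exists because \<open>V\<close> is finite-dimensional, and it
  does not matter which one it is.
\<close>

lemma zariski_topology_eq:
  assumes "fin_dim"
  shows "zariski_topology K V = topology_of_closed (carrier V) (algebraic_sets K V)"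
proof -
  define B where "B = (SOME B. finite B \<and> basis B)"
  have "finite B \<and> basis B"
    unfolding B_def by (rule someI_ex) (rule finite_basis_exists[OF assms])
  then show ?thesis
    unfolding zariski_topology_def zariski_topology_wrt_def B_def[symmetric]
    by (simp add: zero_loci_eq_algebraic_sets)
qed

lemma
  assumes "fin_dim"
  shows openin_zariski_topology:
      "openin (zariski_topology K V) U \<longleftrightarrow> U \<subseteq> carrier V \<and> carrier V - U \<in> algebraic_sets K V"
    and topspace_zariski_topology: "topspace (zariski_topology K V) = carrier V"
  unfolding zariski_topology_eq[OF assms]
   by (rule openin_topology_of_closed topspace_topology_of_closed;
      use algebraic_sets_subset algebraic_sets_empty algebraic_sets_Un algebraic_sets_Inter in blast)+

end

section \<open>Semilinear bijections\<close>

context module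
begin

lemma span_induct [consumes 2, case_names zero base add smult]:
  assumes "x \<in> span S" "S \<subseteq> carrier M"
    and "Q \<zero>\<^bsub>M\<^esub>" "\<And>s. s \<in> S \<Longrightarrow> Q s"
    and "\<And>x y. x \<in> span S \<Longrightarrow> y \<in> span S \<Longrightarrow> Q x \<Longrightarrow> Q y \<Longrightarrow> Q (x \<oplus>\<^bsub>M\<^esub> y)"
    and "\<And>a x. a \<in> carrier R \<Longrightarrow> x \<in> span S \<Longrightarrow> Q x \<Longrightarrow> Q (a \<odot>\<^bsub>M\<^esub> x)"
  shows "Q x"
proof -
  interpret s: LinearCombinations.submodule R "span S" M by (rule span_is_submodule[OF assms(2)])
  have "LinearCombinations.submodule R {x \<in> span S. Q x} M"
    using assms s.subset by unfold_locales auto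
  moreover have "S \<subseteq> {x \<in> span S. Q x}" using assms(4) in_own_span[OF assms(2)] by blast
  ultimately show ?thesis using span_is_subset assms(1) by blast
qed

lemma span_closure:
  assumes "S \<subseteq> carrier M"
  shows "\<zero>\<^bsub>M\<^esub> \<in> span S"
    and "x \<in> span S \<Longrightarrow> y \<in> span S \<Longrightarrow> x \<oplus>\<^bsub>M\<^esub> y \<in> span S"
    and "a \<in> carrier R \<Longrightarrow> x \<in> span S \<Longrightarrow> a \<odot>\<^bsub>M\<^esub> x \<in> span S"
    and "x \<in> span S \<Longrightarrow> \<ominus>\<^bsub>M\<^esub> x \<in> span S"
    and "x \<in> span S \<Longrightarrow> x \<in> carrier M"
proof -
  interpret s: LinearCombinations.submodule R "span S" M by (rule span_is_submodule[OF assms])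
  show "\<zero>\<^bsub>M\<^esub> \<in> span S"
    and "x \<in> span S \<Longrightarrow> y \<in> span S \<Longrightarrow> x \<oplus>\<^bsub>M\<^esub> y \<in> span S"
    and sm: "\<And>a x. a \<in> carrier R \<Longrightarrow> x \<in> span S \<Longrightarrow> a \<odot>\<^bsub>M\<^esub> x \<in> span S"
    and cl: "\<And>x. x \<in> span S \<Longrightarrow> x \<in> carrier M" using s.subset by auto
  show "\<ominus>\<^bsub>M\<^esub> x \<in> span S" if "x \<in> span S"
    using sm[of "\<ominus>\<^bsub>R\<^esub> \<one>\<^bsub>R\<^esub>" x] cl[of x] that smult_l_minus[of "\<one>\<^bsub>R\<^esub>" x] by simp
qed

end

text \<open>
  The residue spaces of \<open>M\<close> and of its localization are vector spaces over fields that are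
  isomorphic but not equal, so the maps between them are linear only along an isomorphism \<open>\<sigma>\<close> of
  the fields.
\<close>

locale semilinear_bijection = V: vectorspace K V + W: vectorspace L W
  for K :: "('k, 'r) ring_scheme" and V :: "('k, 'v, 'm) module_scheme"
    and L :: "('l, 's) ring_scheme" and W :: "('l, 'w, 'n) module_scheme" +
  fixes \<sigma> :: "'k \<Rightarrow> 'l" and \<phi> :: "'v \<Rightarrow> 'w"
  assumes \<sigma>_hom: "\<sigma> \<in> ring_hom K L"
    and \<sigma>_bij: "bij_betw \<sigma> (carrier K) (carrier L)"
    and \<phi>_bij: "bij_betw \<phi> (carrier V) (carrier W)"
    and \<phi>_add: "\<And>x y. x \<in> carrier V \<Longrightarrow> y \<in> carrier V \<Longrightarrow> \<phi> (x \<oplus>\<^bsub>V\<^esub> y) = \<phi> x \<oplus>\<^bsub>W\<^esub> \<phi> y"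
    and \<phi>_smult: "\<And>k x. k \<in> carrier K \<Longrightarrow> x \<in> carrier V \<Longrightarrow> \<phi> (k \<odot>\<^bsub>V\<^esub> x) = \<sigma> k \<odot>\<^bsub>W\<^esub> \<phi> x"
begin

lemma \<sigma>_closed: "k \<in> carrier K \<Longrightarrow> \<sigma> k \<in> carrier L" using \<sigma>_bij bij_betwE by blast
lemma \<phi>_closed: "x \<in> carrier V \<Longrightarrow> \<phi> x \<in> carrier W" using \<phi>_bij bij_betwE by blast

definition \<sigma>' where "\<sigma>' = inv_into (carrier K) \<sigma>"
definition \<phi>' where "\<phi>' = inv_into (carrier V) \<phi>"

lemma \<sigma>'_bij: "bij_betw \<sigma>' (carrier L) (carrier K)"
  unfolding \<sigma>'_def by (rule bij_betw_inv_into[OF \<sigma>_bij])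
lemma \<phi>'_bij: "bij_betw \<phi>' (carrier W) (carrier V)"
  unfolding \<phi>'_def by (rule bij_betw_inv_into[OF \<phi>_bij])
lemma \<sigma>'_closed: "k \<in> carrier L \<Longrightarrow> \<sigma>' k \<in> carrier K" using \<sigma>'_bij bij_betwE by blast
lemma \<phi>'_closed: "x \<in> carrier W \<Longrightarrow> \<phi>' x \<in> carrier V" using \<phi>'_bij bij_betwE by blast
lemma \<sigma>_\<sigma>': "k \<in> carrier L \<Longrightarrow> \<sigma> (\<sigma>' k) = k"
  unfolding \<sigma>'_def by (rule bij_betw_inv_into_right[OF \<sigma>_bij])
lemma \<phi>_\<phi>': "x \<in> carrier W \<Longrightarrow> \<phi> (\<phi>' x) = x"
  unfolding \<phi>'_def by (rule bij_betw_inv_into_right[OF \<phi>_bij])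
lemma \<sigma>'_\<sigma>: "k \<in> carrier K \<Longrightarrow> \<sigma>' (\<sigma> k) = k"
  unfolding \<sigma>'_def by (rule bij_betw_inv_into_left[OF \<sigma>_bij])
lemma \<phi>'_\<phi>: "x \<in> carrier V \<Longrightarrow> \<phi>' (\<phi> x) = x"
  unfolding \<phi>'_def by (rule bij_betw_inv_into_left[OF \<phi>_bij])

lemmas \<sigma>_ring = ring_hom_add[OF \<sigma>_hom] ring_hom_mult[OF \<sigma>_hom] ring_hom_one[OF \<sigma>_hom]

lemma \<sigma>_zero: "\<sigma> \<zero>\<^bsub>K\<^esub> = \<zero>\<^bsub>L\<^esub>"
  using ring_hom_zero[OF \<sigma>_hom] V.R.ring_axioms W.R.ring_axioms by blast

lemma \<sigma>'_ring:
  assumes "k \<in> carrier L" "l \<in> carrier L"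
  shows "\<sigma>' (k \<oplus>\<^bsub>L\<^esub> l) = \<sigma>' k \<oplus>\<^bsub>K\<^esub> \<sigma>' l" "\<sigma>' (k \<otimes>\<^bsub>L\<^esub> l) = \<sigma>' k \<otimes>\<^bsub>K\<^esub> \<sigma>' l"
  using assms \<sigma>_ring(1,2)[of "\<sigma>' k" "\<sigma>' l"] \<sigma>'_\<sigma>[of "\<sigma>' k \<oplus>\<^bsub>K\<^esub> \<sigma>' l"] \<sigma>'_\<sigma>[of "\<sigma>' k \<otimes>\<^bsub>K\<^esub> \<sigma>' l"]
  by (simp_all add: \<sigma>_\<sigma>' \<sigma>'_closed)

lemma inverse: "semilinear_bijection L W K V \<sigma>' \<phi>'"
proof (intro semilinear_bijection.intro W.vectorspace_axioms V.vectorspace_axioms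
    semilinear_bijection_axioms.intro \<sigma>'_bij \<phi>'_bij)
  show "\<sigma>' \<in> ring_hom L K"
    using \<sigma>'_\<sigma>[of "\<one>\<^bsub>K\<^esub>"] \<sigma>_ring(3)
    by (intro ring_hom_memI) (simp_all add: \<sigma>'_ring \<sigma>'_closed)
  show "\<phi>' (x \<oplus>\<^bsub>W\<^esub> y) = \<phi>' x \<oplus>\<^bsub>V\<^esub> \<phi>' y" if "x \<in> carrier W" "y \<in> carrier W" for x y
    using that \<phi>_add[of "\<phi>' x" "\<phi>' y"] \<phi>'_\<phi>[of "\<phi>' x \<oplus>\<^bsub>V\<^esub> \<phi>' y"] by (simp add: \<phi>_\<phi>' \<phi>'_closed)
  show "\<phi>' (k \<odot>\<^bsub>W\<^esub> x) = \<sigma>' k \<odot>\<^bsub>V\<^esub> \<phi>' x" if "k \<in> carrier L" "x \<in> carrier W" for k x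
    using that \<phi>_smult[of "\<sigma>' k" "\<phi>' x"] \<phi>'_\<phi>[of "\<sigma>' k \<odot>\<^bsub>V\<^esub> \<phi>' x"]
    by (simp add: \<phi>_\<phi>' \<phi>'_closed \<sigma>_\<sigma>' \<sigma>'_closed)
qed

text \<open>
  The pullback is \<open>\<sigma>' \<circ> f \<circ> \<phi>\<close>. Equality is claimed only on \<open>carrier V\<close>, because additivity of \<open>\<sigma>'\<close>
  cannot be applied to values of \<open>f \<circ> \<phi>\<close> at points outside.
\<close>

lemma polynomial_function_pullback:
  assumes "polynomial_function L W f"
  shows "\<exists>g. polynomial_function K V g \<and> (\<forall>x\<in>carrier V. \<sigma> (g x) = f (\<phi> x))"
  using assms
proof (induction rule: polynomial_function.induct)
  case (const k)
  then show ?case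
    by (intro exI[of _ "\<lambda>_. \<sigma>' k"]) (simp add: polynomial_function.const \<sigma>'_closed \<sigma>_\<sigma>')
next
  case (linear l)
  then have l: "\<And>x. x \<in> carrier W \<Longrightarrow> l x \<in> carrier L"
    "\<And>x y. x \<in> carrier W \<Longrightarrow> y \<in> carrier W \<Longrightarrow> l (x \<oplus>\<^bsub>W\<^esub> y) = l x \<oplus>\<^bsub>L\<^esub> l y"
    "\<And>k x. k \<in> carrier L \<Longrightarrow> x \<in> carrier W \<Longrightarrow> l (k \<odot>\<^bsub>W\<^esub> x) = k \<otimes>\<^bsub>L\<^esub> l x"
    by (auto simp: linear_form_def)
  have "linear_form K V (\<lambda>x. \<sigma>' (l (\<phi> x)))"
    by (auto simp: linear_form_def l \<phi>_closed \<sigma>'_closed \<phi>_add \<phi>_smult \<sigma>_closed \<sigma>'_ring \<sigma>'_\<sigma>)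
  then show ?case
    by (intro exI[of _ "\<lambda>x. \<sigma>' (l (\<phi> x))"])
      (simp add: polynomial_function.linear \<sigma>_\<sigma>' l \<phi>_closed)
next
  case (add f1 f2)
  then obtain g1 g2 where g: "polynomial_function K V g1" "\<forall>x\<in>carrier V. \<sigma> (g1 x) = f1 (\<phi> x)"
    "polynomial_function K V g2" "\<forall>x\<in>carrier V. \<sigma> (g2 x) = f2 (\<phi> x)" by blast
  then show ?case
    by (intro exI[of _ "\<lambda>x. g1 x \<oplus>\<^bsub>K\<^esub> g2 x"])
      (auto simp: \<sigma>_ring V.polynomial_function_closed intro: polynomial_function.add)
next
  case (mult f1 f2)
  then obtain g1 g2 where g: "polynomial_function K V g1" "\<forall>x\<in>carrier V. \<sigma> (g1 x) = f1 (\<phi> x)"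
    "polynomial_function K V g2" "\<forall>x\<in>carrier V. \<sigma> (g2 x) = f2 (\<phi> x)" by blast
  then show ?case
    by (intro exI[of _ "\<lambda>x. g1 x \<otimes>\<^bsub>K\<^esub> g2 x"])
      (auto simp: \<sigma>_ring V.polynomial_function_closed intro: polynomial_function.mult)
qed

lemma algebraic_sets_vimage:
  assumes "D \<in> algebraic_sets L W"
  shows "{x \<in> carrier V. \<phi> x \<in> D} \<in> algebraic_sets K V"
proof -
  obtain F where F: "D = common_zeros L W F" "\<And>f. f \<in> F \<Longrightarrow> polynomial_function L W f"
    using assms unfolding algebraic_sets_def by blast
  obtain g where g: "\<And>f. f \<in> F \<Longrightarrow> polynomial_function K V (g f)"
    "\<And>f x. f \<in> F \<Longrightarrow> x \<in> carrier V \<Longrightarrow> \<sigma> (g f x) = f (\<phi> x)"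
    using polynomial_function_pullback[OF F(2)] by metis
  have "f (\<phi> x) = \<zero>\<^bsub>L\<^esub> \<longleftrightarrow> g f x = \<zero>\<^bsub>K\<^esub>" if "f \<in> F" "x \<in> carrier V" for f x
    using g(2)[OF that] \<sigma>'_\<sigma>[OF V.polynomial_function_closed[OF g(1)[OF that(1)] that(2)]]
      \<sigma>'_\<sigma>[OF V.R.zero_closed] \<sigma>_zero by metis
  then have "{x \<in> carrier V. \<phi> x \<in> D} = common_zeros K V (g ` F)"
    by (auto simp: F(1) common_zeros_def \<phi>_closed)
  moreover have "g ` F \<subseteq> Collect (polynomial_function K V)" using g by auto
  ultimately show ?thesis unfolding algebraic_sets_def by blast
qed

lemma span_image:
  assumes A: "A \<subseteq> carrier V" "V.gen_set A"
  shows "W.gen_set (\<phi> ` A)"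
proof -
  have sub: "\<phi> ` A \<subseteq> carrier W" using A \<phi>_closed by blast
  have "\<phi> x \<in> W.span (\<phi> ` A)" if "x \<in> V.span A" for x
    using that A(1)
  proof (induction rule: V.span_induct)
    case zero
    have "\<phi> (\<zero>\<^bsub>K\<^esub> \<odot>\<^bsub>V\<^esub> \<zero>\<^bsub>V\<^esub>) = \<sigma> \<zero>\<^bsub>K\<^esub> \<odot>\<^bsub>W\<^esub> \<phi> \<zero>\<^bsub>V\<^esub>" by (intro \<phi>_smult) auto
    then have "\<phi> \<zero>\<^bsub>V\<^esub> = \<zero>\<^bsub>W\<^esub>" by (simp add: \<sigma>_zero \<phi>_closed)
    then show ?case using W.span_closure(1)[OF sub] by simp
  next
    case (base s)
    then show ?case using W.in_own_span[OF sub] by blast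
  next
    case (add x y)
    then show ?case using W.span_closure(2)[OF sub] V.span_closure(5)[OF A(1)] by (simp add: \<phi>_add)
  next
    case (smult a x)
    then show ?case
      using W.span_closure(3)[OF sub] V.span_closure(5)[OF A(1)] by (simp add: \<phi>_smult \<sigma>_closed)
  qed
  then have "carrier W \<subseteq> W.span (\<phi> ` A)"
    using A(2) \<phi>_bij by (metis bij_betw_imp_surj_on image_subsetI)
  then show ?thesis using W.span_is_subset2[OF sub] by blast
qed

lemma fin_dim_image: "V.fin_dim \<Longrightarrow> W.fin_dim"
  unfolding V.fin_dim_def W.fin_dim_def using span_image \<phi>_closed
  by (metis finite_imageI image_subsetI subsetD)

text \<open>
  The image of a basis generates \<open>W\<close>. The reverse inequality is this one for the inverse bijection.
\<close>

lemma dim_le: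
  assumes "V.fin_dim" shows "W.dim \<le> V.dim"
proof -
  obtain B where B: "finite B" "V.basis B" using V.finite_basis_exists[OF assms] by blast
  then have "B \<subseteq> carrier V" "V.gen_set B" by (auto simp: V.basis_def)
  then have "W.dim \<le> card (\<phi> ` B)"
    using W.gen_ge_dim[of "\<phi> ` B"] span_image[of B] B(1) \<phi>_closed by blast
  also have "\<dots> \<le> card B" by (rule card_image_le[OF B(1)])
  finally show ?thesis using V.dim_basis[OF B] by simp
qed

lemma dim_eq: "V.fin_dim \<Longrightarrow> W.dim = V.dim"
  using dim_le fin_dim_image semilinear_bijection.dim_le[OF inverse] by fastforce

lemma zariski_homeomorphic_map:
  assumes fd: "V.fin_dim"
  shows "homeomorphic_map (zariski_topology K V) (zariski_topology L W) \<phi>"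
proof -
  note fd' = fin_dim_image[OF fd]
  note tops = V.openin_zariski_topology[OF fd] W.openin_zariski_topology[OF fd']
    V.topspace_zariski_topology[OF fd] W.topspace_zariski_topology[OF fd']
  have "openin (zariski_topology K V) {x \<in> carrier V. \<phi> x \<in> U}"
    if U: "openin (zariski_topology L W) U" for U
  proof -
    have "carrier V - {x \<in> carrier V. \<phi> x \<in> U} = {x \<in> carrier V. \<phi> x \<in> carrier W - U}"
      using \<phi>_closed by blast
    then show ?thesis using algebraic_sets_vimage[of "carrier W - U"] U by (auto simp: tops)
  qed
  moreover have "openin (zariski_topology L W) (\<phi> ` U)"
    if U: "openin (zariski_topology K V) U" for U
  proof -
    have sub: "U \<subseteq> carrier V" using U by (simp add: tops)
    have "{x \<in> carrier W. \<phi>' x \<in> carrier V - U} = carrier W - \<phi> ` U"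
    proof (intro equalityI subsetI)
      fix x assume "x \<in> {x \<in> carrier W. \<phi>' x \<in> carrier V - U}"
      then show "x \<in> carrier W - \<phi> ` U" using \<phi>'_\<phi> sub by auto
    next
      fix x assume x: "x \<in> carrier W - \<phi> ` U"
      then have "\<phi> (\<phi>' x) \<notin> \<phi> ` U" by (simp add: \<phi>_\<phi>')
      then show "x \<in> {x \<in> carrier W. \<phi>' x \<in> carrier V - U}" using x \<phi>'_closed by blast
    qed
    then show ?thesis
      using semilinear_bijection.algebraic_sets_vimage[OF inverse, of "carrier V - U"] U \<phi>_closed sub
      by (auto simp: tops)
  qed
  ultimately show ?thesis
    using \<phi>_bij \<phi>_closed
    by (intro bijective_open_imp_homeomorphic_map)
      (auto simp: continuous_map tops open_map_def bij_betw_def)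
qed

end

section \<open>Residue modules\<close>

lemma UN_UN_const:
  assumes "\<And>x y. x \<in> A \<Longrightarrow> y \<in> B \<Longrightarrow> f x y = c" "a \<in> A" "b \<in> B"
  shows "(\<Union>x\<in>A. \<Union>y\<in>B. f x y) = c"
proof -
  have "(\<Union>x\<in>A. \<Union>y\<in>B. f x y) = (\<Union>x\<in>A. \<Union>y\<in>B. c)" using assms(1) by simp
  then show ?thesis using assms(2,3) by auto
qed

locale module_ideal = module R M + ideal I R
  for R :: "('a, 'r) ring_scheme" (structure) and M :: "('a, 'b, 'm) module_scheme" and I
begin

abbreviation "N \<equiv> ideal_smult R M I"
abbreviation "rc x \<equiv> N +>\<^bsub>M\<^esub> x"

lemma gens_subset: "{a \<odot>\<^bsub>M\<^esub> x | a x. a \<in> I \<and> x \<in> carrier M} \<subseteq> carrier M"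
  using a_subset by auto

lemma N_closed:
  "\<zero>\<^bsub>M\<^esub> \<in> N" "x \<in> N \<Longrightarrow> y \<in> N \<Longrightarrow> x \<oplus>\<^bsub>M\<^esub> y \<in> N" "a \<in> carrier R \<Longrightarrow> x \<in> N \<Longrightarrow> a \<odot>\<^bsub>M\<^esub> x \<in> N"
  "x \<in> N \<Longrightarrow> \<ominus>\<^bsub>M\<^esub> x \<in> N" "x \<in> N \<Longrightarrow> x \<in> carrier M"
  using span_closure[OF gens_subset] by (auto simp: ideal_smult_def)

lemma N_subset: "N \<subseteq> carrier M" using N_closed by blast

lemma smult_in_N: "a \<in> I \<Longrightarrow> x \<in> carrier M \<Longrightarrow> a \<odot>\<^bsub>M\<^esub> x \<in> N"
  unfolding ideal_smult_def using in_own_span[OF gens_subset] by blast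

lemma N_subgroup: "subgroup N (add_monoid M)"
  using N_closed N_subset by (intro subgroup.intro) (auto simp: a_inv_def[symmetric])

sublocale N: abelian_subgroup N M
  by (rule abelian_subgroupI3) (auto intro: additive_subgroupI N_subgroup M.abelian_group_axioms)

lemma mem_rc: "y \<in> rc x \<longleftrightarrow> (\<exists>h\<in>N. y = h \<oplus>\<^bsub>M\<^esub> x)"
  by (auto simp: a_r_coset_def r_coset_def)

lemma mem_ideal_coset: "b \<in> I +> a \<longleftrightarrow> (\<exists>h\<in>I. b = h \<oplus> a)"
  by (auto simp: a_r_coset_def r_coset_def)

lemma rc_eq_iff:
  assumes "x \<in> carrier M" "y \<in> carrier M"
  shows "rc x = rc y \<longleftrightarrow> x \<ominus>\<^bsub>M\<^esub> y \<in> N"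
proof
  assume "rc x = rc y"
  then have "x \<in> rc y" using N.a_rcos_self[OF assms(1)] by simp
  then obtain h where "h \<in> N" "x = h \<oplus>\<^bsub>M\<^esub> y" unfolding mem_rc by blast
  then show "x \<ominus>\<^bsub>M\<^esub> y \<in> N" using assms N_closed by (simp add: M.minus_eq M.a_assoc M.r_neg)
next
  assume h: "x \<ominus>\<^bsub>M\<^esub> y \<in> N"
  have "x = (x \<ominus>\<^bsub>M\<^esub> y) \<oplus>\<^bsub>M\<^esub> y" using assms by (simp add: M.minus_eq M.a_assoc M.l_neg)
  then have "x \<in> rc y" using h unfolding mem_rc by blast
  then show "rc x = rc y" using M.a_repr_independence[OF _ assms(2) N_subgroup] by blast
qed

lemma ideal_coset_eq_iff:
  assumes "a \<in> carrier R" "b \<in> carrier R"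
  shows "I +> a = I +> b \<longleftrightarrow> a \<ominus> b \<in> I"
proof -
  show ?thesis
  proof
    assume "I +> a = I +> b"
    then have "a \<in> I +> b" using a_rcos_self[OF assms(1)] by simp
    then obtain h where "h \<in> I" "a = h \<oplus> b" unfolding mem_ideal_coset by blast
    then show "a \<ominus> b \<in> I" using assms by (simp add: R.minus_eq R.a_assoc R.r_neg)
  next
    assume h: "a \<ominus> b \<in> I"
    have "a = (a \<ominus> b) \<oplus> b" using assms by (simp add: R.minus_eq R.a_assoc R.l_neg)
    then have "a \<in> I +> b" using h unfolding mem_ideal_coset by blast
    then show "I +> a = I +> b" using R.a_repr_independence[OF _ assms(2) a_subgroup] by blast
  qed
qed

abbreviation "RM \<equiv> residue_module R M I"

lemma carrier_residue_module: "carrier RM = rc ` carrier M"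
  by (auto simp: residue_module_def A_RCOSETS_defs a_r_coset_def)

lemma zero_residue_module: "\<zero>\<^bsub>RM\<^esub> = rc \<zero>\<^bsub>M\<^esub>"
  by (simp add: residue_module_def M.a_coset_add_zero[OF N_subset])

lemma add_residue_module:
  "x \<in> carrier M \<Longrightarrow> y \<in> carrier M \<Longrightarrow> rc x \<oplus>\<^bsub>RM\<^esub> rc y = rc (x \<oplus>\<^bsub>M\<^esub> y)"
  by (simp add: residue_module_def N.a_rcos_sum)

lemma smult_residue_module:
  assumes a: "a \<in> carrier R" and x: "x \<in> carrier M"
  shows "(I +> a) \<odot>\<^bsub>RM\<^esub> rc x = rc (a \<odot>\<^bsub>M\<^esub> x)"
proof -
  have "rc (b \<odot>\<^bsub>M\<^esub> y) = rc (a \<odot>\<^bsub>M\<^esub> x)" if b: "b \<in> I +> a" and y: "y \<in> rc x" for b y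
  proof -
    obtain h where h: "h \<in> I" "b = h \<oplus> a" using mem_ideal_coset[THEN iffD1, OF b] by auto
    obtain k where k: "k \<in> N" "y = k \<oplus>\<^bsub>M\<^esub> x" using mem_rc[THEN iffD1, OF y] by auto
    have hk: "h \<in> carrier R" "k \<in> carrier M" using h k N_closed by auto
    have "b \<odot>\<^bsub>M\<^esub> y = (h \<odot>\<^bsub>M\<^esub> y \<oplus>\<^bsub>M\<^esub> a \<odot>\<^bsub>M\<^esub> k) \<oplus>\<^bsub>M\<^esub> a \<odot>\<^bsub>M\<^esub> x"
      using h k hk a x by (simp add: smult_l_distr smult_r_distr M.a_ac)
    moreover have "h \<odot>\<^bsub>M\<^esub> y \<oplus>\<^bsub>M\<^esub> a \<odot>\<^bsub>M\<^esub> k \<in> N"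
      using h k hk a x by (intro N_closed(2) smult_in_N[OF h(1)] N_closed(3)[OF a k(1)]) auto
    ultimately have "b \<odot>\<^bsub>M\<^esub> y \<in> rc (a \<odot>\<^bsub>M\<^esub> x)" unfolding mem_rc by blast
    then show ?thesis
      using M.a_repr_independence[OF _ _ N_subgroup] a x by (metis smult_closed)
  qed
  moreover have "a \<in> I +> a" using a_rcos_self[OF a] .
  moreover have "x \<in> rc x" using N.a_rcos_self[OF x] .
  ultimately have "(\<Union>b\<in>I +> a. \<Union>y\<in>rc x. rc (b \<odot>\<^bsub>M\<^esub> y)) = rc (a \<odot>\<^bsub>M\<^esub> x)" by (rule UN_UN_const)
  then show ?thesis by (simp add: residue_module_def)
qed

lemma carrier_quot: "carrier (R Quot I) = (+>) I ` carrier R"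
  by (auto simp: FactRing_def A_RCOSETS_defs a_r_coset_def)

lemma quot_simps:
  "a \<in> carrier R \<Longrightarrow> b \<in> carrier R \<Longrightarrow> (I +> a) \<oplus>\<^bsub>R Quot I\<^esub> (I +> b) = I +> (a \<oplus> b)"
  "a \<in> carrier R \<Longrightarrow> b \<in> carrier R \<Longrightarrow> (I +> a) \<otimes>\<^bsub>R Quot I\<^esub> (I +> b) = I +> (a \<otimes> b)"
  "\<one>\<^bsub>R Quot I\<^esub> = I +> \<one>"
  using ring_hom_add[OF rcos_ring_hom] ring_hom_mult[OF rcos_ring_hom] ring_hom_one[OF rcos_ring_hom]
  by auto

lemma residue_module_is_module: "module (R Quot I) RM"
proof (rule module_criteria)
  show "cring (R Quot I)" by (rule quotient_is_cring[OF R.is_cring])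
  show "\<forall>v\<in>carrier RM. \<exists>neg_v\<in>carrier RM. v \<oplus>\<^bsub>RM\<^esub> neg_v = \<zero>\<^bsub>RM\<^esub>"
  proof
    fix v assume "v \<in> carrier RM"
    then obtain x where x: "x \<in> carrier M" "v = rc x" by (auto simp: carrier_residue_module)
    then have "v \<oplus>\<^bsub>RM\<^esub> rc (\<ominus>\<^bsub>M\<^esub> x) = \<zero>\<^bsub>RM\<^esub>"
      by (simp add: add_residue_module zero_residue_module M.r_neg)
    then show "\<exists>neg_v\<in>carrier RM. v \<oplus>\<^bsub>RM\<^esub> neg_v = \<zero>\<^bsub>RM\<^esub>"
      using x by (auto simp: carrier_residue_module)
  qed
  have zero: "\<zero>\<^bsub>RM\<^esub> = rc \<zero>\<^bsub>M\<^esub>" by (rule zero_residue_module)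
  note rules = add_residue_module smult_residue_module quot_simps(1,2)
  show "\<zero>\<^bsub>RM\<^esub> \<in> carrier RM" by (simp add: zero carrier_residue_module)
  show "\<forall>v w. v \<in> carrier RM \<and> w \<in> carrier RM \<longrightarrow> v \<oplus>\<^bsub>RM\<^esub> w \<in> carrier RM"
    unfolding carrier_residue_module by (clarify, simp add: add_residue_module)
  show "\<forall>c v. c \<in> carrier (R Quot I) \<and> v \<in> carrier RM \<longrightarrow> c \<odot>\<^bsub>RM\<^esub> v \<in> carrier RM"
    unfolding carrier_residue_module carrier_quot by (clarify, simp add: smult_residue_module)
  show "\<forall>v w. v \<in> carrier RM \<and> w \<in> carrier RM \<longrightarrow> v \<oplus>\<^bsub>RM\<^esub> w = w \<oplus>\<^bsub>RM\<^esub> v"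
    unfolding carrier_residue_module by (clarify, simp add: add_residue_module M.a_comm)
  show "\<forall>v w x. v \<in> carrier RM \<and> w \<in> carrier RM \<and> x \<in> carrier RM \<longrightarrow>
      v \<oplus>\<^bsub>RM\<^esub> w \<oplus>\<^bsub>RM\<^esub> x = v \<oplus>\<^bsub>RM\<^esub> (w \<oplus>\<^bsub>RM\<^esub> x)"
    unfolding carrier_residue_module by (clarify, simp add: add_residue_module M.a_assoc)
  show "\<forall>v\<in>carrier RM. v \<oplus>\<^bsub>RM\<^esub> \<zero>\<^bsub>RM\<^esub> = v"
    unfolding carrier_residue_module zero by (clarify, simp add: add_residue_module)
  show "\<forall>a b v. a \<in> carrier (R Quot I) \<and> b \<in> carrier (R Quot I) \<and> v \<in> carrier RM \<longrightarrow>
      (a \<otimes>\<^bsub>R Quot I\<^esub> b) \<odot>\<^bsub>RM\<^esub> v = a \<odot>\<^bsub>RM\<^esub> (b \<odot>\<^bsub>RM\<^esub> v)"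
    unfolding carrier_residue_module carrier_quot by (clarify, simp add: rules smult_assoc1)
  show "\<forall>v\<in>carrier RM. \<one>\<^bsub>R Quot I\<^esub> \<odot>\<^bsub>RM\<^esub> v = v"
    unfolding carrier_residue_module quot_simps(3) by (clarify, simp add: smult_residue_module)
  have "((I +> a) \<oplus>\<^bsub>R Quot I\<^esub> (I +> b)) \<odot>\<^bsub>RM\<^esub> rc x = (I +> a) \<odot>\<^bsub>RM\<^esub> rc x \<oplus>\<^bsub>RM\<^esub> (I +> b) \<odot>\<^bsub>RM\<^esub> rc x"
    if h: "a \<in> carrier R" "b \<in> carrier R" "x \<in> carrier M" for a b x
    using smult_l_distr[OF h]
    by (simp only: rules h R.add.m_closed smult_closed)
  then show "\<forall>a b v. a \<in> carrier (R Quot I) \<and> b \<in> carrier (R Quot I) \<and> v \<in> carrier RM \<longrightarrow>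
      (a \<oplus>\<^bsub>R Quot I\<^esub> b) \<odot>\<^bsub>RM\<^esub> v = a \<odot>\<^bsub>RM\<^esub> v \<oplus>\<^bsub>RM\<^esub> b \<odot>\<^bsub>RM\<^esub> v"
    unfolding carrier_residue_module carrier_quot by (intro allI impI, elim conjE imageE) (simp only:)
  have "(I +> a) \<odot>\<^bsub>RM\<^esub> (rc x \<oplus>\<^bsub>RM\<^esub> rc y) = (I +> a) \<odot>\<^bsub>RM\<^esub> rc x \<oplus>\<^bsub>RM\<^esub> (I +> a) \<odot>\<^bsub>RM\<^esub> rc y"
    if h: "a \<in> carrier R" "x \<in> carrier M" "y \<in> carrier M" for a x y
    using smult_r_distr[OF h]
    by (simp only: rules h M.add.m_closed smult_closed)
  then show "\<forall>a v w. a \<in> carrier (R Quot I) \<and> v \<in> carrier RM \<and> w \<in> carrier RM \<longrightarrow>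
      a \<odot>\<^bsub>RM\<^esub> (v \<oplus>\<^bsub>RM\<^esub> w) = a \<odot>\<^bsub>RM\<^esub> v \<oplus>\<^bsub>RM\<^esub> a \<odot>\<^bsub>RM\<^esub> w"
    unfolding carrier_residue_module carrier_quot by (intro allI impI, elim conjE imageE) (simp only:)
qed

text \<open>
  Generators of \<open>M\<close> up to \<open>IM\<close> become generators of \<open>M/IM\<close>. This gives both finite dimension of
  the residue spaces and bounds on their dimension.
\<close>

lemma gen_set_residue_module:
  assumes "A \<subseteq> carrier M" and A: "\<And>x. x \<in> carrier M \<Longrightarrow> \<exists>y\<in>span A. x \<ominus>\<^bsub>M\<^esub> y \<in> N"
  shows "module.span (R Quot I) RM (rc ` A) = carrier RM"
proof -
  interpret Q: module "R Quot I" RM by (rule residue_module_is_module)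
  have sub: "rc ` A \<subseteq> carrier RM"
    unfolding carrier_residue_module using assms(1) by (rule image_mono)
  have *: "rc x \<in> Q.span (rc ` A)" if "x \<in> span A" for x
    using that assms(1)
  proof (induction rule: span_induct)
    case zero
    then show ?case using Q.span_closure(1)[OF sub] by (simp add: zero_residue_module)
  next
    case (base s)
    then show ?case using Q.in_own_span[OF sub] by blast
  next
    case (add x y)
    then show ?case
      using Q.span_closure(2)[OF sub, of "rc x" "rc y"] span_closure(5)[OF assms(1)]
      by (simp add: add_residue_module)
  next
    case (smult a x)
    then show ?case
      using Q.span_closure(3)[OF sub, of "I +> a" "rc x"] span_closure(5)[OF assms(1)]
      by (simp add: smult_residue_module carrier_quot)
  qed
  have "rc x \<in> Q.span (rc ` A)" if x: "x \<in> carrier M" for x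
  proof -
    obtain y where y: "y \<in> span A" "x \<ominus>\<^bsub>M\<^esub> y \<in> N" using A[OF x] by blast
    then have "rc x = rc y" using rc_eq_iff[OF x span_closure(5)[OF assms(1) y(1)]] by simp
    then show ?thesis using *[OF y(1)] by simp
  qed
  then have "carrier RM \<subseteq> Q.span (rc ` A)"
    unfolding carrier_residue_module by (rule image_subsetI)
  then show ?thesis using Q.span_is_subset2[OF sub] by (intro equalityI)
qed

end

lemma vectorspace_residue_module:
  assumes "module R M" "I \<in> mSpec R"
  shows "vectorspace (R Quot I) (residue_module R M I)" and "module_ideal R M I"
proof -
  interpret module R M by fact
  interpret maximalideal I R using assms(2) by (simp add: mSpec_def)
  show mi: "module_ideal R M I"
    by (intro module_ideal.intro assms(1) is_ideal)
  show "vectorspace (R Quot I) (residue_module R M I)"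
    by (intro vectorspace.intro module_ideal.residue_module_is_module[OF mi] quotient_is_field R.is_cring)
qed

lemma fin_dim_residue_module:
  assumes "module R M" "finitely_generated_module R M" "I \<in> mSpec R"
  shows "vectorspace.fin_dim (R Quot I) (residue_module R M I)"
proof -
  interpret module_ideal R M I by (rule vectorspace_residue_module(2)[OF assms(1,3)])
  obtain A where A: "finite A" "A \<subseteq> carrier M" "span A = carrier M"
    using assms(2) unfolding finitely_generated_module_def by blast
  have gen: "module.span (R Quot I) RM (rc ` A) = carrier RM"
  proof (rule gen_set_residue_module[OF A(2)])
    fix x assume x: "x \<in> carrier M"
    then have "x \<ominus>\<^bsub>M\<^esub> x \<in> N" using N_closed(1) by (simp add: M.minus_eq M.r_neg)
    then show "\<exists>y\<in>span A. x \<ominus>\<^bsub>M\<^esub> y \<in> N" using x unfolding A(3) by blast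
  qed
  have "rc ` A \<subseteq> carrier RM" unfolding carrier_residue_module using A(2) by (rule image_mono)
  with gen show ?thesis
    unfolding vectorspace.fin_dim_def[OF vectorspace_residue_module(1)[OF assms(1,3)]]
    by (intro exI[of _ "rc ` A"] conjI finite_imageI A(1))
qed

text \<open>
  The three sets do satisfy the axioms for closed sets, so the topology used at maximal ideals with
  residue space of dimension at most one is the intended one.
\<close>

lemma topspace_point_topology:
  assumes "z \<in> Y"
  shows "topspace (topology_of_closed Y {{}, {z}, Y}) = Y"
proof (rule topspace_topology_of_closed)
  fix \<D> assume \<D>: "\<D> \<subseteq> {{}, {z}, Y}"
  have "Y \<inter> \<Inter>\<D> = {}" if "{} \<in> \<D>" using that by blast
  moreover have "Y \<inter> \<Inter>\<D> = {z}" if "{} \<notin> \<D>" "{z} \<in> \<D>"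
    using that assms \<D> by blast
  moreover have "Y \<inter> \<Inter>\<D> = Y" if "{} \<notin> \<D>" "{z} \<notin> \<D>"
    using that assms \<D> by blast
  ultimately show "Y \<inter> \<Inter>\<D> \<in> {{}, {z}, Y}" by blast
qed (use assms in blast)+

lemma topspace_residue_topology:
  assumes "module R M" "finitely_generated_module R M" "I \<in> mSpec R"
  shows "topspace (residue_topology R M I) = carrier (residue_module R M I)"
proof (cases "I \<in> mSpec_ge2 R M")
  case True
  then show ?thesis
    using vectorspace.topspace_zariski_topology[OF vectorspace_residue_module(1)[OF assms(1,3)]
        fin_dim_residue_module[OF assms]]
    by (simp add: residue_topology_def Let_def)
next
  case False
  interpret Q: module "R Quot I" "residue_module R M I"
    using vectorspace_residue_module(1)[OF assms(1,3)] by (simp add: vectorspace_def)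
  show ?thesis using False topspace_point_topology[OF Q.M.zero_closed]
    by (simp add: residue_topology_def Let_def)
qed

section \<open>Maximal ideals\<close>

context cring
begin

lemma ideal_closure:
  assumes "ideal I R"
  shows "\<zero> \<in> I" "a \<in> I \<Longrightarrow> \<ominus> a \<in> I" "a \<in> I \<Longrightarrow> b \<in> I \<Longrightarrow> a \<oplus> b \<in> I"
    "a \<in> I \<Longrightarrow> x \<in> carrier R \<Longrightarrow> x \<otimes> a \<in> I" "a \<in> I \<Longrightarrow> x \<in> carrier R \<Longrightarrow> a \<otimes> x \<in> I"
    "a \<in> I \<Longrightarrow> a \<in> carrier R"
proof -
  interpret ideal I R by fact
  show "\<zero> \<in> I" "a \<in> I \<Longrightarrow> \<ominus> a \<in> I" "a \<in> I \<Longrightarrow> b \<in> I \<Longrightarrow> a \<oplus> b \<in> I"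
    "a \<in> I \<Longrightarrow> x \<in> carrier R \<Longrightarrow> x \<otimes> a \<in> I" "a \<in> I \<Longrightarrow> x \<in> carrier R \<Longrightarrow> a \<otimes> x \<in> I"
    "a \<in> I \<Longrightarrow> a \<in> carrier R"
    by (simp_all add: I_l_closed I_r_closed)
qed

text \<open>
  Zorn's lemma for the ideals that contain \<open>J\<close> but not \<open>\<one>\<close>; the union of a nonempty chain of such
  ideals is again one.
\<close>

lemma exists_maximalideal:
  assumes J: "ideal J R" "\<one> \<notin> J"
  shows "\<exists>m. maximalideal m R \<and> J \<subseteq> m"
proof -
  define A where "A = {K. ideal K R \<and> J \<subseteq> K \<and> \<one> \<notin> K}"
  have "\<exists>m\<in>A. \<forall>K\<in>A. m \<subseteq> K \<longrightarrow> K = m"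
  proof (rule subset_Zorn_nonempty)
    show "A \<noteq> {}" using J by (auto simp: A_def)
    fix C assume C: "C \<noteq> {}" "subset.chain A C"
    then have id: "ideal K R" "J \<subseteq> K" "\<one> \<notin> K" if "K \<in> C" for K
      using that by (auto simp: A_def subset_chain_def)
    have up: "\<exists>K\<in>C. a \<in> K \<and> b \<in> K" if ab: "a \<in> \<Union>C" "b \<in> \<Union>C" for a b
    proof -
      obtain K L where KL: "K \<in> C" "a \<in> K" "L \<in> C" "b \<in> L" using ab by blast
      then have "K \<subseteq> L \<or> L \<subseteq> K" using C(2) unfolding subset_chain_def by blast
      then show ?thesis using KL by blast
    qed
    have "ideal (\<Union>C) R"
    proof (rule idealI[OF ring_axioms])
      show "subgroup (\<Union>C) (add_monoid R)"
      proof (rule add.subgroupI)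
        show "\<Union>C \<subseteq> carrier R" using ideal_closure(6)[OF id(1)] by (intro Union_least subsetI)
        obtain K where "K \<in> C" using C(1) by blast
        then show "\<Union>C \<noteq> {}" using ideal_closure(1)[OF id(1)] by blast
        show "\<ominus> a \<in> \<Union>C" if a: "a \<in> \<Union>C" for a
        proof -
          obtain K where "K \<in> C" "a \<in> K" using a by blast
          then show ?thesis using ideal_closure(2)[OF id(1), of K a] by (intro UnionI[of K])
        qed
        show "a \<oplus> b \<in> \<Union>C" if ab: "a \<in> \<Union>C" "b \<in> \<Union>C" for a b
        proof -
          obtain K where "K \<in> C" "a \<in> K" "b \<in> K" using up[OF ab] by blast
          then show ?thesis using ideal_closure(3)[OF id(1), of K a b] by (intro UnionI[of K])
        qed
      qed
      fix a x assume ax: "a \<in> \<Union>C" "x \<in> carrier R"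
      then obtain K where K: "K \<in> C" "a \<in> K" by blast
      then show "x \<otimes> a \<in> \<Union>C" "a \<otimes> x \<in> \<Union>C"
        using ideal_closure(4,5)[OF id(1)[OF K(1)] K(2) ax(2)] by (intro UnionI[of K]; simp)+
    qed
    then show "\<Union>C \<in> A" using id C(1) unfolding A_def by blast
  qed
  then obtain m where mA: "m \<in> A" and max: "\<And>K. K \<in> A \<Longrightarrow> m \<subseteq> K \<Longrightarrow> K = m" by blast
  have m: "ideal m R" "J \<subseteq> m" "\<one> \<notin> m" using mA by (auto simp: A_def)
  have "maximalideal m R"
  proof (rule maximalidealI[OF m(1)])
    show "carrier R \<noteq> m" using m(3) by auto
    fix K assume K: "ideal K R" "m \<subseteq> K" "K \<subseteq> carrier R"
    show "K = m \<or> K = carrier R"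
    proof (cases "\<one> \<in> K")
      case True
      then show ?thesis using ideal.one_imp_carrier[OF K(1)] by simp
    next
      case False
      then have "K \<in> A" using K m(2) by (auto simp: A_def)
      then show ?thesis using max K(2) by simp
    qed
  qed
  with m(2) show ?thesis by blast
qed

lemma mSpecD:
  assumes "m \<in> mSpec R"
  shows "maximalideal m R" "ideal m R" "primeideal m R" "\<one> \<notin> m" "m \<subseteq> carrier R"
proof -
  show max: "maximalideal m R" using assms by (simp add: mSpec_def)
  then show id: "ideal m R" by (rule maximalideal.axioms)
  show "primeideal m R" using max by (rule maximalideal_prime)
  show "\<one> \<notin> m" using ideal.one_imp_carrier[OF id] maximalideal.I_notcarr[OF max] by auto
  show "m \<subseteq> carrier R" using ideal_closure(6)[OF id] by (rule subsetI)
qed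

lemma inverse_mod_maximal:
  assumes m: "m \<in> mSpec R" and a: "a \<in> carrier R" "a \<notin> m"
  shows "\<exists>b\<in>carrier R. \<one> \<ominus> b \<otimes> a \<in> m"
proof -
  note id = mSpecD(2)[OF m]
  let ?K = "PIdl a <+>\<^bsub>R\<^esub> m"
  have mem: "x \<in> ?K \<longleftrightarrow> (\<exists>b\<in>carrier R. \<exists>k\<in>m. x = b \<otimes> a \<oplus> k)" for x
    unfolding set_add_def' cgenideal_def by blast
  have K: "ideal ?K R" by (intro add_ideals cgenideal_ideal a id)
  have sub: "m \<subseteq> ?K"
  proof
    fix x assume x: "x \<in> m"
    then have "x = \<zero> \<otimes> a \<oplus> x" using a(1) ideal_closure(6)[OF id] by simp
    then show "x \<in> ?K" using x unfolding mem by blast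
  qed
  have "a = \<one> \<otimes> a \<oplus> \<zero>" using a(1) by simp
  then have aK: "a \<in> ?K" unfolding mem using ideal_closure(1)[OF id] by blast
  have "?K = carrier R"
    using maximalideal.I_maximal[OF mSpecD(1)[OF m] K sub] aK a(2) ideal_closure(6)[OF K] by blast
  then have "\<one> \<in> ?K" by simp
  then obtain b k where b: "b \<in> carrier R" "k \<in> m" "\<one> = b \<otimes> a \<oplus> k"
    unfolding mem by blast
  have k: "k \<in> carrier R" using b(2) ideal_closure(6)[OF id] by blast
  have "(b \<otimes> a \<oplus> k) \<ominus> b \<otimes> a = k" using a(1) k b(1) by algebra
  then have "\<one> \<ominus> b \<otimes> a \<in> m" using b(2) by (simp only: b(3)[symmetric])
  then show ?thesis using b(1) by blast
qed

text \<open>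
  If \<open>e\<close> works for \<open>A\<close> and \<open>f \<in> m\<close> satisfies \<open>f \<equiv> 1\<close> modulo \<open>n\<close>, then \<open>e f\<close> works for
  \<open>insert m A\<close>.
\<close>

lemma ex_separating_single:
  assumes "finite A" "A \<subseteq> mSpec R" "n \<in> mSpec R" "n \<notin> A"
  shows "\<exists>e\<in>carrier R. (\<forall>m\<in>A. e \<in> m) \<and> \<one> \<ominus> e \<in> n"
  using assms(1,2,4)
proof (induction rule: finite_induct)
  case empty
  have "\<one> \<ominus> \<one> = \<zero>" by algebra
  then have "\<one> \<ominus> \<one> \<in> n" using ideal_closure(1)[OF mSpecD(2)[OF assms(3)]] by (simp only:)
  then show ?case by auto
next
  case (insert m A)
  then obtain e where e: "e \<in> carrier R" "\<forall>m\<in>A. e \<in> m" "\<one> \<ominus> e \<in> n" by auto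
  note n = mSpecD(2)[OF assms(3)]
  have m: "m \<in> mSpec R" using insert by blast
  have "\<not> m \<subseteq> n"
  proof
    assume "m \<subseteq> n"
    then have "n = m \<or> n = carrier R"
      using maximalideal.I_maximal[OF mSpecD(1)[OF m] n] mSpecD(5)[OF assms(3)] by blast
    then show False using insert.prems mSpecD(4)[OF assms(3)] one_closed by blast
  qed
  then obtain a where a: "a \<in> m" "a \<notin> n" by blast
  have ac: "a \<in> carrier R" using a mSpecD(5)[OF m] by blast
  obtain b where b: "b \<in> carrier R" "\<one> \<ominus> b \<otimes> a \<in> n"
    using inverse_mod_maximal[OF assms(3) ac a(2)] by blast
  define f where "f = b \<otimes> a"
  have f: "f \<in> m" "f \<in> carrier R" using a b ideal_closure(4)[OF mSpecD(2)[OF m]] ac by (auto simp: f_def)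
  have "\<one> \<ominus> e \<otimes> f = (\<one> \<ominus> e) \<oplus> e \<otimes> (\<one> \<ominus> f)" using e(1) f(2) by algebra
  also have "\<dots> \<in> n"
    using ideal_closure(3)[OF n e(3) ideal_closure(4)[OF n b(2) e(1)]] by (simp add: f_def)
  finally have "\<one> \<ominus> e \<otimes> f \<in> n" .
  moreover have "e \<otimes> f \<in> k" if k: "k \<in> insert m A" for k
  proof -
    have "ideal k R" using k insert.prems(1) mSpecD(2) by blast
    then show ?thesis using k f e ideal_closure(4,5) by blast
  qed
  ultimately show ?case using e(1) f(2) by (intro bexI[of _ "e \<otimes> f"]) auto
qed

text \<open>
  The form of the Chinese remainder theorem that is needed: an element that vanishes modulo the ideals
  in \<open>A\<close> and is \<open>1\<close> modulo those in \<open>B\<close>.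
\<close>

lemma ex_separating:
  assumes "finite A" "finite B" "A \<subseteq> mSpec R" "B \<subseteq> mSpec R" "A \<inter> B = {}"
  shows "\<exists>e\<in>carrier R. (\<forall>m\<in>A. e \<in> m) \<and> (\<forall>n\<in>B. \<one> \<ominus> e \<in> n)"
  using assms(2,4,5)
proof (induction rule: finite_induct)
  case empty
  have "\<forall>m\<in>A. \<zero> \<in> m" using assms(3) mSpecD(2) ideal_closure(1) by blast
  then show ?case by auto
next
  case (insert n B)
  then obtain e where e: "e \<in> carrier R" "\<forall>m\<in>A. e \<in> m" "\<forall>n\<in>B. \<one> \<ominus> e \<in> n" by auto
  obtain f where f: "f \<in> carrier R" "\<forall>m\<in>A. f \<in> m" "\<one> \<ominus> f \<in> n"
    using ex_separating_single[OF assms(1,3), of n] insert.prems by auto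
  \<comment> \<open>the complement of \<open>g\<close> is the product of the complements of \<open>e\<close> and \<open>f\<close>\<close>
  define g where "g = e \<oplus> f \<otimes> (\<one> \<ominus> e)"
  have eq: "\<one> \<ominus> g = (\<one> \<ominus> e) \<otimes> (\<one> \<ominus> f)" unfolding g_def using e(1) f(1) by algebra
  have g: "g \<in> carrier R" using e(1) f(1) by (simp add: g_def)
  have "g \<in> m" if m: "m \<in> A" for m
  proof -
    have id: "ideal m R" using m assms(3) mSpecD(2) by blast
    show ?thesis
      unfolding g_def using e f m
      by (intro ideal_closure(3)[OF id] ideal_closure(5)[OF id]) auto
  qed
  moreover have "\<one> \<ominus> g \<in> k" if k: "k \<in> insert n B" for k
  proof -
    have id: "ideal k R" using k insert.prems(1) mSpecD(2) by blast
    show ?thesis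
    proof (cases "k = n")
      case True
      then show ?thesis unfolding eq using f e(1) by (intro ideal_closure(4)[OF id]) auto
    next
      case False
      then have "\<one> \<ominus> e \<in> k" using k e(3) by blast
      then show ?thesis unfolding eq using f(1) by (intro ideal_closure(5)[OF id]) auto
    qed
  qed
  ultimately show ?case using g by blast
qed

end

context module
begin

text \<open>
  With \<open>e\<close> separating \<open>P\<close> from \<open>Q\<close>, the element \<open>x + e (y - x)\<close> agrees with \<open>x\<close> modulo the ideals in
  \<open>P\<close> and with \<open>y\<close> modulo those in \<open>Q\<close>. So residue classes at finitely many maximal ideals can be
  changed without affecting finitely many others.
\<close>

lemma residue_approximation:
  assumes P: "finite P" "finite Q" "P \<subseteq> mSpec R" "Q \<subseteq> mSpec R" "P \<inter> Q = {}"
    and x: "x \<in> carrier M" and y: "y \<in> carrier M"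
  shows "\<exists>z\<in>carrier M. (\<forall>I\<in>P. ideal_smult R M I +>\<^bsub>M\<^esub> z = ideal_smult R M I +>\<^bsub>M\<^esub> x) \<and>
    (\<forall>I\<in>Q. ideal_smult R M I +>\<^bsub>M\<^esub> z = ideal_smult R M I +>\<^bsub>M\<^esub> y)"
proof -
  obtain e where e: "e \<in> carrier R" "\<And>I. I \<in> P \<Longrightarrow> e \<in> I" "\<And>I. I \<in> Q \<Longrightarrow> \<one>\<^bsub>R\<^esub> \<ominus>\<^bsub>R\<^esub> e \<in> I"
    using ex_separating[OF P] by blast
  define z where "z = x \<oplus>\<^bsub>M\<^esub> e \<odot>\<^bsub>M\<^esub> (y \<ominus>\<^bsub>M\<^esub> x)"
  have z: "z \<in> carrier M" using x y e by (simp add: z_def M.minus_eq)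
  have zx: "z \<ominus>\<^bsub>M\<^esub> x = e \<odot>\<^bsub>M\<^esub> (y \<ominus>\<^bsub>M\<^esub> x)"
    using x y e by (simp add: z_def M.minus_eq M.a_ac M.r_neg2 M.r_neg1)
  have zy: "z \<ominus>\<^bsub>M\<^esub> y = (\<one>\<^bsub>R\<^esub> \<ominus>\<^bsub>R\<^esub> e) \<odot>\<^bsub>M\<^esub> (x \<ominus>\<^bsub>M\<^esub> y)"
    using x y e
    by (simp add: z_def M.minus_eq R.minus_eq smult_l_distr smult_r_distr smult_l_minus
        smult_r_minus M.minus_add M.a_ac)
  have "ideal_smult R M I +>\<^bsub>M\<^esub> z = ideal_smult R M I +>\<^bsub>M\<^esub> x" if "I \<in> P" for I
  proof -
    interpret module_ideal R M I
      using vectorspace_residue_module(2)[OF module_axioms] that P(3) by blast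
    show ?thesis
      unfolding rc_eq_iff[OF z x] zx using e(2)[OF that] x y by (intro smult_in_N) auto
  qed
  moreover have "ideal_smult R M I +>\<^bsub>M\<^esub> z = ideal_smult R M I +>\<^bsub>M\<^esub> y" if "I \<in> Q" for I
  proof -
    interpret module_ideal R M I
      using vectorspace_residue_module(2)[OF module_axioms] that P(4) by blast
    show ?thesis
      unfolding rc_eq_iff[OF z y] zy using e(3)[OF that] x y by (intro smult_in_N) auto
  qed
  ultimately show ?thesis using z by blast
qed

section \<open>A local form of Nakayama's lemma\<close>

lemma span_insertE:
  assumes "x \<in> span (insert e G)" "e \<in> carrier M" "G \<subseteq> carrier M"
  shows "\<exists>r\<in>carrier R. \<exists>q\<in>span G. x = r \<odot>\<^bsub>M\<^esub> e \<oplus>\<^bsub>M\<^esub> q"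
proof -
  note cl = span_closure[OF assms(3)]
  have G: "insert e G \<subseteq> carrier M" using assms by blast
  show ?thesis
    using assms(1) G
  proof (induction rule: span_induct)
    case zero
    then show ?case using cl(1) assms(2) by (intro bexI[of _ "\<zero>\<^bsub>R\<^esub>"] bexI[of _ "\<zero>\<^bsub>M\<^esub>"]) auto
  next
    case (base s)
    show ?case
    proof (cases "s = e")
      case True
      then show ?thesis
        using cl(1) assms(2) by (intro bexI[of _ "\<one>\<^bsub>R\<^esub>"] bexI[of _ "\<zero>\<^bsub>M\<^esub>"]) auto
    next
      case False
      then have s: "s \<in> G" using base by blast
      then have "s \<in> span G" "s \<in> carrier M" using in_own_span[OF assms(3)] assms(3) by auto
      then show ?thesis
        using assms(2) by (intro bexI[of _ "\<zero>\<^bsub>R\<^esub>"] bexI[of _ s]) auto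
    qed
  next
    case (add x y)
    then obtain r q r' q' where h: "r \<in> carrier R" "q \<in> span G" "x = r \<odot>\<^bsub>M\<^esub> e \<oplus>\<^bsub>M\<^esub> q"
      "r' \<in> carrier R" "q' \<in> span G" "y = r' \<odot>\<^bsub>M\<^esub> e \<oplus>\<^bsub>M\<^esub> q'" by blast
    then have "x \<oplus>\<^bsub>M\<^esub> y = (r \<oplus>\<^bsub>R\<^esub> r') \<odot>\<^bsub>M\<^esub> e \<oplus>\<^bsub>M\<^esub> (q \<oplus>\<^bsub>M\<^esub> q')"
      using cl(5) assms(2) by (simp add: smult_l_distr M.a_ac)
    moreover have "q \<oplus>\<^bsub>M\<^esub> q' \<in> span G" "r \<oplus>\<^bsub>R\<^esub> r' \<in> carrier R" using h cl(2) by auto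
    ultimately show ?case by blast
  next
    case (smult a x)
    then obtain r q where h: "r \<in> carrier R" "q \<in> span G" "x = r \<odot>\<^bsub>M\<^esub> e \<oplus>\<^bsub>M\<^esub> q" by blast
    then have "a \<odot>\<^bsub>M\<^esub> x = (a \<otimes>\<^bsub>R\<^esub> r) \<odot>\<^bsub>M\<^esub> e \<oplus>\<^bsub>M\<^esub> a \<odot>\<^bsub>M\<^esub> q"
      using cl(5) assms(2) smult(1) by (simp add: smult_r_distr smult_assoc1)
    moreover have "a \<odot>\<^bsub>M\<^esub> q \<in> span G" "a \<otimes>\<^bsub>R\<^esub> r \<in> carrier R" using h cl(3) smult(1) by auto
    ultimately show ?case by blast
  qed
qed

text \<open>
  If \<open>M = span G + mM\<close>, then \<open>M\<close> and \<open>span G\<close> agree after inverting one element outside \<open>m\<close>.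
  Induction on the number of further generators \<open>A\<close> replaces the usual determinant: moving a
  generator \<open>e\<close> from \<open>A\<close> to \<open>G\<close>, the induction hypothesis gives \<open>a \<notin> m\<close> with
  \<open>a M \<subseteq> span (insert e G)\<close>. Hence \<open>a (mM) \<subseteq> m e + span G\<close>, and writing \<open>e = p + w\<close> with
  \<open>p \<in> span G\<close> and \<open>w \<in> mM\<close> yields \<open>(a - \<mu>) e \<in> span G\<close> for some \<open>\<mu> \<in> m\<close>. The product
  \<open>(a - \<mu>) a\<close> is the required element.
\<close>

lemma local_nakayama:
  assumes m: "m \<in> mSpec R"
    and A: "finite A" "A \<subseteq> carrier M"
    and G: "G \<subseteq> carrier M" "span (A \<union> G) = carrier M"
    and gen: "\<And>x. x \<in> carrier M \<Longrightarrow> \<exists>p\<in>span G. x \<ominus>\<^bsub>M\<^esub> p \<in> ideal_smult R M m"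
  shows "\<exists>a\<in>carrier R. a \<notin> m \<and> (\<forall>x\<in>carrier M. a \<odot>\<^bsub>M\<^esub> x \<in> span G)"
  using A G gen
proof (induction A arbitrary: G rule: finite_induct)
  case empty
  then show ?case using mSpecD(4)[OF m] by (intro bexI[of _ "\<one>\<^bsub>R\<^esub>"]) auto
next
  case (insert e A)
  interpret mi: module_ideal R M m by (rule vectorspace_residue_module(2)[OF module_axioms m])
  note mI = ideal_closure[OF mSpecD(2)[OF m]]
  have e: "e \<in> carrier M" "A \<subseteq> carrier M" using insert.prems by auto
  note cl = span_closure[OF insert.prems(2)]
  have G': "insert e G \<subseteq> carrier M" using insert.prems e by blast
  have "\<exists>a\<in>carrier R. a \<notin> m \<and> (\<forall>x\<in>carrier M. a \<odot>\<^bsub>M\<^esub> x \<in> span (insert e G))"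
  proof (rule insert.IH[OF e(2) G'])
    show "span (A \<union> insert e G) = carrier M" using insert.prems(3) by simp
    show "\<exists>p\<in>span (insert e G). x \<ominus>\<^bsub>M\<^esub> p \<in> ideal_smult R M m" if "x \<in> carrier M" for x
      using insert.prems(4)[OF that] span_is_monotone[of G "insert e G"] by blast
  qed
  then obtain a where a: "a \<in> carrier R" "a \<notin> m"
    "\<And>x. x \<in> carrier M \<Longrightarrow> a \<odot>\<^bsub>M\<^esub> x \<in> span (insert e G)" by blast
  have aw: "\<exists>\<mu>\<in>m. \<exists>q\<in>span G. a \<odot>\<^bsub>M\<^esub> w = \<mu> \<odot>\<^bsub>M\<^esub> e \<oplus>\<^bsub>M\<^esub> q" if w: "w \<in> ideal_smult R M m" for w
    using w mi.gens_subset unfolding ideal_smult_def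
  proof (induction rule: span_induct)
    case zero
    then show ?case
      using cl(1) e a mI(1) by (intro bexI[of _ "\<zero>\<^bsub>R\<^esub>"] bexI[of _ "\<zero>\<^bsub>M\<^esub>"]) auto
  next
    case (base s)
    then obtain \<mu> x where s: "s = \<mu> \<odot>\<^bsub>M\<^esub> x" "\<mu> \<in> m" "x \<in> carrier M" by blast
    have \<mu>: "\<mu> \<in> carrier R" using mI(6)[OF s(2)] .
    obtain r q where h: "r \<in> carrier R" "q \<in> span G" "a \<odot>\<^bsub>M\<^esub> x = r \<odot>\<^bsub>M\<^esub> e \<oplus>\<^bsub>M\<^esub> q"
      using span_insertE[OF a(3)[OF s(3)] e(1) insert.prems(2)] by blast
    have "a \<odot>\<^bsub>M\<^esub> s = \<mu> \<odot>\<^bsub>M\<^esub> (a \<odot>\<^bsub>M\<^esub> x)"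
      using s \<mu> a by (simp add: smult_assoc1[symmetric] R.m_comm)
    also have "\<dots> = (\<mu> \<otimes>\<^bsub>R\<^esub> r) \<odot>\<^bsub>M\<^esub> e \<oplus>\<^bsub>M\<^esub> \<mu> \<odot>\<^bsub>M\<^esub> q"
      unfolding h using h \<mu> e cl(5) by (simp add: smult_r_distr smult_assoc1)
    finally show ?case using mI(5)[OF s(2) h(1)] cl(3)[OF \<mu> h(2)] by blast
  next
    case (add x y)
    have xy: "x \<in> carrier M" "y \<in> carrier M" using add span_closure(5)[OF mi.gens_subset] by blast+
    from add obtain r q r' q' where h: "r \<in> m" "q \<in> span G" "a \<odot>\<^bsub>M\<^esub> x = r \<odot>\<^bsub>M\<^esub> e \<oplus>\<^bsub>M\<^esub> q"
      "r' \<in> m" "q' \<in> span G" "a \<odot>\<^bsub>M\<^esub> y = r' \<odot>\<^bsub>M\<^esub> e \<oplus>\<^bsub>M\<^esub> q'" by blast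
    have "a \<odot>\<^bsub>M\<^esub> (x \<oplus>\<^bsub>M\<^esub> y) = (r \<oplus>\<^bsub>R\<^esub> r') \<odot>\<^bsub>M\<^esub> e \<oplus>\<^bsub>M\<^esub> (q \<oplus>\<^bsub>M\<^esub> q')"
      using h xy a(1) cl(5) e mI(6) by (simp add: smult_l_distr smult_r_distr M.a_ac)
    then show ?case using mI(3)[OF h(1,4)] cl(2)[OF h(2,5)] by blast
  next
    case (smult b x)
    have x: "x \<in> carrier M" using smult span_closure(5)[OF mi.gens_subset] by blast
    from smult obtain r q where h: "r \<in> m" "q \<in> span G" "a \<odot>\<^bsub>M\<^esub> x = r \<odot>\<^bsub>M\<^esub> e \<oplus>\<^bsub>M\<^esub> q" by blast
    have "a \<odot>\<^bsub>M\<^esub> (b \<odot>\<^bsub>M\<^esub> x) = b \<odot>\<^bsub>M\<^esub> (a \<odot>\<^bsub>M\<^esub> x)"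
      using x smult(1) a by (simp add: smult_assoc1[symmetric] R.m_comm)
    also have "\<dots> = (b \<otimes>\<^bsub>R\<^esub> r) \<odot>\<^bsub>M\<^esub> e \<oplus>\<^bsub>M\<^esub> b \<odot>\<^bsub>M\<^esub> q"
      unfolding h(3) using h smult(1) e cl(5) mI(6) by (simp add: smult_r_distr smult_assoc1)
    finally show ?case using mI(4)[OF h(1) smult(1)] cl(3)[OF smult(1) h(2)] by blast
  qed
  obtain p where p: "p \<in> span G" "e \<ominus>\<^bsub>M\<^esub> p \<in> ideal_smult R M m"
    using insert.prems(4)[OF e(1)] by blast
  obtain \<mu> q where \<mu>: "\<mu> \<in> m" "q \<in> span G" "a \<odot>\<^bsub>M\<^esub> (e \<ominus>\<^bsub>M\<^esub> p) = \<mu> \<odot>\<^bsub>M\<^esub> e \<oplus>\<^bsub>M\<^esub> q"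
    using aw[OF p(2)] by blast
  have car: "\<mu> \<in> carrier R" "p \<in> carrier M" "q \<in> carrier M" using \<mu> p cl(5) mI(6) by auto
  define b where "b = a \<ominus>\<^bsub>R\<^esub> \<mu>"
  have b: "b \<in> carrier R" using a car by (simp add: b_def)
  have "b \<notin> m"
  proof
    assume "b \<in> m"
    then have "b \<oplus>\<^bsub>R\<^esub> \<mu> \<in> m" using mI(3) \<mu>(1) by blast
    moreover have "b \<oplus>\<^bsub>R\<^esub> \<mu> = a" unfolding b_def using a(1) car(1) by algebra
    ultimately show False using a by simp
  qed
  have "a \<odot>\<^bsub>M\<^esub> e = a \<odot>\<^bsub>M\<^esub> (e \<ominus>\<^bsub>M\<^esub> p) \<oplus>\<^bsub>M\<^esub> a \<odot>\<^bsub>M\<^esub> p"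
    using a(1) e(1) car by (simp add: smult_r_distr[symmetric] M.minus_eq M.a_assoc M.l_neg)
  also have "\<dots> = \<mu> \<odot>\<^bsub>M\<^esub> e \<oplus>\<^bsub>M\<^esub> (q \<oplus>\<^bsub>M\<^esub> a \<odot>\<^bsub>M\<^esub> p)"
    unfolding \<mu>(3) using a(1) e(1) car by (simp add: M.a_assoc)
  finally have ae: "a \<odot>\<^bsub>M\<^esub> e = \<mu> \<odot>\<^bsub>M\<^esub> e \<oplus>\<^bsub>M\<^esub> (q \<oplus>\<^bsub>M\<^esub> a \<odot>\<^bsub>M\<^esub> p)" .
  have "b \<odot>\<^bsub>M\<^esub> e = \<ominus>\<^bsub>M\<^esub> (\<mu> \<odot>\<^bsub>M\<^esub> e) \<oplus>\<^bsub>M\<^esub> a \<odot>\<^bsub>M\<^esub> e"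
    using a(1) e(1) car(1) by (simp add: b_def R.minus_eq smult_l_distr smult_l_minus M.a_comm)
  also have "\<dots> = q \<oplus>\<^bsub>M\<^esub> a \<odot>\<^bsub>M\<^esub> p"
    unfolding ae using a(1) e(1) car by (intro M.r_neg1) auto
  finally have "b \<odot>\<^bsub>M\<^esub> e = q \<oplus>\<^bsub>M\<^esub> a \<odot>\<^bsub>M\<^esub> p" .
  then have be: "b \<odot>\<^bsub>M\<^esub> e \<in> span G" using cl(2)[OF \<mu>(2) cl(3)[OF a(1) p(1)]] by simp
  have "(b \<otimes>\<^bsub>R\<^esub> a) \<odot>\<^bsub>M\<^esub> x \<in> span G" if x: "x \<in> carrier M" for x
  proof -
    obtain r q where h: "r \<in> carrier R" "q \<in> span G" "a \<odot>\<^bsub>M\<^esub> x = r \<odot>\<^bsub>M\<^esub> e \<oplus>\<^bsub>M\<^esub> q"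
      using span_insertE[OF a(3)[OF x] e(1) insert.prems(2)] by blast
    have "(b \<otimes>\<^bsub>R\<^esub> a) \<odot>\<^bsub>M\<^esub> x = b \<odot>\<^bsub>M\<^esub> (r \<odot>\<^bsub>M\<^esub> e \<oplus>\<^bsub>M\<^esub> q)"
      using a(1) b x h(3) by (simp add: smult_assoc1)
    also have "\<dots> = r \<odot>\<^bsub>M\<^esub> (b \<odot>\<^bsub>M\<^esub> e) \<oplus>\<^bsub>M\<^esub> b \<odot>\<^bsub>M\<^esub> q"
      using b h e(1) cl(5) by (simp add: smult_r_distr smult_assoc1[symmetric] R.m_comm)
    finally show ?thesis using cl(2)[OF cl(3)[OF h(1) be] cl(3)[OF b h(2)]] by simp
  qed
  moreover have "b \<otimes>\<^bsub>R\<^esub> a \<notin> m" using primeideal.I_prime[OF mSpecD(3)[OF m] b a(1)] a(2) \<open>b \<notin> m\<close> by blast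
  ultimately show ?case using b a(1) by (intro bexI[of _ "b \<otimes>\<^bsub>R\<^esub> a"]) auto
qed

lemma ex_residue_generator:
  assumes fg: "finitely_generated_module R M" and m: "m \<in> mSpec R" "m \<notin> mSpec_ge2 R M"
  shows "\<exists>x\<in>carrier M. \<forall>y\<in>carrier M. \<exists>p\<in>span {x}. y \<ominus>\<^bsub>M\<^esub> p \<in> ideal_smult R M m"
proof -
  interpret mi: module_ideal R M m by (rule vectorspace_residue_module(2)[OF module_axioms m(1)])
  interpret Q: vectorspace "R Quot m" "residue_module R M m"
    by (rule vectorspace_residue_module(1)[OF module_axioms m(1)])
  obtain B where B: "finite B" "Q.basis B"
    using Q.finite_basis_exists fin_dim_residue_module[OF module_axioms fg m(1)] by blast
  have "card B \<le> 1"
    using Q.dim_basis[OF B] m by (auto simp: mSpec_ge2_def)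
  have Bsub: "B \<subseteq> carrier (residue_module R M m)" using B(2) by (simp add: Q.basis_def)
  have "\<exists>g\<in>carrier (residue_module R M m). B \<subseteq> {g}"
  proof (cases "B = {}")
    case True
    then show ?thesis using Q.M.zero_closed by blast
  next
    case False
    then have "card B = 1" using \<open>card B \<le> 1\<close> B(1) card_0_eq[OF B(1)] by linarith
    then obtain g where "B = {g}" by (rule card_1_singletonE)
    then show ?thesis using Bsub by blast
  qed
  then obtain g where g: "g \<in> carrier (residue_module R M m)" "B \<subseteq> {g}" by blast
  obtain x where x: "x \<in> carrier M" "g = mi.rc x" using g(1) mi.carrier_residue_module by auto
  show ?thesis
  proof (intro bexI[OF _ x(1)] ballI)
    fix y assume y: "y \<in> carrier M"
    have "mi.rc y \<in> Q.span B" using B(2) y mi.carrier_residue_module by (auto simp: Q.basis_def)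
    then have ys: "mi.rc y \<in> Q.span (insert g {})" using Q.span_is_monotone[OF g(2)] by (rule subsetD[rotated])
    then obtain c q where c: "c \<in> carrier (R Quot m)" "q \<in> Q.span {}"
      "mi.rc y = c \<odot>\<^bsub>residue_module R M m\<^esub> g \<oplus>\<^bsub>residue_module R M m\<^esub> q"
      using Q.span_insertE[OF ys g(1) empty_subsetI] by blast
    have q: "q = \<zero>\<^bsub>residue_module R M m\<^esub>"
      using c(2) by (auto simp: Q.span_def Q.lincomb_def)
    obtain r where r: "r \<in> carrier R" "c = m +>\<^bsub>R\<^esub> r" using c(1) mi.carrier_quot by auto
    have "mi.rc y = mi.rc (r \<odot>\<^bsub>M\<^esub> x)"
      unfolding c(3) q r(2) x(2) using r(1) x(1)
      by (simp add: mi.smult_residue_module mi.zero_residue_module mi.add_residue_module)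
    then have "y \<ominus>\<^bsub>M\<^esub> r \<odot>\<^bsub>M\<^esub> x \<in> ideal_smult R M m"
      using mi.rc_eq_iff y r(1) x(1) by simp
    moreover have "r \<odot>\<^bsub>M\<^esub> x \<in> span {x}"
      using span_closure(3)[of "{x}" r x] in_own_span[of "{x}"] x(1) r(1) by simp
    ultimately show "\<exists>p\<in>span {x}. y \<ominus>\<^bsub>M\<^esub> p \<in> ideal_smult R M m" by blast
  qed
qed

text \<open>
  The set of maximal ideals where the residue space has dimension at least two is closed in the
  maximal spectrum: at any other maximal ideal \<open>m\<close> the residue space is generated by the class of
  one \<open>x\<close>, so \<open>a M \<subseteq> span {x}\<close> for some \<open>a \<notin> m\<close> by Nakayama's lemma. At a maximal ideal that
  does not contain \<open>a\<close>, multiplication by \<open>a\<close> is invertible on the residue space, which is then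
  generated by the class of \<open>x\<close> too and has dimension at most one.
\<close>

lemma ex_in_Inter_mSpec_ge2:
  assumes fg: "finitely_generated_module R M" and m: "m \<in> mSpec R" "m \<notin> mSpec_ge2 R M"
  shows "\<exists>a\<in>carrier R. a \<notin> m \<and> (\<forall>n\<in>mSpec_ge2 R M. a \<in> n)"
proof -
  obtain x where x: "x \<in> carrier M"
    "\<And>y. y \<in> carrier M \<Longrightarrow> \<exists>p\<in>span {x}. y \<ominus>\<^bsub>M\<^esub> p \<in> ideal_smult R M m"
    using ex_residue_generator[OF assms] by blast
  obtain A where A: "finite A" "A \<subseteq> carrier M" "span A = carrier M"
    using fg unfolding finitely_generated_module_def by blast
  have xs: "{x} \<subseteq> carrier M" using x by blast
  have "span (A \<union> {x}) = carrier M"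
    using span_is_monotone[of A "A \<union> {x}"] A span_is_subset2[of "A \<union> {x}"] xs by blast
  from local_nakayama[OF m(1) A(1,2) xs this x(2)]
  obtain a where a: "a \<in> carrier R" "a \<notin> m" "\<And>y. y \<in> carrier M \<Longrightarrow> a \<odot>\<^bsub>M\<^esub> y \<in> span {x}"
    by blast
  have "a \<in> n" if n: "n \<in> mSpec_ge2 R M" for n
  proof (rule ccontr)
    assume an: "a \<notin> n"
    have nS: "n \<in> mSpec R" using n by (simp add: mSpec_ge2_def)
    interpret mi: module_ideal R M n by (rule vectorspace_residue_module(2)[OF module_axioms nS])
    interpret Q: vectorspace "R Quot n" "residue_module R M n"
      by (rule vectorspace_residue_module(1)[OF module_axioms nS])
    obtain b where b: "b \<in> carrier R" "\<one>\<^bsub>R\<^esub> \<ominus>\<^bsub>R\<^esub> b \<otimes>\<^bsub>R\<^esub> a \<in> n"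
      using inverse_mod_maximal[OF nS a(1) an] by blast
    have "Q.gen_set (mi.rc ` {x})"
    proof (rule mi.gen_set_residue_module[OF xs])
      fix y assume y: "y \<in> carrier M"
      have "y \<ominus>\<^bsub>M\<^esub> b \<odot>\<^bsub>M\<^esub> (a \<odot>\<^bsub>M\<^esub> y) = (\<one>\<^bsub>R\<^esub> \<ominus>\<^bsub>R\<^esub> b \<otimes>\<^bsub>R\<^esub> a) \<odot>\<^bsub>M\<^esub> y"
        using y a(1) b(1)
        by (simp add: R.minus_eq M.minus_eq smult_l_distr smult_l_minus smult_assoc1)
      also have "\<dots> \<in> mi.N" by (rule mi.smult_in_N[OF b(2) y])
      finally show "\<exists>p\<in>span {x}. y \<ominus>\<^bsub>M\<^esub> p \<in> mi.N"
        using span_closure(3)[OF xs b(1) a(3)[OF y]] by blast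
    qed
    then have "Q.dim \<le> card (mi.rc ` {x})"
      using x(1) mi.carrier_residue_module by (intro Q.gen_ge_dim) auto
    then show False using n by (simp add: mSpec_ge2_def)
  qed
  with a show ?thesis by blast
qed

lemma ex_mSpec_ge2_above_ideal_containing_Inter:
  assumes fg: "finitely_generated_module R M" and K: "ideal K R" "\<one>\<^bsub>R\<^esub> \<notin> K"
    and sub: "carrier R \<inter> \<Inter>(mSpec_ge2 R M) \<subseteq> K"
  shows "\<exists>m\<in>mSpec_ge2 R M. K \<subseteq> m"
proof -
  obtain m where m: "maximalideal m R" "K \<subseteq> m" using exists_maximalideal[OF K] by blast
  have "m \<in> mSpec_ge2 R M"
    using ex_in_Inter_mSpec_ge2[OF fg, of m] m sub by (auto simp: mSpec_def)
  with m show ?thesis by blast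
qed

text \<open>
  This is applied twice: to a principal ideal, to invert the elements of \<open>T\<close> modulo the
  intersection of \<open>mSpec_ge2 R M\<close>, and to the contraction of a maximal ideal of the localization.
  The last assumption says that \<open>p\<close> and that intersection generate a proper ideal.
\<close>

lemma ex_mSpec_ge2_above_ideal:
  assumes fg: "finitely_generated_module R M" and p: "ideal p R" and ne: "mSpec_ge2 R M \<noteq> {}"
    and no: "\<And>a j. a \<in> p \<Longrightarrow> j \<in> \<Inter>(mSpec_ge2 R M) \<Longrightarrow> \<one>\<^bsub>R\<^esub> \<noteq> a \<oplus>\<^bsub>R\<^esub> j"
  shows "\<exists>m\<in>mSpec_ge2 R M. p \<subseteq> m"
proof -
  have id: "ideal m R" if "m \<in> mSpec_ge2 R M" for m
    using that by (auto simp: mSpec_ge2_def intro: mSpecD)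
  let ?J = "\<Inter>(mSpec_ge2 R M)"
  have J: "ideal ?J R" using id ne by (rule R.i_Intersect)
  have K: "ideal (p <+>\<^bsub>R\<^esub> ?J) R" by (rule R.add_ideals[OF p J])
  have mem: "x \<in> p <+>\<^bsub>R\<^esub> ?J \<longleftrightarrow> (\<exists>a\<in>p. \<exists>j\<in>?J. x = a \<oplus>\<^bsub>R\<^esub> j)" for x
    unfolding set_add_def' by blast
  have "p \<subseteq> p <+>\<^bsub>R\<^esub> ?J"
  proof
    fix a assume a: "a \<in> p"
    then have "a = a \<oplus>\<^bsub>R\<^esub> \<zero>\<^bsub>R\<^esub>" using ideal_closure(6)[OF p] by simp
    then show "a \<in> p <+>\<^bsub>R\<^esub> ?J" using a ideal_closure(1)[OF J] unfolding mem by blast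
  qed
  moreover have "carrier R \<inter> ?J \<subseteq> p <+>\<^bsub>R\<^esub> ?J"
  proof
    fix a assume a: "a \<in> carrier R \<inter> ?J"
    then have "a = \<zero>\<^bsub>R\<^esub> \<oplus>\<^bsub>R\<^esub> a" by simp
    then show "a \<in> p <+>\<^bsub>R\<^esub> ?J" using a ideal_closure(1)[OF p] unfolding mem by blast
  qed
  moreover have "\<one>\<^bsub>R\<^esub> \<notin> p <+>\<^bsub>R\<^esub> ?J" using no unfolding mem by blast
  ultimately obtain m where "m \<in> mSpec_ge2 R M" "p <+>\<^bsub>R\<^esub> ?J \<subseteq> m"
    using ex_mSpec_ge2_above_ideal_containing_Inter[OF fg K] by blast
  with \<open>p \<subseteq> p <+>\<^bsub>R\<^esub> ?J\<close> show ?thesis by blast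
qed

end

section \<open>Localization\<close>

lemma UN_UN_pair_const:
  assumes "(a, b) \<in> A" "(a', b') \<in> B"
    "\<And>x s y t. (x, s) \<in> A \<Longrightarrow> (y, t) \<in> B \<Longrightarrow> f x s y t = c"
  shows "(\<Union>(x, s)\<in>A. \<Union>(y, t)\<in>B. f x s y t) = c"
  using assms by fast

locale localization = module R M
  for R :: "('a, 'r) ring_scheme" (structure) and M :: "('a, 'b, 'm) module_scheme" +
  fixes T :: "'a set"
  assumes T_subset: "T \<subseteq> carrier R"
    and one_T: "\<one> \<in> T"
    and mult_T: "\<And>s t. s \<in> T \<Longrightarrow> t \<in> T \<Longrightarrow> s \<otimes> t \<in> T"
begin

lemma T_closed [simp, intro]: "s \<in> T \<Longrightarrow> s \<in> carrier R" using T_subset by blast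

abbreviation "mfrac x s \<equiv> module_frac R M T x s"
abbreviation "TM \<equiv> localization_module R M T"

lemma rel_iff:
  "((x, s), (y, t)) \<in> loc_module_rel R M T \<longleftrightarrow>
    x \<in> carrier M \<and> y \<in> carrier M \<and> s \<in> T \<and> t \<in> T \<and>
    (\<exists>u\<in>T. u \<odot>\<^bsub>M\<^esub> (t \<odot>\<^bsub>M\<^esub> x) = u \<odot>\<^bsub>M\<^esub> (s \<odot>\<^bsub>M\<^esub> y))"
  by (simp add: loc_module_rel_def)

lemma equiv_rel: "equiv (carrier M \<times> T) (loc_module_rel R M T)"
proof (rule equivI)
  show "refl_on (carrier M \<times> T) (loc_module_rel R M T)"
    using one_T by (auto simp: refl_on_def rel_iff)
  show "loc_module_rel R M T \<subseteq> (carrier M \<times> T) \<times> (carrier M \<times> T)"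
    by (auto simp: rel_iff)
  show "sym (loc_module_rel R M T)"
    by (rule symI) (clarsimp simp: rel_iff, metis)
  show "trans (loc_module_rel R M T)"
  proof (rule transI, clarsimp simp: rel_iff)
    fix x s y t z r u w
    assume h: "x \<in> carrier M" "y \<in> carrier M" "z \<in> carrier M" "s \<in> T" "t \<in> T" "r \<in> T" "u \<in> T" "w \<in> T"
      and u: "u \<odot>\<^bsub>M\<^esub> (t \<odot>\<^bsub>M\<^esub> x) = u \<odot>\<^bsub>M\<^esub> (s \<odot>\<^bsub>M\<^esub> y)"
      and w: "w \<odot>\<^bsub>M\<^esub> (r \<odot>\<^bsub>M\<^esub> y) = w \<odot>\<^bsub>M\<^esub> (t \<odot>\<^bsub>M\<^esub> z)"
    have "(u \<otimes> w \<otimes> t) \<odot>\<^bsub>M\<^esub> (r \<odot>\<^bsub>M\<^esub> x) = (w \<otimes> r) \<odot>\<^bsub>M\<^esub> (u \<odot>\<^bsub>M\<^esub> (t \<odot>\<^bsub>M\<^esub> x))"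
      using h by (simp add: smult_assoc1[symmetric] m_ac)
    also have "\<dots> = (u \<otimes> s) \<odot>\<^bsub>M\<^esub> (w \<odot>\<^bsub>M\<^esub> (r \<odot>\<^bsub>M\<^esub> y))"
      unfolding u using h by (simp add: smult_assoc1[symmetric] m_ac)
    also have "\<dots> = (u \<otimes> w \<otimes> t) \<odot>\<^bsub>M\<^esub> (s \<odot>\<^bsub>M\<^esub> z)"
      unfolding w using h by (simp add: smult_assoc1[symmetric] m_ac)
    finally show "\<exists>v\<in>T. v \<odot>\<^bsub>M\<^esub> (r \<odot>\<^bsub>M\<^esub> x) = v \<odot>\<^bsub>M\<^esub> (s \<odot>\<^bsub>M\<^esub> z)"
      using h mult_T by blast
  qed
qed

lemma frac_eq_iff:
  assumes "x \<in> carrier M" "y \<in> carrier M" "s \<in> T" "t \<in> T"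
  shows "mfrac x s = mfrac y t \<longleftrightarrow> (\<exists>u\<in>T. u \<odot>\<^bsub>M\<^esub> (t \<odot>\<^bsub>M\<^esub> x) = u \<odot>\<^bsub>M\<^esub> (s \<odot>\<^bsub>M\<^esub> y))"
  unfolding module_frac_def using eq_equiv_class_iff[OF equiv_rel, of "(x, s)" "(y, t)"] assms
  by (simp add: rel_iff)

lemma mem_frac: "(y, t) \<in> mfrac x s \<longleftrightarrow> ((x, s), (y, t)) \<in> loc_module_rel R M T"
  by (simp add: module_frac_def)

lemma frac_self: "x \<in> carrier M \<Longrightarrow> s \<in> T \<Longrightarrow> (x, s) \<in> mfrac x s"
  using one_T by (auto simp: mem_frac rel_iff)

lemma frac_cancel:
  assumes "x \<in> carrier M" "s \<in> T" "u \<in> T"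
  shows "mfrac (u \<odot>\<^bsub>M\<^esub> x) (u \<otimes> s) = mfrac x s"
  using assms one_T mult_T
  by (subst frac_eq_iff) (auto simp: smult_assoc1[symmetric] m_ac)

lemma carrier_TM: "carrier TM = {mfrac x s | x s. x \<in> carrier M \<and> s \<in> T}"
  by (auto simp: localization_module_def quotient_def module_frac_def)

lemma frac_in_carrier [simp, intro]: "x \<in> carrier M \<Longrightarrow> s \<in> T \<Longrightarrow> mfrac x s \<in> carrier TM"
  by (auto simp: carrier_TM)

lemma zero_TM: "\<zero>\<^bsub>TM\<^esub> = mfrac \<zero>\<^bsub>M\<^esub> \<one>"
  by (simp add: localization_module_def)

lemma add_frac:
  assumes "x \<in> carrier M" "y \<in> carrier M" "s \<in> T" "t \<in> T"
  shows "mfrac x s \<oplus>\<^bsub>TM\<^esub> mfrac y t = mfrac (t \<odot>\<^bsub>M\<^esub> x \<oplus>\<^bsub>M\<^esub> s \<odot>\<^bsub>M\<^esub> y) (s \<otimes> t)"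
proof -
  have "mfrac (t' \<odot>\<^bsub>M\<^esub> x' \<oplus>\<^bsub>M\<^esub> s' \<odot>\<^bsub>M\<^esub> y') (s' \<otimes> t') = mfrac (t \<odot>\<^bsub>M\<^esub> x \<oplus>\<^bsub>M\<^esub> s \<odot>\<^bsub>M\<^esub> y) (s \<otimes> t)"
    if xy: "(x', s') \<in> mfrac x s" "(y', t') \<in> mfrac y t" for x' s' y' t'
  proof -
    obtain u w where h: "x' \<in> carrier M" "y' \<in> carrier M" "s' \<in> T" "t' \<in> T" "u \<in> T" "w \<in> T"
      and u: "u \<odot>\<^bsub>M\<^esub> (s' \<odot>\<^bsub>M\<^esub> x) = u \<odot>\<^bsub>M\<^esub> (s \<odot>\<^bsub>M\<^esub> x')"
      and w: "w \<odot>\<^bsub>M\<^esub> (t' \<odot>\<^bsub>M\<^esub> y) = w \<odot>\<^bsub>M\<^esub> (t \<odot>\<^bsub>M\<^esub> y')"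
      using xy assms by (auto simp: mem_frac rel_iff)
    note h = h assms
    have 1: "(u \<otimes> w) \<odot>\<^bsub>M\<^esub> ((s \<otimes> t) \<odot>\<^bsub>M\<^esub> (t' \<odot>\<^bsub>M\<^esub> x')) = (u \<otimes> w) \<odot>\<^bsub>M\<^esub> ((s' \<otimes> t') \<odot>\<^bsub>M\<^esub> (t \<odot>\<^bsub>M\<^esub> x))"
    proof -
      have "(u \<otimes> w) \<odot>\<^bsub>M\<^esub> ((s \<otimes> t) \<odot>\<^bsub>M\<^esub> (t' \<odot>\<^bsub>M\<^esub> x')) = (w \<otimes> t \<otimes> t') \<odot>\<^bsub>M\<^esub> (u \<odot>\<^bsub>M\<^esub> (s \<odot>\<^bsub>M\<^esub> x'))"
        using h by (simp add: smult_assoc1[symmetric] m_ac)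
      also have "\<dots> = (u \<otimes> w) \<odot>\<^bsub>M\<^esub> ((s' \<otimes> t') \<odot>\<^bsub>M\<^esub> (t \<odot>\<^bsub>M\<^esub> x))"
        unfolding u[symmetric] using h by (simp add: smult_assoc1[symmetric] m_ac)
      finally show ?thesis .
    qed
    have 2: "(u \<otimes> w) \<odot>\<^bsub>M\<^esub> ((s \<otimes> t) \<odot>\<^bsub>M\<^esub> (s' \<odot>\<^bsub>M\<^esub> y')) = (u \<otimes> w) \<odot>\<^bsub>M\<^esub> ((s' \<otimes> t') \<odot>\<^bsub>M\<^esub> (s \<odot>\<^bsub>M\<^esub> y))"
    proof -
      have "(u \<otimes> w) \<odot>\<^bsub>M\<^esub> ((s \<otimes> t) \<odot>\<^bsub>M\<^esub> (s' \<odot>\<^bsub>M\<^esub> y')) = (u \<otimes> s \<otimes> s') \<odot>\<^bsub>M\<^esub> (w \<odot>\<^bsub>M\<^esub> (t \<odot>\<^bsub>M\<^esub> y'))"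
        using h by (simp add: smult_assoc1[symmetric] m_ac)
      also have "\<dots> = (u \<otimes> w) \<odot>\<^bsub>M\<^esub> ((s' \<otimes> t') \<odot>\<^bsub>M\<^esub> (s \<odot>\<^bsub>M\<^esub> y))"
        unfolding w[symmetric] using h by (simp add: smult_assoc1[symmetric] m_ac)
      finally show ?thesis .
    qed
    show ?thesis
      using h mult_T 1 2
      by (subst frac_eq_iff) (auto simp: smult_r_distr intro!: bexI[of _ "u \<otimes> w"])
  qed
  then show ?thesis
    unfolding localization_module_def ring_record_simps
    by (intro UN_UN_pair_const[OF frac_self[OF assms(1,3)] frac_self[OF assms(2,4)]]) auto
qed

lemma ring_frac_self: "a \<in> carrier R \<Longrightarrow> s \<in> T \<Longrightarrow> (a, s) \<in> ring_frac R T a s"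
  using one_T by (auto simp: ring_frac_def loc_ring_rel_def)

lemma smult_frac:
  assumes "a \<in> carrier R" "x \<in> carrier M" "s \<in> T" "t \<in> T"
  shows "ring_frac R T a s \<odot>\<^bsub>TM\<^esub> mfrac x t = mfrac (a \<odot>\<^bsub>M\<^esub> x) (s \<otimes> t)"
proof -
  have "mfrac (a' \<odot>\<^bsub>M\<^esub> x') (s' \<otimes> t') = mfrac (a \<odot>\<^bsub>M\<^esub> x) (s \<otimes> t)"
    if xy: "(a', s') \<in> ring_frac R T a s" "(x', t') \<in> mfrac x t" for a' s' x' t'
  proof -
    obtain u w where h: "a' \<in> carrier R" "x' \<in> carrier M" "s' \<in> T" "t' \<in> T" "u \<in> T" "w \<in> T"
      and u: "u \<otimes> (s' \<otimes> a) = u \<otimes> (s \<otimes> a')"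
      and w: "w \<odot>\<^bsub>M\<^esub> (t' \<odot>\<^bsub>M\<^esub> x) = w \<odot>\<^bsub>M\<^esub> (t \<odot>\<^bsub>M\<^esub> x')"
      using xy assms by (auto simp: mem_frac rel_iff ring_frac_def loc_ring_rel_def)
    note h = h assms
    have "(u \<otimes> w) \<odot>\<^bsub>M\<^esub> ((s \<otimes> t) \<odot>\<^bsub>M\<^esub> (a' \<odot>\<^bsub>M\<^esub> x')) = (u \<otimes> (s \<otimes> a')) \<odot>\<^bsub>M\<^esub> (w \<odot>\<^bsub>M\<^esub> (t \<odot>\<^bsub>M\<^esub> x'))"
      using h by (simp add: smult_assoc1[symmetric] m_ac)
    also have "\<dots> = (u \<otimes> w) \<odot>\<^bsub>M\<^esub> ((s' \<otimes> t') \<odot>\<^bsub>M\<^esub> (a \<odot>\<^bsub>M\<^esub> x))"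
      unfolding u[symmetric] w[symmetric] using h by (simp add: smult_assoc1[symmetric] m_ac)
    finally show ?thesis
      using h mult_T by (subst frac_eq_iff) (auto intro!: bexI[of _ "u \<otimes> w"])
  qed
  then show ?thesis
    unfolding localization_module_def module.simps
    by (intro UN_UN_pair_const[OF ring_frac_self[OF assms(1,3)] frac_self[OF assms(2,4)]]) auto
qed

lemma abelian_group_TM: "abelian_group TM"
proof (rule abelian_groupI)
  fix U assume "U \<in> carrier TM"
  then obtain x s where x: "U = mfrac x s" "x \<in> carrier M" "s \<in> T" by (auto simp: carrier_TM)
  then show "\<zero>\<^bsub>TM\<^esub> \<oplus>\<^bsub>TM\<^esub> U = U" using one_T by (simp add: zero_TM add_frac)
  have "mfrac (\<ominus>\<^bsub>M\<^esub> x) s \<oplus>\<^bsub>TM\<^esub> U = \<zero>\<^bsub>TM\<^esub>"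
    using x one_T mult_T by (auto simp: zero_TM add_frac smult_r_minus M.l_neg frac_eq_iff)
  then show "\<exists>V\<in>carrier TM. V \<oplus>\<^bsub>TM\<^esub> U = \<zero>\<^bsub>TM\<^esub>" using x by blast
next
  fix U V assume "U \<in> carrier TM" "V \<in> carrier TM"
  then obtain x s y t where x: "U = mfrac x s" "x \<in> carrier M" "s \<in> T"
     "V = mfrac y t" "y \<in> carrier M" "t \<in> T" by (auto simp: carrier_TM)
  then show "U \<oplus>\<^bsub>TM\<^esub> V \<in> carrier TM" using mult_T by (simp add: add_frac frac_in_carrier)
  show "U \<oplus>\<^bsub>TM\<^esub> V = V \<oplus>\<^bsub>TM\<^esub> U" using x by (simp add: add_frac M.a_comm R.m_comm)
  fix W assume "W \<in> carrier TM"
  then obtain z r where z: "W = mfrac z r" "z \<in> carrier M" "r \<in> T" by (auto simp: carrier_TM)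
  show "U \<oplus>\<^bsub>TM\<^esub> V \<oplus>\<^bsub>TM\<^esub> W = U \<oplus>\<^bsub>TM\<^esub> (V \<oplus>\<^bsub>TM\<^esub> W)"
    using x z mult_T
    by (simp add: add_frac smult_r_distr smult_assoc1[symmetric] M.a_assoc R.m_ac)
qed (use one_T in \<open>simp add: zero_TM frac_in_carrier\<close>)

end

text \<open>
  A localized ring is the localization of the ring as a module over itself, with scalar
  multiplication for multiplication. The facts about fractions in modules thus give those for rings.
\<close>

definition ring_as_module :: "('a, 'r) ring_scheme \<Rightarrow> ('a, 'a) module" where
  "ring_as_module R = \<lparr>carrier = carrier R, monoid.mult = monoid.mult R, one = one R,
     zero = zero R, add = add R, smult = monoid.mult R\<rparr>"

lemma (in cring) ring_as_module: "module R (ring_as_module R)"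
  by (intro module.intro is_cring module_axioms.intro abelian_groupI)
    (auto simp: ring_as_module_def l_distr r_distr m_assoc a_ac intro: exI[of _ "\<ominus> _"] l_neg)

context localization
begin

abbreviation "TR \<equiv> localization_ring R T"
abbreviation "rfrac a s \<equiv> ring_frac R T a s"

lemma localization_ring_as_module: "localization R (ring_as_module R) T"
  using R.ring_as_module T_subset one_T mult_T
  by (intro localization.intro localization_axioms.intro)

lemma ring_frac_eq: "rfrac a s = module_frac R (ring_as_module R) T a s"
  by (simp add: ring_frac_def module_frac_def loc_ring_rel_def loc_module_rel_def ring_as_module_def)

lemma localization_ring_eq:
  "carrier TR = carrier (localization_module R (ring_as_module R) T)"
  "add TR = add (localization_module R (ring_as_module R) T)"
  "zero TR = zero (localization_module R (ring_as_module R) T)"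
  "monoid.mult TR = smult (localization_module R (ring_as_module R) T)"
  by (simp_all add: localization_ring_def localization_module_def ring_frac_eq)
    (simp_all add: loc_ring_rel_def loc_module_rel_def ring_as_module_def ring_frac_eq)

lemma carrier_TR: "carrier TR = {rfrac a s | a s. a \<in> carrier R \<and> s \<in> T}"
  using localization.carrier_TM[OF localization_ring_as_module]
  by (simp add: localization_ring_eq ring_frac_eq) (simp add: ring_as_module_def)

lemma rfrac_in_carrier [simp, intro]: "a \<in> carrier R \<Longrightarrow> s \<in> T \<Longrightarrow> rfrac a s \<in> carrier TR"
  by (auto simp: carrier_TR)

lemma rfrac_eq_iff:
  assumes "a \<in> carrier R" "b \<in> carrier R" "s \<in> T" "t \<in> T"
  shows "rfrac a s = rfrac b t \<longleftrightarrow> (\<exists>u\<in>T. u \<otimes> (t \<otimes> a) = u \<otimes> (s \<otimes> b))"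
  using localization.frac_eq_iff[OF localization_ring_as_module, of a b s t] assms
  by (simp add: ring_frac_eq) (simp add: ring_as_module_def)

lemma add_rfrac:
  assumes "a \<in> carrier R" "b \<in> carrier R" "s \<in> T" "t \<in> T"
  shows "rfrac a s \<oplus>\<^bsub>TR\<^esub> rfrac b t = rfrac (t \<otimes> a \<oplus> s \<otimes> b) (s \<otimes> t)"
  using localization.add_frac[OF localization_ring_as_module, of a b s t] assms
  by (simp add: ring_frac_eq localization_ring_eq) (simp add: ring_as_module_def)

lemma mult_rfrac:
  assumes "a \<in> carrier R" "b \<in> carrier R" "s \<in> T" "t \<in> T"
  shows "rfrac a s \<otimes>\<^bsub>TR\<^esub> rfrac b t = rfrac (a \<otimes> b) (s \<otimes> t)"
  using localization.smult_frac[OF localization_ring_as_module, of a b s t] assms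
  by (simp add: ring_frac_eq localization_ring_eq) (simp add: ring_as_module_def)

lemma one_TR: "\<one>\<^bsub>TR\<^esub> = rfrac \<one> \<one>" and zero_TR: "\<zero>\<^bsub>TR\<^esub> = rfrac \<zero> \<one>"
  by (simp_all add: localization_ring_def)

lemma abelian_group_TR: "abelian_group TR"
proof -
  interpret L: abelian_group "localization_module R (ring_as_module R) T"
    by (rule localization.abelian_group_TM[OF localization_ring_as_module])
  show ?thesis
    by (rule abelian_groupI)
      (auto simp: localization_ring_eq L.a_ac
        intro!: bexI[of _ "\<ominus>\<^bsub>localization_module R (ring_as_module R) T\<^esub> _"] L.l_neg)
qed

lemma frac_distrib:
  assumes "a \<in> carrier R" "x \<in> carrier M" "y \<in> carrier M" "s \<in> T" "t \<in> T" "r \<in> T"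
  shows "rfrac a s \<odot>\<^bsub>TM\<^esub> (mfrac x t \<oplus>\<^bsub>TM\<^esub> mfrac y r) =
    rfrac a s \<odot>\<^bsub>TM\<^esub> mfrac x t \<oplus>\<^bsub>TM\<^esub> rfrac a s \<odot>\<^bsub>TM\<^esub> mfrac y r"
  using assms mult_T one_T
  by (auto simp: smult_frac add_frac frac_eq_iff smult_r_distr smult_assoc1[symmetric] R.m_ac)

lemma frac_l_distrib:
  assumes "a \<in> carrier R" "b \<in> carrier R" "x \<in> carrier M" "s \<in> T" "t \<in> T" "r \<in> T"
  shows "(rfrac a s \<oplus>\<^bsub>TR\<^esub> rfrac b t) \<odot>\<^bsub>TM\<^esub> mfrac x r =
    rfrac a s \<odot>\<^bsub>TM\<^esub> mfrac x r \<oplus>\<^bsub>TM\<^esub> rfrac b t \<odot>\<^bsub>TM\<^esub> mfrac x r"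
  using assms mult_T one_T
  by (auto simp: smult_frac add_frac add_rfrac frac_eq_iff smult_l_distr smult_r_distr
      smult_assoc1[symmetric] R.m_ac)

lemma cring_TR: "cring TR"
proof (rule cringI)
  show "abelian_group TR" by (rule abelian_group_TR)
  show "comm_monoid TR"
  proof (rule comm_monoidI)
    fix A B assume "A \<in> carrier TR" "B \<in> carrier TR"
    then obtain a s b t where h: "A = rfrac a s" "B = rfrac b t"
      "a \<in> carrier R" "b \<in> carrier R" "s \<in> T" "t \<in> T"
      by (auto simp: carrier_TR)
    then show "A \<otimes>\<^bsub>TR\<^esub> B \<in> carrier TR" "A \<otimes>\<^bsub>TR\<^esub> B = B \<otimes>\<^bsub>TR\<^esub> A" "\<one>\<^bsub>TR\<^esub> \<otimes>\<^bsub>TR\<^esub> A = A"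
      using one_T mult_T by (simp_all add: mult_rfrac one_TR R.m_comm)
    fix C assume "C \<in> carrier TR"
    then obtain c r where "C = rfrac c r" "c \<in> carrier R" "r \<in> T" by (auto simp: carrier_TR)
    with h show "A \<otimes>\<^bsub>TR\<^esub> B \<otimes>\<^bsub>TR\<^esub> C = A \<otimes>\<^bsub>TR\<^esub> (B \<otimes>\<^bsub>TR\<^esub> C)"
      using mult_T by (simp add: mult_rfrac R.m_assoc)
  qed (use one_T in \<open>simp add: one_TR\<close>)
  fix A B C assume "A \<in> carrier TR" "B \<in> carrier TR" "C \<in> carrier TR"
  then obtain a s b t c r where h: "A = rfrac a s" "B = rfrac b t" "C = rfrac c r"
    "a \<in> carrier R" "b \<in> carrier R" "c \<in> carrier R" "s \<in> T" "t \<in> T" "r \<in> T"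
    by (auto simp: carrier_TR)
  show "(A \<oplus>\<^bsub>TR\<^esub> B) \<otimes>\<^bsub>TR\<^esub> C = A \<otimes>\<^bsub>TR\<^esub> C \<oplus>\<^bsub>TR\<^esub> B \<otimes>\<^bsub>TR\<^esub> C"
    using localization.frac_l_distrib[OF localization_ring_as_module, of a b c s t r] h
    by (simp add: localization_ring_eq ring_frac_eq) (simp add: ring_as_module_def)
qed

lemma module_TM: "module TR TM"
proof (rule moduleI)
  show "cring TR" "abelian_group TM" by (rule cring_TR abelian_group_TM)+
next
  fix A U assume "A \<in> carrier TR" "U \<in> carrier TM"
  then obtain a s x r where h: "A = rfrac a s" "U = mfrac x r"
    "a \<in> carrier R" "x \<in> carrier M" "s \<in> T" "r \<in> T"
    by (auto simp: carrier_TR carrier_TM)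
  then show "A \<odot>\<^bsub>TM\<^esub> U \<in> carrier TM" using mult_T by (simp add: smult_frac)
  { fix B assume "B \<in> carrier TR"
    then obtain b t where "B = rfrac b t" "b \<in> carrier R" "t \<in> T" by (auto simp: carrier_TR)
    with h show "(A \<oplus>\<^bsub>TR\<^esub> B) \<odot>\<^bsub>TM\<^esub> U = A \<odot>\<^bsub>TM\<^esub> U \<oplus>\<^bsub>TM\<^esub> B \<odot>\<^bsub>TM\<^esub> U"
      "A \<otimes>\<^bsub>TR\<^esub> B \<odot>\<^bsub>TM\<^esub> U = A \<odot>\<^bsub>TM\<^esub> (B \<odot>\<^bsub>TM\<^esub> U)"
      using mult_T by (auto simp: frac_l_distrib mult_rfrac smult_frac smult_assoc1 R.m_assoc) }
  { fix V assume "V \<in> carrier TM"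
    then obtain y t where "V = mfrac y t" "y \<in> carrier M" "t \<in> T" by (auto simp: carrier_TM)
    with h show "A \<odot>\<^bsub>TM\<^esub> (U \<oplus>\<^bsub>TM\<^esub> V) = A \<odot>\<^bsub>TM\<^esub> U \<oplus>\<^bsub>TM\<^esub> A \<odot>\<^bsub>TM\<^esub> V"
      by (simp add: frac_distrib) }
next
  fix U assume "U \<in> carrier TM"
  then show "\<one>\<^bsub>TR\<^esub> \<odot>\<^bsub>TM\<^esub> U = U" using one_T by (auto simp: carrier_TM one_TR smult_frac)
qed

end

section \<open>Transfer of the Baire property\<close>

text \<open>
  The coarsest topology on \<open>A\<close> that makes all maps \<open>p i\<close> continuous.
\<close>

definition initial_topology ::
    "'a set \<Rightarrow> ('i \<Rightarrow> 'a \<Rightarrow> 'x) \<Rightarrow> ('i \<Rightarrow> 'x topology) \<Rightarrow> 'i set \<Rightarrow> 'a topology" where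
  "initial_topology A p \<T> I =
     pullback_topology A (\<lambda>x. \<lambda>i\<in>I. p i x) (product_topology \<T> I)"

locale initial_topology_maps =
  fixes A :: "'a set" and p :: "'i \<Rightarrow> 'a \<Rightarrow> 'x" and \<T> :: "'i \<Rightarrow> 'x topology" and I :: "'i set"
  assumes p_topspace: "\<And>i x. i \<in> I \<Longrightarrow> x \<in> A \<Longrightarrow> p i x \<in> topspace (\<T> i)"
begin

abbreviation "S \<equiv> initial_topology A p \<T> I"

lemma topspace_S: "topspace S = A"
  unfolding initial_topology_def topspace_pullback_topology using p_topspace by auto

lemma openin_coordinate:
  assumes "i \<in> I" "openin (\<T> i) V"
  shows "openin S {x \<in> A. p i x \<in> V}"
proof -
  have "openin (product_topology \<T> I) {f \<in> topspace (product_topology \<T> I). f i \<in> V}"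
    by (rule openin_continuous_map_preimage[OF _ assms(2)])
      (rule continuous_map_product_projection[OF assms(1)])
  moreover have "{x \<in> A. p i x \<in> V} =
      (\<lambda>x. \<lambda>i\<in>I. p i x) -` {f \<in> topspace (product_topology \<T> I). f i \<in> V} \<inter> A"
    using assms(1) p_topspace by auto
  ultimately show ?thesis unfolding initial_topology_def openin_pullback_topology by blast
qed

lemma openin_box:
  assumes "finite F" "F \<subseteq> I" "\<And>i. i \<in> F \<Longrightarrow> openin (\<T> i) (V i)"
  shows "openin S {x \<in> A. \<forall>i\<in>F. p i x \<in> V i}"
proof -
  have "openin S (topspace S \<inter> (\<Inter>i\<in>F. {x \<in> A. p i x \<in> V i}))"
    using assms openin_coordinate by (subst Int_commute, intro openin_INT) auto
  moreover have "topspace S \<inter> (\<Inter>i\<in>F. {x \<in> A. p i x \<in> V i}) = {x \<in> A. \<forall>i\<in>F. p i x \<in> V i}"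
    by (auto simp: topspace_S)
  ultimately show ?thesis by simp
qed

text \<open>
  Only finitely many of the open sets \<open>V i\<close> in a basic open set of the product differ from the whole
  space; these give \<open>F\<close>.
\<close>

lemma openin_box_nhd:
  assumes W: "openin S W" and x: "x \<in> W"
  obtains F V where "finite F" "F \<subseteq> I" "\<And>i. i \<in> F \<Longrightarrow> openin (\<T> i) (V i)"
    "\<And>i. i \<in> F \<Longrightarrow> p i x \<in> V i" "{z \<in> A. \<forall>i\<in>F. p i z \<in> V i} \<subseteq> W"
proof -
  obtain G where G: "openin (product_topology \<T> I) G" "W = (\<lambda>x. \<lambda>i\<in>I. p i x) -` G \<inter> A"
    using W unfolding initial_topology_def openin_pullback_topology by blast
  have "(\<lambda>i\<in>I. p i x) \<in> G" using G(2) x by blast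
  then obtain V where V: "finite {i \<in> I. V i \<noteq> topspace (\<T> i)}" "\<And>i. i \<in> I \<Longrightarrow> openin (\<T> i) (V i)"
    "(\<lambda>i\<in>I. p i x) \<in> PiE I V" "PiE I V \<subseteq> G"
    using G(1)[unfolded openin_product_topology_alt, rule_format, of "\<lambda>i\<in>I. p i x"] by auto
  show thesis
  proof (rule that[of "{i \<in> I. V i \<noteq> topspace (\<T> i)}" V])
    show "p i x \<in> V i" if "i \<in> {i \<in> I. V i \<noteq> topspace (\<T> i)}" for i
      using PiE_mem[OF V(3), of i] that by simp
    show "{z \<in> A. \<forall>i\<in>{i \<in> I. V i \<noteq> topspace (\<T> i)}. p i z \<in> V i} \<subseteq> W"
    proof
      fix z assume z: "z \<in> {z \<in> A. \<forall>i\<in>{i \<in> I. V i \<noteq> topspace (\<T> i)}. p i z \<in> V i}"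
      then have "(\<lambda>i\<in>I. p i z) \<in> PiE I V"
        using p_topspace by auto
      then show "z \<in> W" using V(4) G(2) z by blast
    qed
  qed (use V in auto)
qed

lemma openin_saturated:
  assumes "openin S W" "x \<in> W" "y \<in> A" "\<And>i. i \<in> I \<Longrightarrow> p i y = p i x"
  shows "y \<in> W"
proof -
  obtain F V where F: "finite F" "F \<subseteq> I" "\<And>i. i \<in> F \<Longrightarrow> openin (\<T> i) (V i)"
    "\<And>i. i \<in> F \<Longrightarrow> p i x \<in> V i" "{z \<in> A. \<forall>i\<in>F. p i z \<in> V i} \<subseteq> W"
    by (rule openin_box_nhd[OF assms(1,2)], rule that)
  have "p i y \<in> V i" if "i \<in> F" for i using assms(4)[of i] F(2) F(4)[OF that] that by auto
  then show ?thesis using assms(3) F(5) by blast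
qed

end

text \<open>
  This abstracts what relates \<open>M\<close> to its localization: \<open>A\<close> and \<open>B\<close> carry the topologies induced by
  coordinates \<open>p i\<close> and \<open>q j\<close>; the coordinate \<open>j\<close> of \<open>\<phi> x\<close> is the coordinate \<open>\<theta> j\<close> of \<open>x\<close> up to a
  homeomorphism; and \<open>\<phi>\<close> is onto as far as the topology of \<open>B\<close> can tell. The indices outside
  \<open>\<theta> ` J\<close> make the topology of \<open>A\<close> finer than the one that \<open>\<phi>\<close> induces, which is what the
  assumption \<open>approximation\<close> compensates.
\<close>

locale initial_topology_comparison =
  src: initial_topology_maps A p \<T> I + tgt: initial_topology_maps B q \<U> J
  for A :: "'a set" and p :: "'i \<Rightarrow> 'a \<Rightarrow> 'x" and \<T> I
    and B :: "'b set" and q :: "'j \<Rightarrow> 'b \<Rightarrow> 'y" and \<U> J +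
  fixes \<phi> :: "'a \<Rightarrow> 'b" and \<theta> :: "'j \<Rightarrow> 'i" and h :: "'j \<Rightarrow> 'x \<Rightarrow> 'y"
  assumes \<phi>_closed: "\<And>x. x \<in> A \<Longrightarrow> \<phi> x \<in> B"
    and \<phi>_onto: "\<And>y. y \<in> B \<Longrightarrow> \<exists>x\<in>A. \<forall>j\<in>J. q j (\<phi> x) = q j y"
    and \<theta>_closed: "\<And>j. j \<in> J \<Longrightarrow> \<theta> j \<in> I"
    and h_homeo: "\<And>j. j \<in> J \<Longrightarrow> homeomorphic_map (\<T> (\<theta> j)) (\<U> j) (h j)"
    and q_\<phi>: "\<And>j x. j \<in> J \<Longrightarrow> x \<in> A \<Longrightarrow> q j (\<phi> x) = h j (p (\<theta> j) x)"
    and approximation: "\<And>P Q x y. finite P \<Longrightarrow> finite Q \<Longrightarrow> P \<subseteq> I \<Longrightarrow> Q \<subseteq> I \<Longrightarrow> P \<inter> Q = {} \<Longrightarrow>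
      x \<in> A \<Longrightarrow> y \<in> A \<Longrightarrow> \<exists>z\<in>A. (\<forall>i\<in>P. p i z = p i x) \<and> (\<forall>i\<in>Q. p i z = p i y)"
begin

lemma openin_vimage:
  assumes W: "openin tgt.S W"
  shows "openin src.S {x \<in> A. \<phi> x \<in> W}"
proof (subst openin_subopen, intro ballI)
  fix x assume x: "x \<in> {x \<in> A. \<phi> x \<in> W}"
  then have \<phi>x: "\<phi> x \<in> W" by simp
  obtain F V where F: "finite F" "F \<subseteq> J" "\<And>j. j \<in> F \<Longrightarrow> openin (\<U> j) (V j)"
    "\<And>j. j \<in> F \<Longrightarrow> q j (\<phi> x) \<in> V j" "{z \<in> B. \<forall>j\<in>F. q j z \<in> V j} \<subseteq> W"
    by (rule tgt.openin_box_nhd[OF W \<phi>x], rule that)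
  have "openin src.S {z \<in> A. q j (\<phi> z) \<in> V j}" if j: "j \<in> F" for j
  proof -
    have jJ: "j \<in> J" using j F(2) by blast
    have "openin (\<T> (\<theta> j)) {v \<in> topspace (\<T> (\<theta> j)). h j v \<in> V j}"
      by (rule openin_continuous_map_preimage[OF
            homeomorphic_imp_continuous_map[OF h_homeo[OF jJ]] F(3)[OF j]])
    from src.openin_coordinate[OF \<theta>_closed[OF jJ] this]
    have "openin src.S {z \<in> A. p (\<theta> j) z \<in> {v \<in> topspace (\<T> (\<theta> j)). h j v \<in> V j}}" .
    moreover have "{z \<in> A. p (\<theta> j) z \<in> {v \<in> topspace (\<T> (\<theta> j)). h j v \<in> V j}} =
        {z \<in> A. q j (\<phi> z) \<in> V j}"
      using q_\<phi>[OF jJ] src.p_topspace[OF \<theta>_closed[OF jJ]] by auto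
    ultimately show ?thesis by simp
  qed
  then have "openin src.S (topspace src.S \<inter> (\<Inter>j\<in>F. {z \<in> A. q j (\<phi> z) \<in> V j}))"
    using F(1) by (subst Int_commute, intro openin_INT) auto
  moreover have "x \<in> topspace src.S \<inter> (\<Inter>j\<in>F. {z \<in> A. q j (\<phi> z) \<in> V j})"
    using x F(4) by (auto simp: src.topspace_S)
  moreover have "topspace src.S \<inter> (\<Inter>j\<in>F. {z \<in> A. q j (\<phi> z) \<in> V j}) \<subseteq> {x \<in> A. \<phi> x \<in> W}"
  proof
    fix z assume z: "z \<in> topspace src.S \<inter> (\<Inter>j\<in>F. {z \<in> A. q j (\<phi> z) \<in> V j})"
    then have zA: "z \<in> A" by (simp add: src.topspace_S)
    then have "\<phi> z \<in> {z \<in> B. \<forall>j\<in>F. q j z \<in> V j}" using z \<phi>_closed by auto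
    then show "z \<in> {x \<in> A. \<phi> x \<in> W}" using F(5) zA by blast
  qed
  ultimately show "\<exists>T. openin src.S T \<and> x \<in> T \<and> T \<subseteq> {x \<in> A. \<phi> x \<in> W}" by blast
qed

lemma nonempty_vimage:
  assumes "openin tgt.S W" "W \<noteq> {}"
  shows "\<exists>x\<in>A. \<phi> x \<in> W"
proof -
  obtain y where y: "y \<in> W" using assms(2) by blast
  then have "y \<in> B" using openin_subset[OF assms(1)] by (auto simp: tgt.topspace_S)
  then obtain x where "x \<in> A" "\<forall>j\<in>J. q j (\<phi> x) = q j y" using \<phi>_onto by blast
  then show ?thesis using tgt.openin_saturated[OF assms(1) y] \<phi>_closed by blast
qed

text \<open>
  A basic open set \<open>U\<close> of \<open>A\<close> imposes conditions at finitely many indices. Those at indices in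
  \<open>\<theta> ` J\<close> define a nonempty open set of \<open>B\<close>, which meets \<open>W\<close> in some \<open>\<phi> x\<close>. Membership of \<open>\<phi> x\<close> in
  \<open>W\<close> again depends on finitely many indices of \<open>\<theta> ` J\<close>, so \<open>x\<close> can be changed at the remaining
  indices to satisfy the other conditions of \<open>U\<close> as well.
\<close>

lemma dense_vimage:
  assumes W: "openin tgt.S W" "tgt.S closure_of W = topspace tgt.S"
  shows "src.S closure_of {x \<in> A. \<phi> x \<in> W} = topspace src.S"
  unfolding dense_intersects_open
proof (intro allI impI)
  fix U assume U: "openin src.S U \<and> U \<noteq> {}"
  then obtain y where y: "y \<in> U" by blast
  then have yA: "y \<in> A" using U openin_subset[of src.S U] by (auto simp: src.topspace_S)
  obtain F V where F: "finite F" "F \<subseteq> I" "\<And>i. i \<in> F \<Longrightarrow> openin (\<T> i) (V i)"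
    "\<And>i. i \<in> F \<Longrightarrow> p i y \<in> V i" "{z \<in> A. \<forall>i\<in>F. p i z \<in> V i} \<subseteq> U"
    by (rule src.openin_box_nhd[OF conjunct1[OF U] y], rule that)
  \<comment> \<open>\<open>P\<close> and \<open>Q\<close>: the conditions that are visible in \<open>B\<close> and those that are not\<close>
  define P where "P = F \<inter> \<theta> ` J"
  define Q where "Q = F - \<theta> ` J"
  define c where "c = inv_into J \<theta>"
  have c: "c i \<in> J" "\<theta> (c i) = i" if "i \<in> P" for i
    using that by (auto simp: P_def c_def inv_into_into f_inv_into_f)
  have V_sub: "V i \<subseteq> topspace (\<T> i)" if "i \<in> F" for i
    using openin_subset[OF F(3)[OF that]] .
  define U' where "U' = {b \<in> B. \<forall>j\<in>c ` P. q j b \<in> h j ` V (\<theta> j)}"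
  have "openin tgt.S U'"
    unfolding U'_def
  proof (rule tgt.openin_box)
    show "finite (c ` P)" "c ` P \<subseteq> J" using F(1) c by (auto simp: P_def)
    fix j assume "j \<in> c ` P"
    then obtain i where i: "i \<in> P" "j = c i" by blast
    then have "openin (\<T> (\<theta> j)) (V (\<theta> j))" using c F(3) by (auto simp: P_def)
    then show "openin (\<U> j) (h j ` V (\<theta> j))"
      using homeomorphic_imp_open_map[OF h_homeo] c(1)[OF i(1)] i(2) unfolding open_map_def by blast
  qed
  moreover have "\<phi> y \<in> U'"
    unfolding U'_def using \<phi>_closed yA q_\<phi> c F(4) by (auto simp: P_def)
  ultimately have "openin tgt.S (W \<inter> U')" "W \<inter> U' \<noteq> {}"
    using W unfolding dense_intersects_open by (auto intro: openin_Int)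
  then obtain x where x: "x \<in> A" "\<phi> x \<in> W" "\<phi> x \<in> U'" using nonempty_vimage by blast
  obtain G E where G: "finite G" "G \<subseteq> J" "\<And>j. j \<in> G \<Longrightarrow> openin (\<U> j) (E j)"
    "\<And>j. j \<in> G \<Longrightarrow> q j (\<phi> x) \<in> E j" "{z \<in> B. \<forall>j\<in>G. q j z \<in> E j} \<subseteq> W"
    by (rule tgt.openin_box_nhd[OF W(1) x(2)], rule that)
  have "\<exists>z\<in>A. (\<forall>i\<in>\<theta> ` G \<union> P. p i z = p i x) \<and> (\<forall>i\<in>Q. p i z = p i y)"
    using F(1,2) G(1,2) \<theta>_closed x(1) yA
    by (intro approximation) (auto simp: P_def Q_def)
  then obtain z where z: "z \<in> A" "\<And>i. i \<in> \<theta> ` G \<union> P \<Longrightarrow> p i z = p i x" "\<And>i. i \<in> Q \<Longrightarrow> p i z = p i y"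
    by blast
  have "q j (\<phi> z) \<in> E j" if "j \<in> G" for j
  proof -
    have "j \<in> J" using that G(2) by blast
    then have "q j (\<phi> z) = q j (\<phi> x)" using z that x(1) by (simp add: q_\<phi>)
    then show ?thesis using G(4)[OF that] by simp
  qed
  then have "\<phi> z \<in> W" using G(5) \<phi>_closed[OF z(1)] by blast
  moreover have "p i z \<in> V i" if i: "i \<in> F" for i
  proof (cases "i \<in> P")
    case True
    have "q (c i) (\<phi> x) \<in> h (c i) ` V i" using x(3) True c by (auto simp: U'_def)
    then have "h (c i) (p i x) \<in> h (c i) ` V i" using q_\<phi>[OF c(1)[OF True] x(1)] c(2)[OF True] by simp
    moreover have "inj_on (h (c i)) (topspace (\<T> i))"
      using homeomorphic_imp_injective_map[OF h_homeo[OF c(1)[OF True]]] c(2)[OF True] by simp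
    moreover have "p i x \<in> topspace (\<T> i)" using src.p_topspace x(1) i F(2) by blast
    ultimately have "p i x \<in> V i" using V_sub[OF i] by (auto simp: inj_on_def)
    then show ?thesis using z(2) True by simp
  next
    case False
    then have "i \<in> Q" using i by (auto simp: P_def Q_def)
    then show ?thesis using z(3) F(4)[OF i] by simp
  qed
  then have "z \<in> U" using F(5) z(1) by blast
  ultimately show "{x \<in> A. \<phi> x \<in> W} \<inter> U \<noteq> {}" using z(1) by blast
qed

text \<open>
  The preimages of a family of dense open sets form a family of at most the same cardinality.
\<close>

lemma kappa_Baire_transfer:
  assumes "kappa_Baire_space \<kappa> src.S"
  shows "kappa_Baire_space \<kappa> tgt.S"
  unfolding kappa_Baire_space_def
proof (intro allI impI, elim conjE)
  fix \<O> assume card: "(card_of \<O>, \<kappa>) \<in> ordLess"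
    and \<O>: "\<forall>W\<in>\<O>. openin tgt.S W \<and> tgt.S closure_of W = topspace tgt.S"
  define \<O>' where "\<O>' = (\<lambda>W. {x \<in> A. \<phi> x \<in> W}) ` \<O>"
  have "(card_of \<O>', \<kappa>) \<in> ordLess"
    unfolding \<O>'_def using card_of_image card by (rule ordLeq_ordLess_trans)
  moreover have "\<forall>U\<in>\<O>'. openin src.S U \<and> src.S closure_of U = topspace src.S"
    using \<O> openin_vimage dense_vimage by (auto simp: \<O>'_def)
  ultimately have dense: "src.S closure_of (topspace src.S \<inter> \<Inter>\<O>') = topspace src.S"
    using assms unfolding kappa_Baire_space_def by blast
  show "tgt.S closure_of (topspace tgt.S \<inter> \<Inter>\<O>) = topspace tgt.S"
    unfolding dense_intersects_open
  proof (intro allI impI)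
    fix V assume V: "openin tgt.S V \<and> V \<noteq> {}"
    then have "openin src.S {x \<in> A. \<phi> x \<in> V} \<and> {x \<in> A. \<phi> x \<in> V} \<noteq> {}"
      using openin_vimage nonempty_vimage by blast
    then have "(topspace src.S \<inter> \<Inter>\<O>') \<inter> {x \<in> A. \<phi> x \<in> V} \<noteq> {}"
      using dense unfolding dense_intersects_open by blast
    then obtain x where x: "x \<in> A" "\<phi> x \<in> V" "x \<in> \<Inter>\<O>'" by blast
    then have "\<phi> x \<in> \<Inter>\<O>" by (auto simp: \<O>'_def)
    then show "topspace tgt.S \<inter> \<Inter>\<O> \<inter> V \<noteq> {}"
      using x(1,2) \<phi>_closed unfolding tgt.topspace_S by blast
  qed
qed

end

section \<open>Maximal ideals of the localization\<close>

context localization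
begin

sublocale L: module TR TM by (rule module_TM)

lemma add_rfrac_same:
  assumes "a \<in> carrier R" "b \<in> carrier R" "s \<in> T"
  shows "rfrac a s \<oplus>\<^bsub>TR\<^esub> rfrac b s = rfrac (a \<oplus> b) s"
proof -
  have "rfrac (s \<otimes> a \<oplus> s \<otimes> b) (s \<otimes> s) = rfrac (a \<oplus> b) s"
    using assms one_T mult_T
    by (subst rfrac_eq_iff) (auto simp: R.r_distr R.m_ac intro!: bexI[of _ "\<one>"])
  then show ?thesis using assms by (simp add: add_rfrac)
qed

lemma minus_rfrac_same:
  assumes "a \<in> carrier R" "b \<in> carrier R" "s \<in> T"
  shows "rfrac a s \<ominus>\<^bsub>TR\<^esub> rfrac b s = rfrac (a \<ominus> b) s"
proof -
  have "rfrac (a \<ominus> b) s \<oplus>\<^bsub>TR\<^esub> rfrac b s = rfrac a s"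
    using assms by (simp add: add_rfrac_same R.minus_eq R.a_assoc R.l_neg)
  then have "rfrac a s \<ominus>\<^bsub>TR\<^esub> rfrac b s =
      (rfrac (a \<ominus> b) s \<oplus>\<^bsub>TR\<^esub> rfrac b s) \<ominus>\<^bsub>TR\<^esub> rfrac b s" by simp
  also have "\<dots> = rfrac (a \<ominus> b) s"
    using assms by (simp add: L.R.minus_eq L.R.a_assoc L.R.r_neg)
  finally show ?thesis .
qed

lemma add_frac_same:
  assumes "x \<in> carrier M" "y \<in> carrier M" "s \<in> T"
  shows "mfrac x s \<oplus>\<^bsub>TM\<^esub> mfrac y s = mfrac (x \<oplus>\<^bsub>M\<^esub> y) s"
  using assms frac_cancel[of "x \<oplus>\<^bsub>M\<^esub> y" s s] by (simp add: add_frac smult_r_distr)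

lemma minus_frac_same:
  assumes "x \<in> carrier M" "y \<in> carrier M" "s \<in> T"
  shows "mfrac x s \<ominus>\<^bsub>TM\<^esub> mfrac y s = mfrac (x \<ominus>\<^bsub>M\<^esub> y) s"
proof -
  have "mfrac (x \<ominus>\<^bsub>M\<^esub> y) s \<oplus>\<^bsub>TM\<^esub> mfrac y s = mfrac x s"
    using assms by (simp add: add_frac_same M.minus_eq M.a_assoc M.l_neg)
  then have "mfrac x s \<ominus>\<^bsub>TM\<^esub> mfrac y s =
      (mfrac (x \<ominus>\<^bsub>M\<^esub> y) s \<oplus>\<^bsub>TM\<^esub> mfrac y s) \<ominus>\<^bsub>TM\<^esub> mfrac y s" by simp
  also have "\<dots> = mfrac (x \<ominus>\<^bsub>M\<^esub> y) s"
    using assms by (simp add: L.M.minus_eq L.M.a_assoc L.M.r_neg)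
  finally show ?thesis .
qed

lemma frac_zero: "s \<in> T \<Longrightarrow> mfrac \<zero>\<^bsub>M\<^esub> s = \<zero>\<^bsub>TM\<^esub>"
  using frac_cancel[of "\<zero>\<^bsub>M\<^esub>" \<one> s] one_T by (simp add: zero_TM)

definition contraction :: "('a \<times> 'a) set set \<Rightarrow> 'a set" where
  "contraction n = {a \<in> carrier R. rfrac a \<one> \<in> n}"

lemma contraction_subset: "contraction n \<subseteq> carrier R"
  by (auto simp: contraction_def)

text \<open>
  An ideal of the localization is determined by its contraction, since fractions with equal numerator
  differ by a unit.
\<close>

lemma rfrac_mem_iff:
  assumes n: "ideal n TR" and a: "a \<in> carrier R" "s \<in> T"
  shows "rfrac a s \<in> n \<longleftrightarrow> a \<in> contraction n"
proof -
  note nI = L.R.ideal_closure[OF n]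
  have 1: "rfrac \<one> s \<otimes>\<^bsub>TR\<^esub> rfrac a \<one> = rfrac a s"
    using a one_T by (simp add: mult_rfrac)
  have "rfrac (s \<otimes> a) s = rfrac a \<one>"
    using a one_T by (subst rfrac_eq_iff) (auto simp: intro!: bexI[of _ "\<one>"])
  then have 2: "rfrac s \<one> \<otimes>\<^bsub>TR\<^esub> rfrac a s = rfrac a \<one>"
    using a one_T by (simp add: mult_rfrac)
  have "rfrac \<one> s \<in> carrier TR" "rfrac s \<one> \<in> carrier TR" using a one_T by auto
  then have "rfrac a s \<in> n \<longleftrightarrow> rfrac a \<one> \<in> n"
    using nI(4)[of "rfrac a \<one>" "rfrac \<one> s"] nI(4)[of "rfrac a s" "rfrac s \<one>"] 1 2 by auto
  then show ?thesis using a by (simp add: contraction_def)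
qed

lemma ideal_contraction:
  assumes n: "ideal n TR"
  shows "ideal (contraction n) R"
proof (rule idealI[OF R.ring_axioms])
  note nI = L.R.ideal_closure[OF n]
  have "rfrac \<zero> \<one> \<in> n" using nI(1) by (simp add: zero_TR)
  then have zero: "\<zero> \<in> contraction n" by (simp add: contraction_def)
  show "x \<otimes> a \<in> contraction n" "a \<otimes> x \<in> contraction n"
    if a: "a \<in> contraction n" and x: "x \<in> carrier R" for a x
  proof -
    have ac: "a \<in> carrier R" "rfrac a \<one> \<in> n" using a by (auto simp: contraction_def)
    have "rfrac x \<one> \<otimes>\<^bsub>TR\<^esub> rfrac a \<one> \<in> n" using nI(4)[OF ac(2)] x one_T by simp
    then show "x \<otimes> a \<in> contraction n" using ac x one_T by (simp add: contraction_def mult_rfrac)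
    then show "a \<otimes> x \<in> contraction n" using ac x by (simp add: R.m_comm)
  qed
  note mult = this(1)
  show "subgroup (contraction n) (add_monoid R)"
  proof (rule R.add.subgroupI)
    show "contraction n \<subseteq> carrier R" by (rule contraction_subset)
    show "contraction n \<noteq> {}" using zero by blast
    show "\<ominus> a \<in> contraction n" if a: "a \<in> contraction n" for a
    proof -
      have "a \<in> carrier R" using a contraction_subset by blast
      then show ?thesis using mult[OF a, of "\<ominus> \<one>"] by (simp add: R.l_minus)
    qed
    show "a \<oplus> b \<in> contraction n" if ab: "a \<in> contraction n" "b \<in> contraction n" for a b
      using ab nI(3)[of "rfrac a \<one>" "rfrac b \<one>"] one_T by (simp add: contraction_def add_rfrac_same)
  qed
qed

lemma contraction_disjoint:
  assumes n: "n \<in> mSpec TR" and s: "s \<in> T"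
  shows "s \<notin> contraction n"
proof
  note nI = L.R.mSpecD[OF n]
  assume "s \<in> contraction n"
  then have "rfrac s s \<in> n" using rfrac_mem_iff[OF nI(2) _ s] s by auto
  moreover have "rfrac s s = \<one>\<^bsub>TR\<^esub>"
    using s one_T unfolding one_TR by (subst rfrac_eq_iff) auto
  ultimately show False using nI(4) by simp
qed

end

locale localization_at_ge2 = localization R M T
  for R :: "('a, 'r) ring_scheme" (structure) and M :: "('a, 'b, 'm) module_scheme" and T +
  assumes fg: "finitely_generated_module R M"
    and T_eq: "T = carrier R - \<Union>(mSpec_ge2 R M)"
begin

lemma mSpec_ge2_mSpec: "m \<in> mSpec_ge2 R M \<Longrightarrow> m \<in> mSpec R"
  by (simp add: mSpec_ge2_def)

text \<open>
  The elements of \<open>T\<close> lie in no ideal of \<open>mSpec_ge2 R M\<close>, and these are all the maximal ideals above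
  their intersection. It matters later that \<open>r\<close> does not depend on \<open>m\<close>.
\<close>

lemma inverse_mod_mSpec_ge2:
  assumes s: "s \<in> T"
  shows "\<exists>r\<in>carrier R. \<forall>m\<in>mSpec_ge2 R M. \<one> \<ominus> r \<otimes> s \<in> m"
proof (cases "mSpec_ge2 R M = {}")
  case True
  then show ?thesis by auto
next
  case False
  have sc: "s \<in> carrier R" using s by blast
  have "\<exists>a\<in>PIdl s. \<exists>j\<in>\<Inter>(mSpec_ge2 R M). \<one> = a \<oplus> j"
  proof (rule ccontr)
    assume "\<not> ?thesis"
    then have "\<exists>m\<in>mSpec_ge2 R M. PIdl s \<subseteq> m"
      using R.cgenideal_ideal[OF sc] False by (intro ex_mSpec_ge2_above_ideal[OF fg]) blast+
    then show False using R.cgenideal_self[OF sc] s by (auto simp: T_eq)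
  qed
  then obtain r j where h: "r \<in> carrier R" "j \<in> \<Inter>(mSpec_ge2 R M)" "\<one> = r \<otimes> s \<oplus> j"
    unfolding cgenideal_def by blast
  have j: "j \<in> carrier R"
    using h(2) False R.mSpecD(5)[OF mSpec_ge2_mSpec] by blast
  have "(r \<otimes> s \<oplus> j) \<ominus> r \<otimes> s = j" using h(1) sc j by algebra
  then have "\<one> \<ominus> r \<otimes> s = j" using h(3) by simp
  then show ?thesis using h(1,2) by auto
qed

text \<open>
  The contraction avoids \<open>T\<close>, hence lies in the union of \<open>mSpec_ge2 R M\<close>. For infinite
  \<open>mSpec_ge2 R M\<close> this alone does not put it into a single one of these ideals. But each of its
  elements lies in some ideal of \<open>mSpec_ge2 R M\<close>, which also contains the intersection \<open>J\<close> of all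
  of them. So no sum of an element of the contraction and one of \<open>J\<close> is \<open>\<one>\<close>, and some \<open>m\<close> in
  \<open>mSpec_ge2 R M\<close> contains the contraction. The two are equal: an element \<open>a\<close> of
  \<open>m\<close> outside the contraction would have an inverse \<open>c/s\<close> modulo \<open>n\<close>, and then \<open>s - c a\<close> and
  \<open>s\<close> would lie in \<open>m\<close>.
\<close>

lemma contraction_mSpec_ge2:
  assumes n: "n \<in> mSpec TR"
  shows "contraction n \<in> mSpec_ge2 R M"
proof -
  note nI = L.R.mSpecD[OF n]
  note pI = R.ideal_closure[OF ideal_contraction[OF nI(2)]]
  have mem: "\<exists>m\<in>mSpec_ge2 R M. a \<in> m" if a: "a \<in> contraction n" for a
    using contraction_disjoint[OF n, of a] a pI(6)[OF a] by (auto simp: T_eq)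
  have "\<exists>m\<in>mSpec_ge2 R M. contraction n \<subseteq> m"
  proof (rule ex_mSpec_ge2_above_ideal[OF fg ideal_contraction[OF nI(2)]])
    show "mSpec_ge2 R M \<noteq> {}" using mem[OF pI(1)] by blast
    fix a j assume a: "a \<in> contraction n" and j: "j \<in> \<Inter>(mSpec_ge2 R M)"
    obtain m where m: "m \<in> mSpec_ge2 R M" "a \<in> m" using mem[OF a] by blast
    then have "a \<oplus> j \<in> m" using R.ideal_closure(3)[OF R.mSpecD(2)[OF mSpec_ge2_mSpec[OF m(1)]]] j by blast
    then show "\<one> \<noteq> a \<oplus> j" using R.mSpecD(4)[OF mSpec_ge2_mSpec[OF m(1)]] by auto
  qed
  then obtain m where m: "m \<in> mSpec_ge2 R M" "contraction n \<subseteq> m" by blast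
  note mI = R.mSpecD[OF mSpec_ge2_mSpec[OF m(1)]]
  have "a \<in> contraction n" if a: "a \<in> m" for a
  proof (rule ccontr)
    assume an: "a \<notin> contraction n"
    have ac: "a \<in> carrier R" using a mI(5) by blast
    then have "rfrac a \<one> \<in> carrier TR" "rfrac a \<one> \<notin> n"
      using an one_T by (auto simp: contraction_def)
    then obtain C where C: "C \<in> carrier TR" "\<one>\<^bsub>TR\<^esub> \<ominus>\<^bsub>TR\<^esub> C \<otimes>\<^bsub>TR\<^esub> rfrac a \<one> \<in> n"
      using L.R.inverse_mod_maximal[OF n] by blast
    then obtain c s where c: "C = rfrac c s" "c \<in> carrier R" "s \<in> T" by (auto simp: carrier_TR)
    have "\<one>\<^bsub>TR\<^esub> = rfrac s s"
      using c one_T unfolding one_TR by (subst rfrac_eq_iff) auto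
    then have "rfrac (s \<ominus> c \<otimes> a) s \<in> n"
      using C(2) c ac one_T by (simp add: mult_rfrac minus_rfrac_same)
    then have "s \<ominus> c \<otimes> a \<in> m"
      using rfrac_mem_iff[OF nI(2) _ c(3)] c ac m(2) by auto
    then have "(s \<ominus> c \<otimes> a) \<oplus> c \<otimes> a \<in> m"
      using R.ideal_closure(3,4)[OF mI(2)] a c(2) by blast
    moreover have "(s \<ominus> c \<otimes> a) \<oplus> c \<otimes> a = s"
      using c ac by (simp add: R.minus_eq R.a_assoc R.l_neg)
    ultimately show False using c(3) m(1) by (auto simp: T_eq)
  qed
  then have "contraction n = m" using m(2) by blast
  then show ?thesis using m(1) by simp
qed

section \<open>Residue modules of the localization\<close>

context
  fixes n
  assumes n: "n \<in> mSpec TR"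
begin

lemma contraction_mSpec: "contraction n \<in> mSpec R"
  using contraction_mSpec_ge2[OF n] by (rule mSpec_ge2_mSpec)

interpretation p: module_ideal R M "contraction n"
  by (rule vectorspace_residue_module(2)[OF module_axioms contraction_mSpec])

interpretation q: module_ideal TR TM n
  by (rule vectorspace_residue_module(2)[OF L.module_axioms n])

lemmas pI = R.ideal_closure[OF R.mSpecD(2)[OF contraction_mSpec]]

lemma frac_in_ideal_smult:
  assumes "x \<in> p.N" "t \<in> T"
  shows "mfrac x t \<in> q.N"
  using assms(1) p.gens_subset unfolding ideal_smult_def[of R]
proof (induction rule: span_induct)
  case zero
  then show ?case using q.N_closed(1) assms(2) by (simp add: frac_zero)
next
  case (base y)
  then obtain a x where h: "y = a \<odot>\<^bsub>M\<^esub> x" "a \<in> contraction n" "x \<in> carrier M" by blast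
  have ac: "a \<in> carrier R" using h pI(6) by blast
  have "rfrac a t \<in> n" using rfrac_mem_iff[OF q.is_ideal ac assms(2)] h by simp
  then have "rfrac a t \<odot>\<^bsub>TM\<^esub> mfrac x \<one> \<in> q.N" using h one_T by (intro q.smult_in_N) auto
  then show ?case using h ac assms(2) one_T by (simp add: smult_frac)
next
  case (add x y)
  have "x \<in> carrier M" "y \<in> carrier M" using add(1,2) span_closure(5)[OF p.gens_subset] by blast+
  then show ?case using q.N_closed(2)[OF add(3,4)] assms(2) by (simp add: add_frac_same)
next
  case (smult a x)
  have x: "x \<in> carrier M" using smult(2) span_closure(5)[OF p.gens_subset] by blast
  have "rfrac a \<one> \<odot>\<^bsub>TM\<^esub> mfrac x t \<in> q.N"
    using q.N_closed(3)[OF _ smult(3)] smult(1) one_T by blast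
  then show ?case using x smult(1) assms(2) one_T by (simp add: smult_frac)
qed

lemma ideal_smult_fracE:
  assumes "z \<in> q.N"
  shows "\<exists>x\<in>p.N. \<exists>t\<in>T. z = mfrac x t"
  using assms q.gens_subset unfolding ideal_smult_def[of TR]
proof (induction rule: L.span_induct)
  case zero
  then show ?case using p.N_closed(1) one_T zero_TM by blast
next
  case (base z)
  then obtain C Y where CY: "z = C \<odot>\<^bsub>TM\<^esub> Y" "C \<in> n" "Y \<in> carrier TM" by blast
  then have "C \<in> carrier TR" using L.R.ideal_closure(6)[OF q.is_ideal] by blast
  then obtain a s y t where h: "C = rfrac a s" "a \<in> carrier R" "s \<in> T"
    "Y = mfrac y t" "y \<in> carrier M" "t \<in> T" using CY(3) by (auto simp: carrier_TR carrier_TM)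
  have "a \<in> contraction n" using rfrac_mem_iff[OF q.is_ideal h(2,3)] CY(2) h(1) by simp
  then have "a \<odot>\<^bsub>M\<^esub> y \<in> p.N" using h by (intro p.smult_in_N)
  moreover have "z = mfrac (a \<odot>\<^bsub>M\<^esub> y) (s \<otimes> t)" using h CY(1) by (simp add: smult_frac)
  ultimately show ?case using mult_T h by blast
next
  case (add z w)
  then obtain x s y t where h: "x \<in> p.N" "s \<in> T" "z = mfrac x s" "y \<in> p.N" "t \<in> T" "w = mfrac y t"
    by blast
  have "z \<oplus>\<^bsub>TM\<^esub> w = mfrac (t \<odot>\<^bsub>M\<^esub> x \<oplus>\<^bsub>M\<^esub> s \<odot>\<^bsub>M\<^esub> y) (s \<otimes> t)"
    using h p.N_closed(5) by (simp add: add_frac)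
  moreover have "t \<odot>\<^bsub>M\<^esub> x \<oplus>\<^bsub>M\<^esub> s \<odot>\<^bsub>M\<^esub> y \<in> p.N"
    using h by (intro p.N_closed(2) p.N_closed(3)) auto
  ultimately show ?case using mult_T h by blast
next
  case (smult C z)
  then obtain a s x t where h: "C = rfrac a s" "a \<in> carrier R" "s \<in> T" "z = mfrac x t" "x \<in> p.N" "t \<in> T"
    by (auto simp: carrier_TR)
  have "C \<odot>\<^bsub>TM\<^esub> z = mfrac (a \<odot>\<^bsub>M\<^esub> x) (s \<otimes> t)" using h p.N_closed(5) by (simp add: smult_frac)
  then show ?case using mult_T h p.N_closed(3) by blast
qed

text \<open>
  If \<open>x/1\<close> lies in \<open>n T^-1 M\<close>, then \<open>s x\<close> lies in \<open>contraction n M\<close> for some \<open>s \<in> T\<close>; as \<open>s\<close>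
  is invertible modulo the maximal ideal \<open>contraction n\<close>, so does \<open>x\<close>.
\<close>

lemma frac_one_in_ideal_smult_iff:
  assumes x: "x \<in> carrier M"
  shows "mfrac x \<one> \<in> q.N \<longleftrightarrow> x \<in> p.N"
proof
  assume "mfrac x \<one> \<in> q.N"
  then obtain y t where y: "y \<in> p.N" "t \<in> T" "mfrac x \<one> = mfrac y t" using ideal_smult_fracE by blast
  then obtain u where u: "u \<in> T" "u \<odot>\<^bsub>M\<^esub> (t \<odot>\<^bsub>M\<^esub> x) = u \<odot>\<^bsub>M\<^esub> (\<one> \<odot>\<^bsub>M\<^esub> y)"
    using frac_eq_iff[OF x p.N_closed(5)[OF y(1)] one_T y(2)] by blast
  define s where "s = u \<otimes> t"
  have s: "s \<in> T" "s \<in> carrier R" using u y mult_T by (auto simp: s_def)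
  have "s \<odot>\<^bsub>M\<^esub> x = u \<odot>\<^bsub>M\<^esub> y"
    using u y x p.N_closed(5) by (simp add: s_def smult_assoc1)
  then have sx: "s \<odot>\<^bsub>M\<^esub> x \<in> p.N" using p.N_closed(3)[OF _ y(1)] u(1) by simp
  obtain b where b: "b \<in> carrier R" "\<one> \<ominus> b \<otimes> s \<in> contraction n"
    using R.inverse_mod_maximal[OF contraction_mSpec s(2) contraction_disjoint[OF n s(1)]] by blast
  have "x = (\<one> \<ominus> b \<otimes> s) \<odot>\<^bsub>M\<^esub> x \<oplus>\<^bsub>M\<^esub> b \<odot>\<^bsub>M\<^esub> (s \<odot>\<^bsub>M\<^esub> x)"
    using x b(1) s(2)
    by (simp add: smult_assoc1[symmetric] smult_l_distr[symmetric] R.minus_eq R.a_assoc R.l_neg)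
  also have "\<dots> \<in> p.N"
    using p.N_closed(2)[OF p.smult_in_N[OF b(2) x] p.N_closed(3)[OF b(1) sx]] .
  finally show "x \<in> p.N" .
qed (rule frac_in_ideal_smult[OF _ one_T])

text \<open>
  The maps on residue fields and residue spaces that \<open>r \<mapsto> r/1\<close> and \<open>x \<mapsto> x/1\<close> induce. The lemmas
  \<open>residue_ring_map_coset\<close> and \<open>residue_map_coset\<close> show that the chosen representative is irrelevant.
\<close>

definition residue_ring_map :: "'a set \<Rightarrow> ('a \<times> 'a) set set" where
  "residue_ring_map C = n +>\<^bsub>TR\<^esub> rfrac (SOME r. r \<in> carrier R \<and> C = contraction n +> r) \<one>"

definition residue_map :: "'b set \<Rightarrow> ('b \<times> 'a) set set" where
  "residue_map C = q.rc (mfrac (SOME x. x \<in> carrier M \<and> C = p.rc x) \<one>)"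

lemma ring_coset_eq_iff:
  assumes "r \<in> carrier R" "r' \<in> carrier R"
  shows "n +>\<^bsub>TR\<^esub> rfrac r \<one> = n +>\<^bsub>TR\<^esub> rfrac r' \<one> \<longleftrightarrow> contraction n +> r = contraction n +> r'"
proof -
  have "rfrac (r \<ominus> r') \<one> \<in> n \<longleftrightarrow> r \<ominus> r' \<in> contraction n"
    using rfrac_mem_iff[OF q.is_ideal _ one_T] assms by simp
  then show ?thesis
    using assms one_T by (simp add: q.ideal_coset_eq_iff p.ideal_coset_eq_iff minus_rfrac_same)
qed

lemma coset_eq_iff:
  assumes "x \<in> carrier M" "x' \<in> carrier M"
  shows "q.rc (mfrac x \<one>) = q.rc (mfrac x' \<one>) \<longleftrightarrow> p.rc x = p.rc x'"
proof -
  have "mfrac (x \<ominus>\<^bsub>M\<^esub> x') \<one> \<in> q.N \<longleftrightarrow> x \<ominus>\<^bsub>M\<^esub> x' \<in> p.N"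
    using frac_one_in_ideal_smult_iff assms by simp
  then show ?thesis
    using assms one_T by (simp add: q.rc_eq_iff p.rc_eq_iff minus_frac_same)
qed

lemma residue_ring_map_coset:
  assumes "r \<in> carrier R"
  shows "residue_ring_map (contraction n +> r) = n +>\<^bsub>TR\<^esub> rfrac r \<one>"
proof -
  let ?r = "SOME r'. r' \<in> carrier R \<and> contraction n +> r = contraction n +> r'"
  have "?r \<in> carrier R \<and> contraction n +> r = contraction n +> ?r"
    by (rule someI[of _ r]) (use assms in simp)
  then show ?thesis using ring_coset_eq_iff[of ?r r] assms by (simp add: residue_ring_map_def)
qed

lemma residue_map_coset:
  assumes "x \<in> carrier M"
  shows "residue_map (p.rc x) = q.rc (mfrac x \<one>)"
proof -
  let ?x = "SOME x'. x' \<in> carrier M \<and> p.rc x = p.rc x'"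
  have "?x \<in> carrier M \<and> p.rc x = p.rc ?x"
    by (rule someI[of _ x]) (use assms in simp)
  then show ?thesis using coset_eq_iff[of ?x x] assms by (simp add: residue_map_def)
qed

lemma ring_coset_of_inverse:
  assumes a: "a \<in> carrier R" and s: "s \<in> T" and r: "r \<in> carrier R" "\<one> \<ominus> r \<otimes> s \<in> contraction n"
  shows "n +>\<^bsub>TR\<^esub> rfrac a s = n +>\<^bsub>TR\<^esub> rfrac (r \<otimes> a) \<one>"
proof -
  have sc: "s \<in> carrier R" using s by blast
  have "rfrac (r \<otimes> a) \<one> = rfrac (s \<otimes> (r \<otimes> a)) s"
    using a s r(1) one_T by (subst rfrac_eq_iff) (auto intro!: bexI[of _ "\<one>"])
  then have "rfrac a s \<ominus>\<^bsub>TR\<^esub> rfrac (r \<otimes> a) \<one> = rfrac (a \<ominus> s \<otimes> (r \<otimes> a)) s"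
    using a s r(1) by (simp add: minus_rfrac_same)
  moreover have "a \<ominus> s \<otimes> (r \<otimes> a) = (\<one> \<ominus> r \<otimes> s) \<otimes> a" using a sc r(1) by algebra
  moreover have "(\<one> \<ominus> r \<otimes> s) \<otimes> a \<in> contraction n" using pI(5)[OF r(2) a] .
  ultimately have "rfrac a s \<ominus>\<^bsub>TR\<^esub> rfrac (r \<otimes> a) \<one> \<in> n"
    using rfrac_mem_iff[OF q.is_ideal _ s, of "(\<one> \<ominus> r \<otimes> s) \<otimes> a"] pI(6) by simp
  then show ?thesis using a s r(1) one_T by (simp add: q.ideal_coset_eq_iff)
qed

text \<open>
  Modulo \<open>n\<close>, division by \<open>s\<close> is multiplication by \<open>r\<close>. Hence every residue class of the localization
  comes from \<open>M\<close>.
\<close>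

lemma coset_of_inverse:
  assumes x: "x \<in> carrier M" and s: "s \<in> T" and r: "r \<in> carrier R" "\<one> \<ominus> r \<otimes> s \<in> contraction n"
  shows "q.rc (mfrac x s) = q.rc (mfrac (r \<odot>\<^bsub>M\<^esub> x) \<one>)"
proof -
  have sc: "s \<in> carrier R" using s by blast
  have "mfrac (r \<odot>\<^bsub>M\<^esub> x) \<one> = mfrac (s \<odot>\<^bsub>M\<^esub> (r \<odot>\<^bsub>M\<^esub> x)) s"
    using frac_cancel[of "r \<odot>\<^bsub>M\<^esub> x" \<one> s] x s r(1) one_T by simp
  then have "mfrac x s \<ominus>\<^bsub>TM\<^esub> mfrac (r \<odot>\<^bsub>M\<^esub> x) \<one> = mfrac (x \<ominus>\<^bsub>M\<^esub> s \<odot>\<^bsub>M\<^esub> (r \<odot>\<^bsub>M\<^esub> x)) s"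
    using x s r(1) by (simp add: minus_frac_same)
  moreover have "x \<ominus>\<^bsub>M\<^esub> s \<odot>\<^bsub>M\<^esub> (r \<odot>\<^bsub>M\<^esub> x) = (\<one> \<ominus> r \<otimes> s) \<odot>\<^bsub>M\<^esub> x"
    using x sc r(1)
    by (simp add: R.minus_eq M.minus_eq smult_l_distr smult_l_minus smult_assoc1[symmetric] R.m_comm)
  ultimately have "mfrac x s \<ominus>\<^bsub>TM\<^esub> mfrac (r \<odot>\<^bsub>M\<^esub> x) \<one> \<in> q.N"
    using frac_in_ideal_smult[OF p.smult_in_N[OF r(2) x] s] by simp
  then show ?thesis using x s r(1) one_T by (simp add: q.rc_eq_iff)
qed

lemma semilinear_bijection_residue_map:
  "semilinear_bijection (R Quot contraction n) (residue_module R M (contraction n))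
     (TR Quot n) (residue_module TR TM n) residue_ring_map residue_map"
proof (intro semilinear_bijection.intro semilinear_bijection_axioms.intro)
  show "vectorspace (R Quot contraction n) p.RM" "vectorspace (TR Quot n) q.RM"
    by (rule vectorspace_residue_module(1)[OF module_axioms contraction_mSpec]
        vectorspace_residue_module(1)[OF L.module_axioms n])+
  show "residue_ring_map \<in> ring_hom (R Quot contraction n) (TR Quot n)"
  proof (rule ring_hom_memI)
    fix C assume "C \<in> carrier (R Quot contraction n)"
    then obtain r where r: "r \<in> carrier R" "C = contraction n +> r" by (auto simp: p.carrier_quot)
    then show "residue_ring_map C \<in> carrier (TR Quot n)"
      using one_T by (simp add: residue_ring_map_coset q.carrier_quot)
    fix D assume "D \<in> carrier (R Quot contraction n)"
    then obtain s where s: "s \<in> carrier R" "D = contraction n +> s" by (auto simp: p.carrier_quot)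
    show "residue_ring_map (C \<otimes>\<^bsub>R Quot contraction n\<^esub> D) =
        residue_ring_map C \<otimes>\<^bsub>TR Quot n\<^esub> residue_ring_map D"
      "residue_ring_map (C \<oplus>\<^bsub>R Quot contraction n\<^esub> D) =
        residue_ring_map C \<oplus>\<^bsub>TR Quot n\<^esub> residue_ring_map D"
      using r s one_T
      by (simp_all add: residue_ring_map_coset p.quot_simps q.quot_simps mult_rfrac add_rfrac_same)
  next
    show "residue_ring_map \<one>\<^bsub>R Quot contraction n\<^esub> = \<one>\<^bsub>TR Quot n\<^esub>"
      unfolding p.quot_simps(3) q.quot_simps(3) by (simp add: residue_ring_map_coset one_TR)
  qed
  show "bij_betw residue_ring_map (carrier (R Quot contraction n)) (carrier (TR Quot n))"
    unfolding bij_betw_def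
  proof (intro conjI equalityI subsetI)
    show "inj_on residue_ring_map (carrier (R Quot contraction n))"
    proof (rule inj_onI)
      fix C D assume CD: "C \<in> carrier (R Quot contraction n)" "D \<in> carrier (R Quot contraction n)"
        and eq: "residue_ring_map C = residue_ring_map D"
      obtain r where r: "r \<in> carrier R" "C = contraction n +> r" using CD by (auto simp: p.carrier_quot)
      obtain s where s: "s \<in> carrier R" "D = contraction n +> s" using CD by (auto simp: p.carrier_quot)
      show "C = D" using eq ring_coset_eq_iff[OF r(1) s(1)] r s by (simp add: residue_ring_map_coset)
    qed
    fix C assume "C \<in> residue_ring_map ` carrier (R Quot contraction n)"
    then show "C \<in> carrier (TR Quot n)"
      using one_T by (auto simp: p.carrier_quot q.carrier_quot residue_ring_map_coset)
  next
    fix C assume "C \<in> carrier (TR Quot n)"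
    then obtain a s where h: "a \<in> carrier R" "s \<in> T" "C = n +>\<^bsub>TR\<^esub> rfrac a s"
      by (auto simp: q.carrier_quot carrier_TR)
    obtain r where r: "r \<in> carrier R" "\<one> \<ominus> r \<otimes> s \<in> contraction n"
      using inverse_mod_mSpec_ge2[OF h(2)] contraction_mSpec_ge2[OF n] by blast
    have "C = residue_ring_map (contraction n +> (r \<otimes> a))"
      using ring_coset_of_inverse[OF h(1,2) r] h r(1) by (simp add: residue_ring_map_coset)
    then show "C \<in> residue_ring_map ` carrier (R Quot contraction n)"
      unfolding p.carrier_quot using r(1) h(1) by blast
  qed
  show "bij_betw residue_map (carrier p.RM) (carrier q.RM)"
    unfolding bij_betw_def
  proof (intro conjI equalityI subsetI)
    show "inj_on residue_map (carrier p.RM)"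
    proof (rule inj_onI)
      fix C D assume CD: "C \<in> carrier p.RM" "D \<in> carrier p.RM"
        and eq: "residue_map C = residue_map D"
      obtain x where x: "x \<in> carrier M" "C = p.rc x" using CD by (auto simp: p.carrier_residue_module)
      obtain y where y: "y \<in> carrier M" "D = p.rc y" using CD by (auto simp: p.carrier_residue_module)
      show "C = D" using eq coset_eq_iff[OF x(1) y(1)] x y by (simp add: residue_map_coset)
    qed
    fix C assume "C \<in> residue_map ` carrier p.RM"
    then obtain x where "x \<in> carrier M" "C = residue_map (p.rc x)"
      unfolding p.carrier_residue_module by blast
    then show "C \<in> carrier q.RM"
      using one_T by (simp add: q.carrier_residue_module residue_map_coset)
  next
    fix C assume "C \<in> carrier q.RM"
    then obtain x s where h: "x \<in> carrier M" "s \<in> T" "C = q.rc (mfrac x s)"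
      by (auto simp: q.carrier_residue_module carrier_TM)
    obtain r where r: "r \<in> carrier R" "\<one> \<ominus> r \<otimes> s \<in> contraction n"
      using inverse_mod_mSpec_ge2[OF h(2)] contraction_mSpec_ge2[OF n] by blast
    have "C = residue_map (p.rc (r \<odot>\<^bsub>M\<^esub> x))"
      using coset_of_inverse[OF h(1,2) r] h r(1) by (simp add: residue_map_coset)
    then show "C \<in> residue_map ` carrier p.RM"
      unfolding p.carrier_residue_module using r(1) h(1) by blast
  qed
  fix C assume "C \<in> carrier p.RM"
  then obtain x where x: "x \<in> carrier M" "C = p.rc x" by (auto simp: p.carrier_residue_module)
  show "residue_map (C \<oplus>\<^bsub>p.RM\<^esub> D) = residue_map C \<oplus>\<^bsub>q.RM\<^esub> residue_map D"
    if "D \<in> carrier p.RM" for D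
  proof -
    obtain y where y: "y \<in> carrier M" "D = p.rc y" using \<open>D \<in> carrier p.RM\<close> by (auto simp: p.carrier_residue_module)
    then show ?thesis
      using x one_T
      by (simp add: residue_map_coset p.add_residue_module q.add_residue_module add_frac_same)
  qed
  show "residue_map (k \<odot>\<^bsub>p.RM\<^esub> C) = residue_ring_map k \<odot>\<^bsub>q.RM\<^esub> residue_map C"
    if "k \<in> carrier (R Quot contraction n)" for k
  proof -
    obtain r where r: "r \<in> carrier R" "k = contraction n +> r"
      using \<open>k \<in> carrier (R Quot contraction n)\<close> by (auto simp: p.carrier_quot)
    then show ?thesis
      using x one_T
      by (simp add: residue_map_coset residue_ring_map_coset p.smult_residue_module
          q.smult_residue_module smult_frac)
  qed
qed

lemma mSpec_ge2_localization: "n \<in> mSpec_ge2 TR TM"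
proof -
  interpret sb: semilinear_bijection "R Quot contraction n" "residue_module R M (contraction n)"
    "TR Quot n" "residue_module TR TM n" residue_ring_map residue_map
    by (rule semilinear_bijection_residue_map)
  show ?thesis
    using sb.dim_eq[OF fin_dim_residue_module[OF module_axioms fg contraction_mSpec]]
      contraction_mSpec_ge2[OF n] n
    by (simp add: mSpec_ge2_def)
qed

text \<open>
  Both residue spaces have dimension at least two, so both carry a Zariski topology.
\<close>

lemma homeomorphic_map_residue_topology:
  "homeomorphic_map (residue_topology R M (contraction n)) (residue_topology TR TM n) residue_map"
  using semilinear_bijection.zariski_homeomorphic_map[OF semilinear_bijection_residue_map
      fin_dim_residue_module[OF module_axioms fg contraction_mSpec]]
    contraction_mSpec_ge2[OF n] mSpec_ge2_localization
  by (simp add: residue_topology_def Let_def)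

end

text \<open>
  For surjectivity up to the topology, \<open>x/s\<close> has the same residue classes as \<open>(r x)/1\<close> at all
  maximal ideals simultaneously, because one \<open>r\<close> inverts \<open>s\<close> modulo all of \<open>mSpec_ge2 R M\<close>.
\<close>

lemma initial_topology_comparison:
  "initial_topology_comparison (carrier M) (\<lambda>I x. ideal_smult R M I +>\<^bsub>M\<^esub> x) (residue_topology R M)
     (mSpec R) (carrier TM) (\<lambda>n y. ideal_smult TR TM n +>\<^bsub>TM\<^esub> y) (residue_topology TR TM)
     (mSpec TR) (\<lambda>x. mfrac x \<one>) contraction residue_map"
proof (intro initial_topology_comparison.intro initial_topology_maps.intro
    initial_topology_comparison_axioms.intro)
  show "ideal_smult R M I +>\<^bsub>M\<^esub> x \<in> topspace (residue_topology R M I)"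
    if "I \<in> mSpec R" "x \<in> carrier M" for I x
    using that topspace_residue_topology[OF module_axioms fg]
      module_ideal.carrier_residue_module[OF vectorspace_residue_module(2)[OF module_axioms]] by auto
  show "\<exists>x\<in>carrier M. \<forall>n\<in>mSpec TR. ideal_smult TR TM n +>\<^bsub>TM\<^esub> mfrac x \<one> =
      ideal_smult TR TM n +>\<^bsub>TM\<^esub> y" if y: "y \<in> carrier TM" for y
  proof -
    obtain x s where h: "x \<in> carrier M" "s \<in> T" "y = mfrac x s" using y by (auto simp: carrier_TM)
    obtain r where r: "r \<in> carrier R" "\<And>m. m \<in> mSpec_ge2 R M \<Longrightarrow> \<one> \<ominus> r \<otimes> s \<in> m"
      using inverse_mod_mSpec_ge2[OF h(2)] by blast
    have "ideal_smult TR TM n +>\<^bsub>TM\<^esub> mfrac (r \<odot>\<^bsub>M\<^esub> x) \<one> = ideal_smult TR TM n +>\<^bsub>TM\<^esub> y"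
      if n: "n \<in> mSpec TR" for n
      using coset_of_inverse[OF n h(1,2) r(1) r(2)[OF contraction_mSpec_ge2[OF n]]] h(3) by simp
    then show ?thesis using r(1) h(1) by blast
  qed
  show "ideal_smult TR TM n +>\<^bsub>TM\<^esub> mfrac x \<one> =
      residue_map n (ideal_smult R M (contraction n) +>\<^bsub>M\<^esub> x)"
    if "n \<in> mSpec TR" "x \<in> carrier M" for n x
    using residue_map_coset[OF that] by simp
  show "ideal_smult TR TM n +>\<^bsub>TM\<^esub> y \<in> topspace (residue_topology TR TM n)"
    if n: "n \<in> mSpec TR" and y: "y \<in> carrier TM" for n y
  proof -
    note sb = semilinear_bijection_residue_map[OF n]
    note fd = fin_dim_residue_module[OF module_axioms fg contraction_mSpec[OF n]]
    have "topspace (residue_topology TR TM n) = carrier (residue_module TR TM n)"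
      using mSpec_ge2_localization[OF n]
        vectorspace.topspace_zariski_topology[OF vectorspace_residue_module(1)[OF L.module_axioms n]
          semilinear_bijection.fin_dim_image[OF sb fd]]
      by (simp add: residue_topology_def Let_def)
    then show ?thesis
      using y module_ideal.carrier_residue_module[OF vectorspace_residue_module(2)[OF L.module_axioms n]]
      by simp
  qed
qed (use one_T contraction_mSpec homeomorphic_map_residue_topology residue_approximation in auto)

end

section \<open>The Baire property of the localization\<close>

lemma (in module) localization_outside_mSpec_ge2:
  assumes "T = carrier R - \<Union>(mSpec_ge2 R M)"
  shows "localization R M T"
proof (intro localization.intro localization_axioms.intro module_axioms)
  have m: "m \<in> mSpec R" if "m \<in> mSpec_ge2 R M" for m using that by (simp add: mSpec_ge2_def)
  show "T \<subseteq> carrier R" using assms by blast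
  show "\<one>\<^bsub>R\<^esub> \<in> T" using mSpecD(4)[OF m] by (auto simp: assms)
  show "s \<otimes>\<^bsub>R\<^esub> t \<in> T" if st: "s \<in> T" "t \<in> T" for s t
  proof -
    have sc: "s \<in> carrier R" "t \<in> carrier R" using st by (auto simp: assms)
    have "s \<otimes>\<^bsub>R\<^esub> t \<notin> m" if mS: "m \<in> mSpec_ge2 R M" for m
    proof -
      have "s \<notin> m" "t \<notin> m" using st mS by (auto simp: assms)
      then show ?thesis using primeideal.I_prime[OF mSpecD(3)[OF m[OF mS]] sc] by blast
    qed
    then show ?thesis using sc by (auto simp: assms)
  qed
qed

lemma induced_zariski_topology_eq:
  "induced_zariski_topology R M =
     initial_topology (carrier M) (\<lambda>I x. ideal_smult R M I +>\<^bsub>M\<^esub> x) (residue_topology R M) (mSpec R)"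
  by (simp add: induced_zariski_topology_def initial_topology_def)

theorem proposition3p9:
  fixes R :: "('a, 'r) ring_scheme"
    and M :: "('a, 'b, 'm) module_scheme"
    and \<kappa> :: "'k rel"
    and T :: "'a set"
  assumes "cring R"
    and "module R M"
    and "finitely_generated_module R M"
    and "\<And>I. I \<in> mSpec_ge2 R M \<Longrightarrow> infinite (carrier (R Quot I))"
    and "T = carrier R - \<Union>(mSpec_ge2 R M)"
    and "Card_order \<kappa>" and "infinite (Field \<kappa>)"
    and "kappa_Baire_space \<kappa> (induced_zariski_topology R M)"
  shows "kappa_Baire_space \<kappa>
           (induced_zariski_topology (localization_ring R T) (localization_module R M T))"
proof -
  interpret module R M by fact
  interpret localization_at_ge2 R M T
    by (intro localization_at_ge2.intro localization_at_ge2_axioms.intro localization_outside_mSpec_ge2 assms)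
  show ?thesis
    using initial_topology_comparison.kappa_Baire_transfer[OF initial_topology_comparison] assms(8)
    unfolding induced_zariski_topology_eq by blast
qed

end
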